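(* Let $n\ge 3$ be an integer, $\gamma\in(1,2]$, $\beta>0$ with $\beta\gamma<n$, $q\ge p>1$, and $-\beta\gamma<\sigma_1\le\sigma_2\le 0$. Let $c_1,c_2:\mathbb{R}^n\to(0,\infty)$ be double bounded, and assume the non-subcritical condition $$\frac{n+\sigma_1}{\gamma-1+q}+\frac{n+\sigma_2}{\gamma-1+p}\le\frac{n-\beta\gamma}{\gamma-1}.$$ Let $(u,v)$ be a positive solution of the integral system $$u(x)=c_1(x)W_{\beta,\gamma}(|y|^{\sigma_1}v^q)(x),\qquad v(x)=c_2(x)W_{\beta,\gamma}(|y|^{\sigma_2}u^p)(x),\qquad x\in\mathbb{R}^n.$$ Then $(u,v)$ is an integrable solution if and only if $u,v$ are bounded and decay with the following fast rates as $|x|\to\infty$: $$u(x)\simeq|x|^{-\frac{n-\beta\gamma}{\gamma-1}}$$ and $$\begin{cases} v(x)\simeq|x|^{-\frac{n-\beta\gamma}{\gamma-1}}, & \text{if } p\,\frac{n-\beta\gamma}{\gamma-1}-\sigma_2>n;\\[4pt] v(x)\simeq|x|^{-\frac{n-\beta\gamma}{\gamma-1}}(\ln|x|)^{\frac1{\gamma-1}}, & \text{if } p\,\frac{n-\beta\gamma}{\gamma-1}-\sigma_2=n;\\[4pt] v(x)\simeq|x|^{-\frac{p\frac{n-\beta\gamma}{\gamma-1}-(\beta\gamma+\sigma_2)}{\gamma-1}}, & \text{if } p\,\frac{n-\beta\gamma}{\gamma-1}-\sigma_2<n.\end{cases}$$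
   Context: $B_t(x)\subset\mathbb{R}^n$ is the ball of radius $t$ centered at $x$. The Wolff potential of a nonnegative $f\in L^1_{loc}(\mathbb{R}^n)$ is $$W_{\beta,\gamma}(f)(x)=\int_0^\infty\Big(\frac{\int_{B_t(x)}f(y)\,dy}{t^{n-\beta\gamma}}\Big)^{\frac1{\gamma-1}}\frac{dt}{t}.$$ In the system, $W_{\beta,\gamma}(|y|^{\sigma_1}v^q)$ means the Wolff potential of the function $y\mapsto|y|^{\sigma_1}v(y)^q$, and similarly for the second equation. A function $c$ is double bounded if there is $C>0$ with $C^{-1}\le c(x)\le C$ for all $x\in\mathbb{R}^n$. A positive solution is a pair of positive (finite-valued, measurable) functions on $\mathbb{R}^n$ satisfying the system. A positive solution $(u,v)$ is an integrable solution if $(u,v)\in L^{r_0}(\mathbb{R}^n)\times L^{s_0}(\mathbb{R}^n)$, where $r_0=n/q_0$, $s_0=n/p_0$ and $$q_0=\frac{\beta\gamma(\gamma-1+q)+(\gamma-1)\sigma_1+\sigma_2q}{pq-(\gamma-1)^2},\qquad p_0=\frac{\beta\gamma(\gamma-1+p)+(\gamma-1)\sigma_2+\sigma_1p}{pq-(\gamma-1)^2}.$$ $f(x)\simeq g(x)$ (as $|x|\to\infty$) means there are constants $k_1,k_2>0$ such that $k_1g(x)\le f(x)\le k_2g(x)$ for all sufficiently large $|x|$. *)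

theory Defs
  imports "HOL-Analysis.Analysis"
begin

(* Real powers of extended nonnegative reals, meant for a positive exponent. *)
definition ennpowr :: "ennreal \<Rightarrow> real \<Rightarrow> ennreal" where
  "ennpowr x a = (if x = \<infinity> then \<infinity> else ennreal (enn2real x powr a))"

(* The potential of a nonnegative measurable f is formed in [0,\<infinity>]; in particular it is
   identically \<infinity> if f is not integrable over some ball. *)
definition wolff_potential ::
    "real \<Rightarrow> real \<Rightarrow> (real ^ 'n \<Rightarrow> real) \<Rightarrow> real ^ 'n \<Rightarrow> ennreal" where
  "wolff_potential \<beta> \<gamma> f x =
     (\<integral>\<^sup>+ t \<in> {0<..}.
        ennpowr ((\<integral>\<^sup>+ y \<in> ball x t. ennreal (f y) \<partial>lebesgue)
                   / ennreal (t powr (real CARD('n) - \<beta> * \<gamma>)))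
                (1 / (\<gamma> - 1))
        * ennreal (1 / t) \<partial>lebesgue)"

definition double_bounded :: "('a \<Rightarrow> real) \<Rightarrow> bool" where
  "double_bounded c \<longleftrightarrow> (\<exists>C>0. \<forall>x. 1 / C \<le> c x \<and> c x \<le> C)"

(* Equality in [0,\<infinity>] at every point, so both potentials are finite everywhere.  At y = 0
   Isabelle's convention 0 powr s = 0 applies, which only affects a null set. *)
definition positive_solution ::
    "real \<Rightarrow> real \<Rightarrow> real \<Rightarrow> real \<Rightarrow> real \<Rightarrow> real \<Rightarrow> (real ^ 'n \<Rightarrow> real) \<Rightarrow> (real ^ 'n \<Rightarrow> real)
       \<Rightarrow> (real ^ 'n \<Rightarrow> real) \<Rightarrow> (real ^ 'n \<Rightarrow> real) \<Rightarrow> bool" where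
  "positive_solution \<beta> \<gamma> p q \<sigma>\<^sub>1 \<sigma>\<^sub>2 c\<^sub>1 c\<^sub>2 u v \<longleftrightarrow>
     u \<in> borel_measurable lebesgue \<and> v \<in> borel_measurable lebesgue \<and>
     (\<forall>x. u x > 0) \<and> (\<forall>x. v x > 0) \<and>
     (\<forall>x. ennreal (u x) =
        ennreal (c\<^sub>1 x) * wolff_potential \<beta> \<gamma> (\<lambda>y. norm y powr \<sigma>\<^sub>1 * v y powr q) x) \<and>
     (\<forall>x. ennreal (v x) =
        ennreal (c\<^sub>2 x) * wolff_potential \<beta> \<gamma> (\<lambda>y. norm y powr \<sigma>\<^sub>2 * u y powr p) x)"

definition q0_exponent :: "real \<Rightarrow> real \<Rightarrow> real \<Rightarrow> real \<Rightarrow> real \<Rightarrow> real \<Rightarrow> real" where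
  "q0_exponent \<beta> \<gamma> p q \<sigma>\<^sub>1 \<sigma>\<^sub>2 =
     (\<beta> * \<gamma> * (\<gamma> - 1 + q) + (\<gamma> - 1) * \<sigma>\<^sub>1 + \<sigma>\<^sub>2 * q) / (p * q - (\<gamma> - 1)\<^sup>2)"

definition p0_exponent :: "real \<Rightarrow> real \<Rightarrow> real \<Rightarrow> real \<Rightarrow> real \<Rightarrow> real \<Rightarrow> real" where
  "p0_exponent \<beta> \<gamma> p q \<sigma>\<^sub>1 \<sigma>\<^sub>2 =
     (\<beta> * \<gamma> * (\<gamma> - 1 + p) + (\<gamma> - 1) * \<sigma>\<^sub>2 + \<sigma>\<^sub>1 * p) / (p * q - (\<gamma> - 1)\<^sup>2)"

definition in_Lp :: "real \<Rightarrow> (real ^ 'n \<Rightarrow> real) \<Rightarrow> bool" where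
  "in_Lp r f \<longleftrightarrow>
     f \<in> borel_measurable lebesgue \<and> integrable lebesgue (\<lambda>x. \<bar>f x\<bar> powr r)"

definition integrable_solution ::
    "real \<Rightarrow> real \<Rightarrow> real \<Rightarrow> real \<Rightarrow> real \<Rightarrow> real \<Rightarrow> (real ^ 'n \<Rightarrow> real) \<Rightarrow> (real ^ 'n \<Rightarrow> real)
       \<Rightarrow> (real ^ 'n \<Rightarrow> real) \<Rightarrow> (real ^ 'n \<Rightarrow> real) \<Rightarrow> bool" where
  "integrable_solution \<beta> \<gamma> p q \<sigma>\<^sub>1 \<sigma>\<^sub>2 c\<^sub>1 c\<^sub>2 u v \<longleftrightarrow>
     positive_solution \<beta> \<gamma> p q \<sigma>\<^sub>1 \<sigma>\<^sub>2 c\<^sub>1 c\<^sub>2 u v \<and>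
     in_Lp (real CARD('n) / q0_exponent \<beta> \<gamma> p q \<sigma>\<^sub>1 \<sigma>\<^sub>2) u \<and>
     in_Lp (real CARD('n) / p0_exponent \<beta> \<gamma> p q \<sigma>\<^sub>1 \<sigma>\<^sub>2) v"

definition same_rate :: "('a::real_normed_vector \<Rightarrow> real) \<Rightarrow> ('a \<Rightarrow> real) \<Rightarrow> bool"
    (infix "\<simeq>" 50) where
  "f \<simeq> g \<longleftrightarrow>
     (\<exists>k\<^sub>1>0. \<exists>k\<^sub>2>0. \<forall>\<^sub>F x in at_infinity. k\<^sub>1 * g x \<le> f x \<and> f x \<le> k\<^sub>2 * g x)"

end

theory Submission
  imports Defs
begin

text \<open>
  Put \<open>\<alpha> = \<beta>\<gamma>\<close>, \<open>s = 1/(\<gamma> - 1)\<close>, \<open>U = u\<^sup>1\<^sup>/\<^sup>s\<close> and \<open>V = v\<^sup>1\<^sup>/\<^sup>s\<close>. Because \<open>\<gamma> \<le> 2\<close> gives \<open>s \<ge> 1\<close>, the Wolff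
  potential is dominated by a power of the Riesz potential, \<open>W f \<le> (I f)\<^sup>s / (n - \<alpha>)\<close>, so \<open>(U, V)\<close> is a
  subsolution of a system with the linear kernel \<open>|x - y|\<close> to the power \<open>\<alpha> - n\<close>; all upper bounds come
  from this system, and the lower bounds from discarding parts of the Wolff integral. The
  scale-invariant rates of \<open>U\<close> and \<open>V\<close> are \<open>A = q\<^sub>0/s\<close> and \<open>B = p\<^sub>0/s\<close>, and the non-subcritical
  condition says \<open>A + B \<le> n - \<alpha>\<close>.

  The upper bounds use the same contraction argument at two places. Writing
  \<open>V\<^sup>Q = V\<^sup>Q\<^sup>-\<^sup>1 V\<close>, smallness of the first factor in a scale-invariant sense makes the potential halve the
  coefficient of the critical power in a bound for \<open>V\<close>, up to a term of better order, and iteration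
  removes the critical power. Applied to decreasing rearrangements near \<open>0\<close>, where smallness comes from
  integrability over \<open>{V > L}\<close>, this yields boundedness. Boundedness and the smallness of the tails
  in \<open>L\<^sup>n\<^sup>/\<^sup>B\<close> then give \<open>U = o(|x|\<^sup>-\<^sup>A)\<close>; this is pointwise smallness at infinity, and a second contraction
  improves the rates enough for one more application of the potentials to produce the fast rates.
\<close>

section \<open>Decreasing rearrangements\<close>

text \<open>At the critical exponents a Riesz potential only reproduces the rate it is given, so
  plain bootstrapping never starts. The factor V^(Q-1), together with the weight, has just the
  scaling for which multiplication followed by the potential maps the critical power for
  \<open>V\<close> to the one for \<open>U\<close>; its smallness turns this into a factor 1/2.
  Bounds therefore have the shape "c times critical plus d times better", and a step is (c, d) ->
  (c/2, d/2 + d0): c tends to 0 while d stays below a fixed level. The start is the weak-type bound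
  from Chebyshev's inequality, so no regularity is presupposed. Rearrangements are used because
  weight, kernel and solution all become powers on the half line, whose exponents add under
  multiplication. A, B < n - \<alpha>, a consequence of A + B <= n - \<alpha> and positivity, keeps
  the critical exponents in the range where the potential maps powers to powers. The order p <= q
  decides that \<open>U\<close> is the component reaching the kernel rate in every case;
  \<open>V\<close> inherits its three cases from the source built from \<open>U\<close>.\<close>

lemma sigma_finite_lebesgue: "sigma_finite_measure (lebesgue :: 'a::euclidean_space measure)"
proof
  obtain A :: "'a set set" where A: "countable A" "A \<subseteq> sets lborel" "\<Union>A = space lborel"
      "\<forall>a\<in>A. emeasure lborel a \<noteq> \<infinity>"
    using lborel.sigma_finite_countable by blast
  show "\<exists>A::'a set set. countable A \<and> A \<subseteq> sets lebesgue \<and> \<Union> A = space lebesgue \<and>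
      (\<forall>a\<in>A. emeasure lebesgue a \<noteq> \<infinity>)"
    using A by (intro exI[of _ A]) auto
qed

lemma measurable_ident_lebesgue: "(\<lambda>x. x) \<in> lebesgue \<rightarrow>\<^sub>M borel"
  by (rule measurable_completion) simp

lemma borel_measurable_lebesgue_of_borel:
  "f \<in> borel_measurable borel \<Longrightarrow> f \<in> borel_measurable lebesgue"
  by (rule measurable_compose[OF measurable_ident_lebesgue])

lemma nn_integral_Fubini_lebesgue:
  fixes F :: "'a::euclidean_space \<times> 'b::euclidean_space \<Rightarrow> ennreal"
  assumes "F \<in> borel_measurable (lebesgue \<Otimes>\<^sub>M lebesgue)"
  shows "(\<integral>\<^sup>+x. \<integral>\<^sup>+y. F (x, y) \<partial>lebesgue \<partial>lebesgue) = (\<integral>\<^sup>+y. \<integral>\<^sup>+x. F (x, y) \<partial>lebesgue \<partial>lebesgue)"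
proof -
  interpret pair_sigma_finite "lebesgue :: 'a measure" "lebesgue :: 'b measure"
    by (intro pair_sigma_finite.intro sigma_finite_lebesgue)
  show ?thesis using Fubini[OF assms] by simp
qed

text \<open>The decreasing rearrangement of \<open>h\<close> is at most \<open>\<phi>\<close>.\<close>

definition rearr_le :: "('a::euclidean_space \<Rightarrow> real) \<Rightarrow> (real \<Rightarrow> real) \<Rightarrow> bool" where
  "rearr_le h \<phi> \<longleftrightarrow> h \<in> borel_measurable lebesgue \<and>
     (\<forall>s>0. emeasure lebesgue {x. \<phi> s < h x} \<le> ennreal s)"

lemma rearr_leD:
  "rearr_le h \<phi> \<Longrightarrow> s > 0 \<Longrightarrow> emeasure lebesgue {x. \<phi> s < h x} \<le> ennreal s"
  by (auto simp: rearr_le_def)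

lemma rearr_le_measurable: "rearr_le h \<phi> \<Longrightarrow> h \<in> borel_measurable lebesgue"
  by (auto simp: rearr_le_def)

lemma sets_superlevel:
  fixes h :: "'a::euclidean_space \<Rightarrow> real"
  assumes "h \<in> borel_measurable lebesgue" shows "{x. c < h x} \<in> sets lebesgue"
proof -
  have "{x \<in> space lebesgue. c < h x} \<in> sets lebesgue"
    using assms by measurable
  then show ?thesis by simp
qed

lemma rearr_le_mono:
  assumes "rearr_le h \<phi>" "g \<in> borel_measurable lebesgue" "\<And>x. g x \<le> h x"
    "\<And>s. s > 0 \<Longrightarrow> \<phi> s \<le> \<psi> s"
  shows "rearr_le g \<psi>"
  unfolding rearr_le_def
proof (intro conjI allI impI)
  fix s :: real assume "s > 0"
  have "{x. \<psi> s < g x} \<subseteq> {x. \<phi> s < h x}"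
  proof safe
    fix x assume "\<psi> s < g x"
    then show "\<phi> s < h x" using assms(3)[of x] assms(4)[OF \<open>s > 0\<close>] by linarith
  qed
  then have "emeasure lebesgue {x. \<psi> s < g x} \<le> emeasure lebesgue {x. \<phi> s < h x}"
    by (intro emeasure_mono sets_superlevel rearr_le_measurable[OF assms(1)])
  also have "\<dots> \<le> ennreal s" by (rule rearr_leD[OF assms(1) \<open>s > 0\<close>])
  finally show "emeasure lebesgue {x. \<psi> s < g x} \<le> ennreal s" .
qed (fact assms(2))

lemma rearr_le_mono_bound:
  "rearr_le h \<phi> \<Longrightarrow> (\<And>s. s > 0 \<Longrightarrow> \<phi> s \<le> \<psi> s) \<Longrightarrow> rearr_le h \<psi>"
  by (rule rearr_le_mono) (auto dest: rearr_le_measurable)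

text \<open>A product exceeds the product of two bounds only where one factor exceeds its own.
  Giving each exceptional set measure s/2 produces the halved arguments, and later the powers of
  2.\<close>

lemma rearr_le_mult:
  assumes h: "rearr_le h \<phi>" and g: "rearr_le g \<psi>"
    and nonneg: "\<And>x. 0 \<le> h x" "\<And>x. 0 \<le> g x" "\<And>s. s > 0 \<Longrightarrow> 0 \<le> \<phi> s" 
  shows "rearr_le (\<lambda>x. h x * g x) (\<lambda>s. \<phi> (s / 2) * \<psi> (s / 2))"
  unfolding rearr_le_def
proof (intro conjI allI impI)
  show "(\<lambda>x. h x * g x) \<in> borel_measurable lebesgue"
    using rearr_le_measurable[OF h] rearr_le_measurable[OF g] by measurable
  fix s :: real assume s: "s > 0"
  have "{x. \<phi> (s/2) * \<psi> (s/2) < h x * g x} \<subseteq> {x. \<phi> (s/2) < h x} \<union> {x. \<psi> (s/2) < g x}"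
  proof
    fix x assume x: "x \<in> {x. \<phi> (s/2) * \<psi> (s/2) < h x * g x}"
    show "x \<in> {x. \<phi> (s/2) < h x} \<union> {x. \<psi> (s/2) < g x}"
    proof (rule ccontr)
      assume "x \<notin> {x. \<phi> (s/2) < h x} \<union> {x. \<psi> (s/2) < g x}"
      then have "h x * g x \<le> \<phi> (s/2) * \<psi> (s/2)"
        using nonneg s by (intro mult_mono) auto
      with x show False by simp
    qed
  qed
  then have "emeasure lebesgue {x. \<phi> (s/2) * \<psi> (s/2) < h x * g x}
      \<le> emeasure lebesgue ({x. \<phi> (s/2) < h x} \<union> {x. \<psi> (s/2) < g x})"
    using rearr_le_measurable[OF h] rearr_le_measurable[OF g]
    by (intro emeasure_mono sets.Un sets_superlevel)
  also have "\<dots> \<le> emeasure lebesgue {x. \<phi> (s/2) < h x} + emeasure lebesgue {x. \<psi> (s/2) < g x}"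
    using rearr_le_measurable[OF h] rearr_le_measurable[OF g]
    by (intro emeasure_subadditive sets_superlevel)
  also have "\<dots> \<le> ennreal (s/2) + ennreal (s/2)"
    using s by (intro add_mono rearr_leD[OF h] rearr_leD[OF g]) auto
  also have "\<dots> = ennreal s" using s by (simp flip: ennreal_plus)
  finally show "emeasure lebesgue {x. \<phi> (s/2) * \<psi> (s/2) < h x * g x} \<le> ennreal s" .
qed

lemma rearr_le_powr:
  assumes h: "rearr_le h \<phi>" and "e \<ge> 0" "\<And>x. 0 \<le> h x" "\<And>s. s > 0 \<Longrightarrow> 0 \<le> \<phi> s"
  shows "rearr_le (\<lambda>x. h x powr e) (\<lambda>s. \<phi> s powr e)"
  unfolding rearr_le_def
proof (intro conjI allI impI)
  show "(\<lambda>x. h x powr e) \<in> borel_measurable lebesgue"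
    using rearr_le_measurable[OF h] by measurable
  fix s :: real assume s: "s > 0"
  have "{x. \<phi> s powr e < h x powr e} \<subseteq> {x. \<phi> s < h x}"
    using assms(2-4) s by (auto simp: not_less[symmetric] intro: powr_mono2 dest!: leD)
      (metis linorder_not_less powr_mono2)
  then have "emeasure lebesgue {x. \<phi> s powr e < h x powr e} \<le> emeasure lebesgue {x. \<phi> s < h x}"
    by (intro emeasure_mono sets_superlevel rearr_le_measurable[OF h])
  also have "\<dots> \<le> ennreal s" by (rule rearr_leD[OF h s])
  finally show "emeasure lebesgue {x. \<phi> s powr e < h x powr e} \<le> ennreal s" .
qed

lemma rearr_le_const:
  "h \<in> borel_measurable lebesgue \<Longrightarrow> (\<And>x. h x \<le> K) \<Longrightarrow> rearr_le h (\<lambda>s. K)"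
  by (simp add: rearr_le_def not_less[symmetric] leD)

lemma rearr_le_indicator:
  assumes "E \<in> sets lebesgue" "emeasure lebesgue E \<le> ennreal \<tau>"
  shows "rearr_le (indicator E) (\<lambda>s. if s < \<tau> then 1 else 0)"
  unfolding rearr_le_def
proof (intro conjI allI impI)
  show "indicator E \<in> borel_measurable lebesgue" using assms by measurable
  fix s :: real assume s: "s > 0"
  show "emeasure lebesgue {x. (if s < \<tau> then 1 else 0) < (indicator E x :: real)} \<le> ennreal s"
  proof (cases "s < \<tau>")
    case True
    have "{x. 1 < (indicator E x :: real)} = {}" by (auto simp: indicator_def)
    with True show ?thesis by simp
  next
    case False
    have "{x. 0 < (indicator E x :: real)} = E" by (auto simp: indicator_def split: if_splits)
    with False have "emeasure lebesgue {x. (if s < \<tau> then 1 else 0) < (indicator E x :: real)} \<le> ennreal \<tau>"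
      using assms by simp
    also have "\<dots> \<le> ennreal s" using False by (intro ennreal_leI) simp
    finally show ?thesis .
  qed
qed

text \<open>The superlevel sets lie in balls around \<open>x\<close>, and \<open>r\<close> below is
  the radius of volume \<open>s\<close>. The bound does not depend on \<open>x\<close>, which makes
  the later estimates uniform in the point.\<close>

lemma rearr_le_norm_powr:
  fixes x :: "'a::euclidean_space"
  assumes \<kappa>: "\<kappa> \<ge> 0"
  shows "rearr_le (\<lambda>y. norm (x - y) powr (-\<kappa>))
           (\<lambda>s. unit_ball_vol DIM('a) powr (\<kappa> / DIM('a)) * s powr (-\<kappa> / DIM('a)))"
  unfolding rearr_le_def
proof (intro conjI allI impI)
  show "(\<lambda>y. norm (x - y) powr (-\<kappa>)) \<in> borel_measurable lebesgue"
    by (rule borel_measurable_lebesgue_of_borel) measurable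
  fix s :: real assume s: "s > 0"
  define \<omega> where "\<omega> = unit_ball_vol DIM('a)"
  define r where "r = (s / \<omega>) powr (1 / DIM('a))"
  have \<omega>: "\<omega> > 0" by (simp add: \<omega>_def)
  have r: "r > 0" using s \<omega> by (simp add: r_def)
  have eq: "\<omega> powr (\<kappa> / DIM('a)) * s powr (-\<kappa> / DIM('a)) = r powr (-\<kappa>)"
    using s \<omega> by (simp add: r_def powr_powr powr_divide powr_minus divide_simps)
  have "{y. r powr (-\<kappa>) < norm (x - y) powr (-\<kappa>)} \<subseteq> ball x r"
  proof
    fix y assume y: "y \<in> {y. r powr (-\<kappa>) < norm (x - y) powr (-\<kappa>)}"
    show "y \<in> ball x r"
    proof (rule ccontr)
      assume "y \<notin> ball x r"
      then have "r \<le> norm (x - y)" by (simp add: dist_norm)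
      then have "norm (x - y) powr (-\<kappa>) \<le> r powr (-\<kappa>)"
        using \<kappa> r by (intro powr_mono2') auto
      with y show False by simp
    qed
  qed
  then have "emeasure lebesgue {y. r powr (-\<kappa>) < norm (x - y) powr (-\<kappa>)} \<le> emeasure lebesgue (ball x r)"
    by (intro emeasure_mono) auto
  also have "\<dots> = ennreal (\<omega> * r ^ DIM('a))"
    using r by (simp add: emeasure_ball \<omega>_def)
  also have "\<omega> * r ^ DIM('a) = s"
    using s \<omega> r by (simp add: r_def powr_powr flip: powr_realpow)
  finally show "emeasure lebesgue {y. unit_ball_vol DIM('a) powr (\<kappa> / DIM('a)) * s powr (-\<kappa> / DIM('a))
      < norm (x - y) powr (-\<kappa>)} \<le> ennreal s"
    using eq by (simp add: \<omega>_def)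
qed

text \<open>Chebyshev's inequality: L^(1/k) embeds in weak L^(1/k). The constant is explicit because
  a small integral must later give a small weak bound.\<close>

lemma rearr_le_of_powr_integral:
  assumes h: "h \<in> borel_measurable lebesgue" "\<And>x. 0 \<le> h x" and k: "k > 0"
    and I: "(\<integral>\<^sup>+x. ennreal (h x powr (1 / k)) \<partial>lebesgue) \<le> ennreal I" and I0: "I > 0"
  shows "rearr_le h (\<lambda>s. I powr k * s powr (-k))"
  unfolding rearr_le_def
proof (intro conjI allI impI)
  fix s :: real assume s: "s > 0"
  define c where "c = I / s"
  have c: "c > 0" using s I0 by (simp add: c_def)
  have hm: "(\<lambda>x. ennreal (h x powr (1/k))) \<in> borel_measurable lebesgue"
    using h(1) by measurable
  have le_set: "{x\<in>space lebesgue. ennreal c \<le> F x} \<in> sets lebesgue"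
    if "F \<in> borel_measurable lebesgue" for F :: "'a \<Rightarrow> ennreal"
    using that by measurable
  have eq: "I powr k * s powr (-k) = c powr k"
    using s I0 by (simp add: c_def powr_divide powr_minus divide_simps)
  have "{x. c powr k < h x} \<subseteq> {x\<in>space lebesgue. ennreal c \<le> ennreal (h x powr (1/k))}"
  proof safe
    fix x assume "c powr k < h x"
    then have "(c powr k) powr (1/k) \<le> h x powr (1/k)"
      using k by (intro powr_mono2) auto
    then show "ennreal c \<le> ennreal (h x powr (1/k))"
      using k c by (simp add: powr_powr ennreal_leI)
  qed auto
  then have "emeasure lebesgue {x. c powr k < h x}
      \<le> emeasure lebesgue {x\<in>space lebesgue. ennreal c \<le> ennreal (h x powr (1/k))}"
    by (intro emeasure_mono le_set hm)
  also have "\<dots> = emeasure lebesgue {x\<in>UNIV. 1 \<le> ennreal (1/c) * ennreal (h x powr (1/k))}"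
  proof -
    have "ennreal c \<le> ennreal t \<longleftrightarrow> 1 \<le> ennreal (1/c) * ennreal t" if "t \<ge> 0" for t
    proof -
      have 1: "ennreal (1/c) * ennreal t = ennreal (t / c)"
        using c that ennreal_mult[of "1/c" t] by simp
      have "ennreal 1 \<le> ennreal (t / c) \<longleftrightarrow> 1 \<le> t / c"
        using c that by (intro ennreal_le_iff) simp
      moreover have "ennreal c \<le> ennreal t \<longleftrightarrow> c \<le> t"
        using that by (intro ennreal_le_iff) simp
      moreover have "1 \<le> t / c \<longleftrightarrow> c \<le> t"
        using c by (simp add: le_divide_eq)
      ultimately show ?thesis unfolding 1 by simp
    qed
    then show ?thesis by simp
  qed
  also have "\<dots> \<le> ennreal (1/c) * (\<integral>\<^sup>+x. ennreal (h x powr (1/k)) * indicator UNIV x \<partial>lebesgue)"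
    using hm by (intro nn_integral_Markov_inequality) auto
  also have "\<dots> \<le> ennreal (1/c) * ennreal I"
    using I by (intro mult_left_mono) auto
  also have "\<dots> = ennreal (1/c * I)" using c I0 by (subst ennreal_mult) auto
  also have "1/c * I = s" using s I0 by (simp add: c_def)
  finally show "emeasure lebesgue {x. I powr k * s powr (-k) < h x} \<le> ennreal s"
    unfolding eq .
qed (fact h(1))

section \<open>Layer-cake comparison and integrals of power bounds\<close>

lemma nn_integral_layer_cake:
  fixes h :: "'a::euclidean_space \<Rightarrow> real"
  assumes h: "h \<in> borel_measurable lebesgue" "\<And>x. 0 \<le> h x"
  shows "(\<integral>\<^sup>+x. ennreal (h x) \<partial>lebesgue) =
    (\<integral>\<^sup>+l. emeasure lebesgue {x. l < h x} * indicator {0..} l \<partial>lebesgue)"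
proof -
  define F :: "'a \<times> real \<Rightarrow> ennreal" where "F = (\<lambda>z. indicator {z. 0 \<le> snd z \<and> snd z < h (fst z)} z)"
  have hf: "(\<lambda>z::'a\<times>real. h (fst z)) \<in> borel_measurable (lebesgue \<Otimes>\<^sub>M lebesgue)"
    using h(1) by measurable
  have sf: "(\<lambda>z::'a\<times>real. snd z) \<in> borel_measurable (lebesgue \<Otimes>\<^sub>M lebesgue)"
    by (rule measurable_compose[OF measurable_snd measurable_ident_lebesgue])
  have F: "F \<in> borel_measurable (lebesgue \<Otimes>\<^sub>M lebesgue)"
    unfolding F_def
  proof (rule borel_measurable_indicator)
    have "{z \<in> space (lebesgue \<Otimes>\<^sub>M lebesgue). 0 \<le> snd z \<and> snd z < h (fst z)} \<in> sets (lebesgue \<Otimes>\<^sub>M lebesgue)"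
      using hf sf by measurable
    then show "{z::'a\<times>real. 0 \<le> snd z \<and> snd z < h (fst z)} \<in> sets (lebesgue \<Otimes>\<^sub>M lebesgue)"
      by (simp add: space_pair_measure)
  qed
  have "(\<integral>\<^sup>+x. ennreal (h x) \<partial>lebesgue) = (\<integral>\<^sup>+x. \<integral>\<^sup>+l. F (x, l) \<partial>lebesgue \<partial>lebesgue)"
  proof (rule nn_integral_cong)
    fix x :: 'a
    have "(\<integral>\<^sup>+l. F (x, l) \<partial>lebesgue) = (\<integral>\<^sup>+l. indicator {0..<h x} l \<partial>lebesgue)"
      by (intro nn_integral_cong) (auto simp: F_def indicator_def)
    also have "\<dots> = ennreal (h x)" using h(2)[of x] by simp
    finally show "ennreal (h x) = (\<integral>\<^sup>+l. F (x, l) \<partial>lebesgue)" by simp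
  qed
  also have "\<dots> = (\<integral>\<^sup>+l. \<integral>\<^sup>+x. F (x, l) \<partial>lebesgue \<partial>lebesgue)"
    by (rule nn_integral_Fubini_lebesgue[OF F])
  also have "\<dots> = (\<integral>\<^sup>+l. emeasure lebesgue {x. l < h x} * indicator {0..} l \<partial>lebesgue)"
  proof (rule nn_integral_cong)
    fix l :: real
    have "(\<integral>\<^sup>+x. F (x, l) \<partial>lebesgue) = (\<integral>\<^sup>+x. indicator {x. l < h x} x * indicator {0..} l \<partial>lebesgue)"
      by (intro nn_integral_cong) (auto simp: F_def indicator_def)
    also have "\<dots> = emeasure lebesgue {x. l < h x} * indicator {0..} l"
      using sets_superlevel[OF h(1), of l] by (simp add: nn_integral_multc)
    finally show "(\<integral>\<^sup>+x. F (x, l) \<partial>lebesgue) = emeasure lebesgue {x. l < h x} * indicator {0..} l" .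
  qed
  finally show ?thesis .
qed

text \<open>By the layer-cake formula it is enough to compare distribution functions level by level.
  \<open>\<phi>\<close> may fail to be monotone, so the comparison looks for one good
  \<open>s\<close> at most slightly above the measure \<open>m\<close> of the level set of
  \<open>\<phi>\<close>.\<close>

lemma nn_integral_rearr_le:
  fixes h :: "'a::euclidean_space \<Rightarrow> real"
  assumes h: "rearr_le h \<phi>" "\<And>x. 0 \<le> h x"
    and \<phi>: "\<phi> \<in> borel_measurable borel" "\<And>s. s > 0 \<Longrightarrow> 0 \<le> \<phi> s"
  shows "(\<integral>\<^sup>+x. ennreal (h x) \<partial>lebesgue) \<le> (\<integral>\<^sup>+s. ennreal (\<phi> s) * indicator {0<..} s \<partial>lborel)"
proof -
  define f where "f = (\<lambda>s. if s > 0 then \<phi> s else 0)"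
  have fm: "f \<in> borel_measurable lebesgue"
    unfolding f_def using \<phi>(1) by (intro borel_measurable_lebesgue_of_borel measurable_If) auto
  have f0: "0 \<le> f s" for s using \<phi>(2) by (simp add: f_def)
  have "(\<integral>\<^sup>+x. ennreal (h x) \<partial>lebesgue) =
      (\<integral>\<^sup>+l. emeasure lebesgue {x. l < h x} * indicator {0..} l \<partial>lebesgue)"
    by (rule nn_integral_layer_cake[OF rearr_le_measurable[OF h(1)] h(2)])
  also have "\<dots> \<le> (\<integral>\<^sup>+l. emeasure lebesgue {s. l < f s} * indicator {0..} l \<partial>lebesgue)"
  proof (rule nn_integral_mono)
    fix l :: real
    show "emeasure lebesgue {x. l < h x} * indicator {0..} l \<le> emeasure lebesgue {s. l < f s} * indicator {0..} l"
    proof (cases "l \<ge> 0")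
      case True
      have key: "emeasure lebesgue {x. l < h x} \<le> ennreal s" if "s > 0" "\<phi> s \<le> l" for s
      proof -
        have "emeasure lebesgue {x. l < h x} \<le> emeasure lebesgue {x. \<phi> s < h x}"
          using that by (intro emeasure_mono sets_superlevel rearr_le_measurable[OF h(1)]) auto
        then show ?thesis using rearr_leD[OF h(1) \<open>s > 0\<close>] by simp
      qed
      have "emeasure lebesgue {x. l < h x} \<le> emeasure lebesgue {s. l < f s}"
      proof (rule ennreal_le_epsilon)
        fix e :: real
        assume fin: "emeasure lebesgue {s. l < f s} < top" and e: "0 < e"
        define m where "m = measure lebesgue {s. l < f s}"
        have m: "emeasure lebesgue {s. l < f s} = ennreal m"
          using fin by (simp add: m_def emeasure_eq_ennreal_measure)
        have m0: "m \<ge> 0" by (simp add: m_def)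
        \<comment> \<open>Otherwise the interval up to \<open>m + e\<close> would lie in a set of
          measure \<open>m\<close>; the margin \<open>e\<close> also covers
          \<open>m = 0\<close>.\<close>
        have "\<exists>s. 0 < s \<and> s \<le> m + e \<and> \<phi> s \<le> l"
        proof (rule ccontr)
          assume "\<not> ?thesis"
          then have "{0<..m+e} \<subseteq> {s. l < f s}" by (force simp: f_def not_le)
          then have "emeasure lebesgue {0<..m+e} \<le> emeasure lebesgue {s. l < f s}"
            by (intro emeasure_mono sets_superlevel fm)
          then show False using m m0 e by (simp add: ennreal_le_iff)
        qed
        then obtain s where s: "0 < s" "s \<le> m + e" "\<phi> s \<le> l" by blast
        have "emeasure lebesgue {x. l < h x} \<le> ennreal s" using key s by blast
        also have "\<dots> \<le> ennreal (m + e)" using s by (intro ennreal_leI)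
        also have "\<dots> = emeasure lebesgue {s. l < f s} + ennreal e" using m m0 e by simp
        finally show "emeasure lebesgue {x. l < h x} \<le> emeasure lebesgue {s. l < f s} + ennreal e" .
      qed
      then show ?thesis using True by simp
    qed simp
  qed
  also have "\<dots> = (\<integral>\<^sup>+s. ennreal (f s) \<partial>lebesgue)"
    by (rule nn_integral_layer_cake[symmetric, OF fm f0])
  also have "\<dots> = (\<integral>\<^sup>+s. ennreal (\<phi> s) * indicator {0<..} s \<partial>lborel)"
    unfolding nn_integral_completion by (intro nn_integral_cong) (auto simp: f_def indicator_def)
  finally show ?thesis .
qed

lemma nn_integral_powr_below:
  fixes k s0 :: real
  assumes "k < 1" "s0 > 0"
  shows "(\<integral>\<^sup>+s. ennreal (s powr (-k)) * indicator {0<..s0} s \<partial>lborel) = ennreal (s0 powr (1 - k) / (1 - k))"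
proof -
  have "((\<lambda>x. x powr (-k)) has_integral (s0 powr (-k+1) / (-k+1))) {0..s0}"
    using assms by (intro has_integral_powr_from_0) auto
  then have "(\<integral>\<^sup>+s. ennreal (s powr (-k)) * indicator {0..s0} s \<partial>lborel) = ennreal (s0 powr (-k+1) / (-k+1))"
    by (intro nn_integral_has_integral_lebesgue') auto
  moreover have "(\<integral>\<^sup>+s. ennreal (s powr (-k)) * indicator {0<..s0} s \<partial>lborel) =
      (\<integral>\<^sup>+s. ennreal (s powr (-k)) * indicator {0..s0} s \<partial>lborel)"
    by (intro nn_integral_cong) (auto simp: indicator_def)
  ultimately show ?thesis by simp
qed

lemma nn_integral_powr_above:
  fixes k s0 :: real
  assumes "k > 1" "s0 > 0"
  shows "(\<integral>\<^sup>+s. ennreal (s powr (-k)) * indicator {s0<..} s \<partial>lborel) = ennreal (s0 powr (1 - k) / (k - 1))"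
proof -
  have "((\<lambda>x. x powr (-k)) has_integral -(s0 powr (-k+1)) / (-k+1)) {s0..}"
    using assms by (intro has_integral_powr_to_inf) auto
  then have "(\<integral>\<^sup>+s. ennreal (s powr (-k)) * indicator {s0..} s \<partial>lborel) = ennreal (-(s0 powr (-k+1)) / (-k+1))"
    by (intro nn_integral_has_integral_lebesgue') auto
  also have "-(s0 powr (-k+1)) / (-k+1) = s0 powr (1 - k) / (k - 1)"
    using assms by (simp add: field_simps)
  moreover have "(\<integral>\<^sup>+s. ennreal (s powr (-k)) * indicator {s0<..} s \<partial>lborel) =
      (\<integral>\<^sup>+s. ennreal (s powr (-k)) * indicator {s0..} s \<partial>lborel)"
  proof (rule nn_integral_cong_AE)
    have "AE x in lborel. x \<noteq> s0" by (rule AE_lborel_singleton)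
    then show "AE s in lborel. ennreal (s powr (-k)) * indicator {s0<..} s = ennreal (s powr (-k)) * indicator {s0..} s"
      by eventually_elim (auto simp: indicator_def)
  qed
  ultimately show ?thesis by simp
qed

text \<open>Exponents below 1 are integrable at 0 and those above 1 at infinity; \<open>s0\<close>
  separates the regimes. Two powers on each side allow a bound with a critical and a better term to
  be integrated with a result linear in its coefficients.\<close>

lemma nn_integral_rearr_le_powr:
  fixes h :: "'a::euclidean_space \<Rightarrow> real"
  assumes h: "rearr_le h \<phi>" "\<And>x. 0 \<le> h x" and s0: "s0 > 0"
    and k: "k < 1" "l < 1" "k' > 1" "l' > 1"
    and c: "0 \<le> c" "0 \<le> d" "0 \<le> c'" "0 \<le> d'"
    and below: "\<And>s. 0 < s \<Longrightarrow> s \<le> s0 \<Longrightarrow> \<phi> s \<le> c * s powr (-k) + d * s powr (-l)"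
    and above: "\<And>s. s0 < s \<Longrightarrow> \<phi> s \<le> c' * s powr (-k') + d' * s powr (-l')"
  shows "(\<integral>\<^sup>+x. ennreal (h x) \<partial>lebesgue) \<le>
     ennreal (c * (s0 powr (1 - k) / (1 - k)) + d * (s0 powr (1 - l) / (1 - l)) +
       c' * (s0 powr (1 - k') / (k' - 1)) + d' * (s0 powr (1 - l') / (l' - 1)))"
proof -
  define \<psi> where "\<psi> = (\<lambda>s. if s \<le> s0 then c * s powr (-k) + d * s powr (-l) else c' * s powr (-k') + d' * s powr (-l'))"
  have \<psi>: "rearr_le h \<psi>"
    by (rule rearr_le_mono_bound[OF h(1)]) (auto simp: \<psi>_def below above)
  have meas: "\<psi> \<in> borel_measurable borel"
    unfolding \<psi>_def by (intro measurable_If) auto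
  have "(\<integral>\<^sup>+x. ennreal (h x) \<partial>lebesgue) \<le> (\<integral>\<^sup>+s. ennreal (\<psi> s) * indicator {0<..} s \<partial>lborel)"
    by (rule nn_integral_rearr_le[OF \<psi> h(2) meas]) (use c in \<open>auto simp: \<psi>_def\<close>)
  also have "\<dots> = (\<integral>\<^sup>+s. (ennreal c * (ennreal (s powr (-k)) * indicator {0<..s0} s) +
       ennreal d * (ennreal (s powr (-l)) * indicator {0<..s0} s)) +
       (ennreal c' * (ennreal (s powr (-k')) * indicator {s0<..} s) +
       ennreal d' * (ennreal (s powr (-l')) * indicator {s0<..} s)) \<partial>lborel)"
    using c s0 by (intro nn_integral_cong) (auto simp: \<psi>_def indicator_def ennreal_mult)
  also have "\<dots> = (ennreal c * ennreal (s0 powr (1 - k) / (1 - k)) + ennreal d * ennreal (s0 powr (1 - l) / (1 - l))) +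
       (ennreal c' * ennreal (s0 powr (1 - k') / (k' - 1)) + ennreal d' * ennreal (s0 powr (1 - l') / (l' - 1)))"
    using k s0 by (simp add: nn_integral_add nn_integral_cmult nn_integral_powr_below nn_integral_powr_above)
  also have "\<dots> = ennreal (c * (s0 powr (1 - k) / (1 - k)) + d * (s0 powr (1 - l) / (1 - l)) +
       (c' * (s0 powr (1 - k') / (k' - 1)) + d' * (s0 powr (1 - l') / (l' - 1))))"
  proof -
    have "ennreal x * ennreal y = ennreal (x * y)" "ennreal x + ennreal y = ennreal (x + y)"
      if "0 \<le> x" "0 \<le> y" for x y
      using that by (simp_all add: ennreal_mult ennreal_plus)
    moreover have "0 \<le> s0 powr (1 - k) / (1 - k)" "0 \<le> s0 powr (1 - l) / (1 - l)"
       "0 \<le> s0 powr (1 - k') / (k' - 1)" "0 \<le> s0 powr (1 - l') / (l' - 1)"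
      using k by simp_all
    ultimately show ?thesis using c by (simp only: mult_nonneg_nonneg add_nonneg_nonneg)
  qed
  finally show ?thesis by (simp only: add.assoc)
qed

text \<open>The defining condition is imposed separately for each \<open>s\<close>, so two bounds
  for the same function may be spliced at any \<open>s0\<close>.\<close>

lemma rearr_le_if:
  "rearr_le h \<phi> \<Longrightarrow> rearr_le h \<psi> \<Longrightarrow> rearr_le h (\<lambda>s. if s \<le> s0 then \<phi> s else \<psi> s)"
  unfolding rearr_le_def by presburger

text \<open>The usual way of evaluating an integral below: one bound controls the singularities, the
  other the large sets, and \<open>s0\<close> is left free to balance them.\<close>

lemma nn_integral_le_two_powers:
  fixes h :: "'a::euclidean_space \<Rightarrow> real"
  assumes "rearr_le h (\<lambda>s. K\<^sub>1 * s powr (-k\<^sub>1))" "rearr_le h (\<lambda>s. K\<^sub>2 * s powr (-k\<^sub>2))" "\<And>x. 0 \<le> h x"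
    and "s0 > 0" "k\<^sub>1 < 1" "1 < k\<^sub>2" "0 \<le> K\<^sub>1" "0 \<le> K\<^sub>2"
  shows "(\<integral>\<^sup>+x. ennreal (h x) \<partial>lebesgue) \<le>
     ennreal (K\<^sub>1 * (s0 powr (1 - k\<^sub>1) / (1 - k\<^sub>1)) + K\<^sub>2 * (s0 powr (1 - k\<^sub>2) / (k\<^sub>2 - 1)))"
  using nn_integral_rearr_le_powr[OF rearr_le_if[OF assms(1,2), of s0] assms(3,4),
      of k\<^sub>1 k\<^sub>1 k\<^sub>2 k\<^sub>2 K\<^sub>1 0 K\<^sub>2 0] assms by simp

section \<open>Riesz potentials\<close>

text \<open>The unnormalised Riesz potential, with values in [0, \<infinity>]. The value 0 that
  \<open>powr\<close> takes at \<open>y = x\<close> affects a null set only.\<close>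

definition riesz :: "real \<Rightarrow> ('a::euclidean_space \<Rightarrow> real) \<Rightarrow> 'a \<Rightarrow> ennreal" where
  "riesz \<alpha> f x = (\<integral>\<^sup>+y. ennreal (f y * norm (x - y) powr (\<alpha> - DIM('a))) \<partial>lebesgue)"

lemma riesz_mono: "(\<And>y. f y \<le> g y) \<Longrightarrow> riesz \<alpha> f x \<le> riesz \<alpha> g x"
  unfolding riesz_def by (intro nn_integral_mono ennreal_leI mult_right_mono) auto

lemma kernel_measurable:
  "(\<lambda>y::'a::euclidean_space. norm (x - y) powr e) \<in> borel_measurable lebesgue"
  by (rule borel_measurable_lebesgue_of_borel) measurable

lemma riesz_add:
  assumes "f \<in> borel_measurable lebesgue" "g \<in> borel_measurable lebesgue" "\<And>y. 0 \<le> f y" "\<And>y. 0 \<le> g y"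
  shows "riesz \<alpha> (\<lambda>y. f y + g y) x = riesz \<alpha> f x + riesz \<alpha> g x"
  unfolding riesz_def using assms kernel_measurable[of x]
  by (subst nn_integral_add[symmetric]) (auto intro!: nn_integral_cong simp: distrib_right simp flip: ennreal_plus)

lemma riesz_cmult:
  assumes "f \<in> borel_measurable lebesgue" "\<And>y. 0 \<le> f y" "0 \<le> c"
  shows "riesz \<alpha> (\<lambda>y. c * f y) x = ennreal c * riesz \<alpha> f x"
  unfolding riesz_def using assms kernel_measurable[of x]
  by (subst nn_integral_cmult[symmetric]) (auto intro!: nn_integral_cong simp: ennreal_mult[symmetric] mult.assoc)

lemma riesz_kernel_pair_measurable:
  fixes f :: "'a::euclidean_space \<Rightarrow> real"
  assumes "f \<in> borel_measurable lebesgue"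
  shows "(\<lambda>z::'a\<times>'a. ennreal (f (snd z) * norm (fst z - snd z) powr e))
           \<in> borel_measurable (lebesgue \<Otimes>\<^sub>M lebesgue)"
proof -
  have f: "(\<lambda>z::'a\<times>'a. f (snd z)) \<in> borel_measurable (lebesgue \<Otimes>\<^sub>M lebesgue)"
    by (rule measurable_compose[OF measurable_snd assms])
  have 1: "(\<lambda>z::'a\<times>'a. fst z) \<in> borel_measurable (lebesgue \<Otimes>\<^sub>M lebesgue)"
    by (rule measurable_compose[OF measurable_fst measurable_ident_lebesgue])
  have 2: "(\<lambda>z::'a\<times>'a. snd z) \<in> borel_measurable (lebesgue \<Otimes>\<^sub>M lebesgue)"
    by (rule measurable_compose[OF measurable_snd measurable_ident_lebesgue])
  have 3: "(\<lambda>z::'a\<times>'a. norm (fst z - snd z) powr e) \<in> borel_measurable (lebesgue \<Otimes>\<^sub>M lebesgue)"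
    by (rule measurable_compose[OF borel_measurable_diff[OF 1 2], of "\<lambda>w. norm w powr e"]) measurable
  show ?thesis using borel_measurable_times[OF f 3] by measurable
qed

lemma riesz_measurable:
  fixes f :: "'a::euclidean_space \<Rightarrow> real"
  assumes "f \<in> borel_measurable lebesgue"
  shows "riesz \<alpha> f \<in> borel_measurable lebesgue"
proof -
  interpret sigma_finite_measure "lebesgue :: 'a measure" by (rule sigma_finite_lebesgue)
  show ?thesis unfolding riesz_def[abs_def]
    using borel_measurable_nn_integral_fst[OF riesz_kernel_pair_measurable[OF assms]] by simp
qed

text \<open>Tonelli and the symmetry of the kernel. Integrals of a potential over a set can thus be
  controlled through the potential of the indicator of that set.\<close>

lemma nn_integral_riesz_dual:
  fixes f g :: "'a::euclidean_space \<Rightarrow> real"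
  assumes f: "f \<in> borel_measurable lebesgue" "\<And>y. 0 \<le> f y"
    and g: "g \<in> borel_measurable lebesgue" "\<And>y. 0 \<le> g y"
  shows "(\<integral>\<^sup>+x. ennreal (g x) * riesz \<alpha> f x \<partial>lebesgue) = (\<integral>\<^sup>+y. ennreal (f y) * riesz \<alpha> g y \<partial>lebesgue)"
proof -
  define F :: "'a \<times> 'a \<Rightarrow> ennreal" where
    "F = (\<lambda>z. ennreal (g (fst z)) * ennreal (f (snd z) * norm (fst z - snd z) powr (\<alpha> - DIM('a))))"
  have gm: "(\<lambda>z::'a\<times>'a. g (fst z)) \<in> borel_measurable (lebesgue \<Otimes>\<^sub>M lebesgue)"
    by (rule measurable_compose[OF measurable_fst g(1)])
  have F: "F \<in> borel_measurable (lebesgue \<Otimes>\<^sub>M lebesgue)"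
    unfolding F_def using gm riesz_kernel_pair_measurable[OF f(1), of "\<alpha> - DIM('a)"]
    by (intro borel_measurable_times_ennreal measurable_compose[OF gm measurable_ennreal]) 
  have k: "(\<lambda>y. ennreal (f y * norm (x - y) powr (\<alpha> - DIM('a)))) \<in> borel_measurable lebesgue" for x
    using f(1) kernel_measurable[of x] by measurable
  have k': "(\<lambda>y. ennreal (g y * norm (x - y) powr (\<alpha> - DIM('a)))) \<in> borel_measurable lebesgue" for x
    using g(1) kernel_measurable[of x] by measurable
  have "(\<integral>\<^sup>+x. ennreal (g x) * riesz \<alpha> f x \<partial>lebesgue) = (\<integral>\<^sup>+x. \<integral>\<^sup>+y. F (x, y) \<partial>lebesgue \<partial>lebesgue)"
    unfolding riesz_def F_def using k by (intro nn_integral_cong) (simp add: nn_integral_cmult)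
  also have "\<dots> = (\<integral>\<^sup>+y. \<integral>\<^sup>+x. F (x, y) \<partial>lebesgue \<partial>lebesgue)"
    by (rule nn_integral_Fubini_lebesgue[OF F])
  also have "\<dots> = (\<integral>\<^sup>+y. ennreal (f y) * riesz \<alpha> g y \<partial>lebesgue)"
  proof (rule nn_integral_cong)
    fix y
    have "(\<integral>\<^sup>+x. F (x, y) \<partial>lebesgue) =
        (\<integral>\<^sup>+x. ennreal (f y) * ennreal (g x * norm (y - x) powr (\<alpha> - DIM('a))) \<partial>lebesgue)"
      using f(2) g(2) by (intro nn_integral_cong)
        (simp add: F_def ennreal_mult[symmetric] norm_minus_commute mult_ac)
    then show "(\<integral>\<^sup>+x. F (x, y) \<partial>lebesgue) = ennreal (f y) * riesz \<alpha> g y"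
      using k'[of y] by (simp add: nn_integral_cmult riesz_def)
  qed
  finally show ?thesis .
qed

text \<open>If \<open>U\<close> exceeded \<open>\<phi> s\<close> on a set of measure above
  \<open>s\<close>, a part of it of finite measure \<open>\<tau> > s\<close> would give \<tau>
  \<phi>(s) <= \<tau> \<phi>(\<tau>), against strict decrease. Set integrals are the right test
  because duality applies to them.\<close>

lemma rearr_le_of_set_integrals:
  fixes U :: "'a::euclidean_space \<Rightarrow> real"
  assumes U: "U \<in> borel_measurable lebesgue" "\<And>x. 0 \<le> U x"
    and \<phi>: "\<And>s t. 0 < s \<Longrightarrow> s < t \<Longrightarrow> \<phi> t < \<phi> s"  "\<And>s. 0 < s \<Longrightarrow> 0 \<le> \<phi> s"
    and bd: "\<And>E \<tau>. E \<in> sets lebesgue \<Longrightarrow> emeasure lebesgue E = ennreal \<tau> \<Longrightarrow> \<tau> > 0 \<Longrightarrow>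
        (\<integral>\<^sup>+x. ennreal (indicator E x) * ennreal (U x) \<partial>lebesgue) \<le> ennreal (\<tau> * \<phi> \<tau>)"
  shows "rearr_le U \<phi>"
  unfolding rearr_le_def
proof (intro conjI allI impI)
  fix s :: real assume s: "s > 0"
  define F where "F = {x. \<phi> s < U x}"
  have F: "F \<in> sets lebesgue" unfolding F_def by (rule sets_superlevel[OF U(1)])
  show "emeasure lebesgue {x. \<phi> s < U x} \<le> ennreal s"
  proof (rule ccontr)
    assume "\<not> ?thesis"
    then have gt: "ennreal s < emeasure lebesgue F" by (simp add: F_def)
    \<comment> \<open>Cutting with balls makes the measure finite; by continuity from below it still
      exceeds \<open>s\<close> for large \<open>j\<close>.\<close>
    define Fj where "Fj = (\<lambda>j::nat. F \<inter> ball 0 (real j))"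
    have Fj: "Fj j \<in> sets lebesgue" for j
      unfolding Fj_def using F by (intro sets.Int) auto
    have "incseq Fj" by (auto simp: incseq_def Fj_def)
    have "(\<Union>j. Fj j) = F"
    proof
      show "F \<subseteq> (\<Union>j. Fj j)"
      proof
        fix x assume "x \<in> F"
        moreover obtain j :: nat where "norm x < real j" using reals_Archimedean2 by blast
        ultimately show "x \<in> (\<Union>j. Fj j)" by (auto simp: Fj_def)
      qed
    qed (auto simp: Fj_def)
    then have "(SUP j. emeasure lebesgue (Fj j)) = emeasure lebesgue F"
      using SUP_emeasure_incseq[OF _ \<open>incseq Fj\<close>, of lebesgue] Fj by (metis image_subset_iff)
    then obtain j where j: "ennreal s < emeasure lebesgue (Fj j)"
      using gt by (metis less_SUP_iff)
    have "emeasure lebesgue (Fj j) \<le> emeasure lebesgue (ball 0 (real j) :: 'a set)"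
      by (intro emeasure_mono) (auto simp: Fj_def)
    also have "\<dots> < \<infinity>" by (simp add: emeasure_ball)
    finally have fin: "emeasure lebesgue (Fj j) < \<infinity>" .
    define \<tau> where "\<tau> = measure lebesgue (Fj j)"
    have \<tau>: "emeasure lebesgue (Fj j) = ennreal \<tau>"
      using fin by (simp add: \<tau>_def emeasure_eq_ennreal_measure)
    have "s < \<tau>" using j s unfolding \<tau> by (metis ennreal_less_iff less_imp_le)
    then have \<tau>0: "\<tau> > 0" using s by simp
    have "ennreal (\<tau> * \<phi> s) = (\<integral>\<^sup>+x. ennreal (\<phi> s) * indicator (Fj j) x \<partial>lebesgue)"
      using Fj \<phi>(2)[OF s] \<tau>0 by (simp add: nn_integral_cmult_indicator \<tau> ennreal_mult mult.commute)
    also have "\<dots> \<le> (\<integral>\<^sup>+x. ennreal (indicator (Fj j) x) * ennreal (U x) \<partial>lebesgue)"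
      by (intro nn_integral_mono) (auto simp: Fj_def F_def indicator_def intro!: ennreal_leI)
    also have "\<dots> \<le> ennreal (\<tau> * \<phi> \<tau>)" by (rule bd[OF Fj \<tau> \<tau>0])
    finally have "\<tau> * \<phi> s \<le> \<tau> * \<phi> \<tau>"
      using \<phi>(2)[OF \<tau>0] \<tau>0 by (simp add: ennreal_le_iff)
    then show False using \<tau>0 \<phi>(1)[OF s \<open>s < \<tau>\<close>] by simp
  qed
qed (fact U(1))

lemma rearr_le_mult_powr:
  assumes "rearr_le h (\<lambda>s. K * s powr (-k))" "rearr_le g (\<lambda>s. L * s powr (-l))"
    and "\<And>x. 0 \<le> h x" "\<And>x. 0 \<le> g x" "0 \<le> K"
  shows "rearr_le (\<lambda>x. h x * g x) (\<lambda>s. (K * L * 2 powr (k + l)) * s powr (-(k + l)))"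
proof (rule rearr_le_mono_bound[OF rearr_le_mult[OF assms(1,2)]])
  fix s :: real assume s: "s > 0"
  have "s powr (-(k+l)) * 2 powr (k+l) = (s powr (-k) * 2 powr k) * (s powr (-l) * 2 powr l)"
    by (simp add: powr_add powr_minus powr_diff field_simps)
  also have "s powr (-k) * 2 powr k = (s/2) powr (-k)"
    using s by (simp add: powr_divide powr_minus field_simps)
  also have "s powr (-l) * 2 powr l = (s/2) powr (-l)"
    using s by (simp add: powr_divide powr_minus field_simps)
  finally show "K * (s / 2) powr - k * (L * (s / 2) powr - l) \<le> K * L * 2 powr (k + l) * s powr - (k + l)"
    by (simp add: mult_ac)
qed (use assms in auto)

lemma rearr_le_cmult:
  assumes "rearr_le h \<phi>" "0 < c"
  shows "rearr_le (\<lambda>x. c * h x) (\<lambda>s. c * \<phi> s)"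
  using assms unfolding rearr_le_def by auto

lemma rearr_le_norm_powr0:
  assumes "\<kappa> \<ge> 0"
  shows "rearr_le (\<lambda>y::'a::euclidean_space. norm y powr (-\<kappa>))
           (\<lambda>s. unit_ball_vol DIM('a) powr (\<kappa> / DIM('a)) * s powr (-(\<kappa> / DIM('a))))"
  using rearr_le_norm_powr[OF assms, of "0::'a"] by simp

lemma rearr_le_kernel:
  fixes x :: "'a::euclidean_space" and \<alpha> :: real
  assumes "\<alpha> < DIM('a)"
  shows "rearr_le (\<lambda>y. norm (x - y) powr (\<alpha> - DIM('a)))
     (\<lambda>s. unit_ball_vol DIM('a) powr (1 - \<alpha> / DIM('a)) * s powr (-(1 - \<alpha> / DIM('a))))"
proof -
  have eqs: "(real DIM('a) - \<alpha>) / real DIM('a) = 1 - \<alpha> / real DIM('a)"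
      "- (real DIM('a) - \<alpha>) = \<alpha> - real DIM('a)"
      "(\<alpha> - real DIM('a)) / real DIM('a) = -(1 - \<alpha> / real DIM('a))"
    by (simp_all add: field_simps)
  have "0 \<le> real DIM('a) - \<alpha>" using assms by simp
  from rearr_le_norm_powr[OF this, of x] show ?thesis by (simp only: eqs)
qed

section \<open>Testing potentials on sets of given measure\<close>

lemma riesz_split:
  assumes f: "f \<in> borel_measurable lebesgue" "\<And>y. 0 \<le> f y" and S: "S \<in> sets lebesgue"
  shows "riesz \<alpha> f x = riesz \<alpha> (\<lambda>y. indicator S y * f y) x + riesz \<alpha> (\<lambda>y. indicator (-S) y * f y) x"
proof -
  have "-S \<in> sets lebesgue" using sets.compl_sets[OF S] by (simp add: Compl_eq_Diff_UNIV)
  then have "riesz \<alpha> (\<lambda>y. indicator S y * f y + indicator (-S) y * f y) x =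
      riesz \<alpha> (\<lambda>y. indicator S y * f y) x + riesz \<alpha> (\<lambda>y. indicator (-S) y * f y) x"
    using f S by (intro riesz_add borel_measurable_times borel_measurable_indicator) auto
  moreover have "(\<lambda>y. indicator S y * f y + indicator (-S) y * f y) = f"
    by (auto simp: indicator_def)
  ultimately show ?thesis by simp
qed

lemma riesz_far_le:
  fixes f :: "'a::euclidean_space \<Rightarrow> real" and \<alpha> \<rho> :: real
  assumes f: "f \<in> borel_measurable lebesgue" "\<And>y. 0 \<le> f y" and "\<alpha> < DIM('a)" "\<rho> > 0"
    and far: "\<And>y. f y \<noteq> 0 \<Longrightarrow> \<rho> \<le> norm (x - y)"
  shows "riesz \<alpha> f x \<le> ennreal (\<rho> powr (\<alpha> - DIM('a))) * (\<integral>\<^sup>+y. ennreal (f y) \<partial>lebesgue)"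
proof -
  have "riesz \<alpha> f x \<le> (\<integral>\<^sup>+y. ennreal (\<rho> powr (\<alpha> - DIM('a))) * ennreal (f y) \<partial>lebesgue)"
    unfolding riesz_def
  proof (rule nn_integral_mono)
    fix y
    have "f y * norm (x - y) powr (\<alpha> - DIM('a)) \<le> f y * \<rho> powr (\<alpha> - DIM('a))"
    proof (cases "f y = 0")
      case False
      then have "norm (x - y) powr (\<alpha> - DIM('a)) \<le> \<rho> powr (\<alpha> - DIM('a))"
        using far assms by (intro powr_mono2') auto
      then show ?thesis using f(2) by (intro mult_left_mono) auto
    qed simp
    then show "ennreal (f y * norm (x - y) powr (\<alpha> - real DIM('a))) \<le> ennreal (\<rho> powr (\<alpha> - DIM('a))) * ennreal (f y)"
      using f(2) by (subst ennreal_mult[symmetric]) (auto intro!: ennreal_leI simp: mult.commute)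
  qed
  also have "\<dots> = ennreal (\<rho> powr (\<alpha> - DIM('a))) * (\<integral>\<^sup>+y. ennreal (f y) \<partial>lebesgue)"
    using f(1) by (intro nn_integral_cmult) measurable
  finally show ?thesis .
qed

text \<open>After multiplication by the indicator the rearrangement vanishes beyond 2 \<tau>, so
  only an integral over (0, 2 \<tau>] remains, which converges for k < 1.\<close>

lemma set_integral_rearr_le:
  fixes f :: "'a::euclidean_space \<Rightarrow> real"
  assumes f: "rearr_le f (\<lambda>s. K * s powr (-k))" "\<And>y. 0 \<le> f y" and k: "k < 1" and K: "0 \<le> K"
    and E: "E \<in> sets lebesgue" "emeasure lebesgue E \<le> ennreal \<tau>" "\<tau> > 0"
  shows "(\<integral>\<^sup>+y. ennreal (indicator E y * f y) \<partial>lebesgue) \<le> ennreal (2 * K / (1 - k) * \<tau> powr (1 - k))"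
proof -
  have *: "rearr_le (\<lambda>y. indicator E y * f y) (\<lambda>s. (if s/2 < \<tau> then 1 else 0) * (K * (s/2) powr (-k)))"
    by (rule rearr_le_mult[OF rearr_le_indicator[OF E(1,2)] f(1)]) (use f(2) in auto)
  \<comment> \<open>The terms with coefficient 0 fill the slots of the general estimate; their
    exponents are arbitrary admissible values.\<close>
  have "(\<integral>\<^sup>+y. ennreal (indicator E y * f y) \<partial>lebesgue) \<le> ennreal (K * 2 powr k * ((2 * \<tau>) powr (1 - k) / (1 - k)) +
      0 * ((2 * \<tau>) powr (1 - k) / (1 - k)) + 0 * ((2 * \<tau>) powr (1 - 2) / (2 - 1)) +
      0 * ((2 * \<tau>) powr (1 - 2) / (2 - 1)))"
  proof (rule nn_integral_rearr_le_powr[OF *])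
    fix s :: real assume "0 < s" "s \<le> 2 * \<tau>"
    then show "(if s / 2 < \<tau> then 1 else 0) * (K * (s / 2) powr - k) \<le> K * 2 powr k * s powr - k + 0 * s powr - k"
      using K by (simp add: powr_divide powr_minus field_simps)
  next
    fix s :: real assume "2 * \<tau> < s"
    then show "(if s / 2 < \<tau> then 1 else 0) * (K * (s / 2) powr - k) \<le> 0 * s powr - 2 + 0 * s powr - 2"
      by simp
  qed (use E K k f(2) in auto)
  also have "K * 2 powr k * ((2 * \<tau>) powr (1 - k) / (1 - k)) +
      0 * ((2 * \<tau>) powr (1 - k) / (1 - k)) + 0 * ((2 * \<tau>) powr (1 - 2) / (2 - 1)) +
      0 * ((2 * \<tau>) powr (1 - 2) / (2 - 1)) = 2 * K / (1 - k) * \<tau> powr (1 - k)"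
    using E k by (simp add: powr_mult powr_diff field_simps)
  finally show ?thesis .
qed

text \<open>The preceding estimate with the kernel itself as the function, at exponent 1 -
  \<alpha>/n. Uniformity in \<open>x\<close> comes from the kernel bound.\<close>

lemma riesz_indicator_le:
  fixes \<alpha> :: real
  assumes \<alpha>: "0 < \<alpha>" "\<alpha> < DIM('a::euclidean_space)"
  obtains M where "M > 0" "\<And>(E::'a set) \<tau> (x::'a). E \<in> sets lebesgue \<Longrightarrow> \<tau> > 0 \<Longrightarrow>
    emeasure lebesgue E \<le> ennreal \<tau> \<Longrightarrow> riesz \<alpha> (indicator E) x \<le> ennreal (M * \<tau> powr (\<alpha> / DIM('a)))"
proof
  define \<nu> where "\<nu> = \<alpha> / DIM('a)"
  define c where "c = unit_ball_vol DIM('a) powr (1 - \<nu>)"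
  have \<nu>: "\<nu> > 0" using \<alpha> by (simp add: \<nu>_def)
  have c: "c > 0"
    unfolding c_def powr_gt_zero using unit_ball_vol_pos[of "real DIM('a)"] by (metis less_irrefl of_nat_0_le_iff)
  then show "2 * c / \<nu> > 0" using \<nu> by simp
  fix E :: "'a set" and \<tau> and x :: 'a
  assume E: "E \<in> sets lebesgue" "\<tau> > 0" "emeasure lebesgue E \<le> ennreal \<tau>"
  have "riesz \<alpha> (indicator E) x \<le> ennreal (2 * c / (1 - (1 - \<nu>)) * \<tau> powr (1 - (1 - \<nu>)))"
    unfolding riesz_def
    by (rule set_integral_rearr_le[OF rearr_le_kernel[OF \<alpha>(2), of x, folded \<nu>_def, folded c_def] _ _ _ E(1,3,2)])
      (use c \<nu> in auto)
  then show "riesz \<alpha> (indicator E) x \<le> ennreal (2 * c / \<nu> * \<tau> powr (\<alpha> / DIM('a)))"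
    by (simp add: \<nu>_def)
qed

text \<open>The uniform bound misses that the potential of \<open>E\<close> is small off large sets.
  Testing on a set \<open>F\<close> and moving the potential to its indicator bounds the integral by
  \<tau> times the uniform bound for \<open>F\<close>.\<close>

lemma riesz_indicator_rearr:
  fixes \<alpha> :: real
  assumes \<alpha>: "0 < \<alpha>" "\<alpha> < DIM('a::euclidean_space)"
    and M: "M > 0" "\<And>(E::'a set) \<tau> (x::'a). E \<in> sets lebesgue \<Longrightarrow> \<tau> > 0 \<Longrightarrow>
      emeasure lebesgue E \<le> ennreal \<tau> \<Longrightarrow> riesz \<alpha> (indicator E) x \<le> ennreal (M * \<tau> powr (\<alpha> / DIM('a)))"
    and E: "(E::'a set) \<in> sets lebesgue" "\<tau> > 0" "emeasure lebesgue E = ennreal \<tau>"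
  shows "rearr_le (\<lambda>y. enn2real (riesz \<alpha> (indicator E) y)) (\<lambda>s. M * \<tau> * s powr (-(1 - \<alpha> / DIM('a))))"
proof (rule rearr_le_of_set_integrals)
  define n where "n = real DIM('a)"
  have n: "n > 0" "\<alpha> < n" using \<alpha> by (auto simp: n_def)
  have ind: "(indicator E :: 'a \<Rightarrow> real) \<in> borel_measurable lebesgue" using E by measurable
  show "(\<lambda>y. enn2real (riesz \<alpha> (indicator E) y)) \<in> borel_measurable lebesgue"
    using riesz_measurable[OF ind] by measurable
  show "0 \<le> enn2real (riesz \<alpha> (indicator E) y)" for y by simp
  show "M * \<tau> * t powr (-(1 - \<alpha> / DIM('a))) < M * \<tau> * s powr (-(1 - \<alpha> / DIM('a)))" if "0 < s" "s < t" for s t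
    using that M E n by (intro mult_strict_left_mono powr_less_mono2_neg) (auto simp: n_def)
  show "0 \<le> M * \<tau> * s powr (-(1 - \<alpha> / DIM('a)))" for s using M E by simp
  fix F :: "'a set" and \<sigma> assume F: "F \<in> sets lebesgue" "emeasure lebesgue F = ennreal \<sigma>" "\<sigma> > 0"
  have indF: "(indicator F :: 'a \<Rightarrow> real) \<in> borel_measurable lebesgue" using F by measurable
  have "(\<integral>\<^sup>+x. ennreal (indicator F x) * ennreal (enn2real (riesz \<alpha> (indicator E) x)) \<partial>lebesgue)
      \<le> (\<integral>\<^sup>+x. ennreal (indicator F x) * riesz \<alpha> (indicator E) x \<partial>lebesgue)"
    by (intro nn_integral_mono mult_left_mono) (auto simp: ennreal_enn2real_if)
  also have "\<dots> = (\<integral>\<^sup>+x. ennreal (indicator E x) * riesz \<alpha> (indicator F) x \<partial>lebesgue)"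
    by (rule nn_integral_riesz_dual) (use ind indF in auto)
  also have "\<dots> \<le> (\<integral>\<^sup>+x. ennreal (M * \<sigma> powr (\<alpha> / n)) * indicator E x \<partial>lebesgue)"
    using M(2)[OF F(1,3)] F(2) by (intro nn_integral_mono) (auto simp: indicator_def n_def)
  also have "\<dots> = ennreal (M * \<sigma> powr (\<alpha> / n)) * ennreal \<tau>"
    using E by (simp add: nn_integral_cmult_indicator)
  also have "\<dots> = ennreal (M * \<sigma> powr (\<alpha> / n) * \<tau>)"
    using M E by (simp add: ennreal_mult)
  also have "\<sigma> powr (\<alpha> / n) = \<sigma> * \<sigma> powr (-(1 - \<alpha> / n))"
    using F by (simp add: powr_diff powr_minus field_simps)
  finally show "(\<integral>\<^sup>+x. ennreal (indicator F x) * ennreal (enn2real (riesz \<alpha> (indicator E) x)) \<partial>lebesgue)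
      \<le> ennreal (\<sigma> * (M * \<tau> * \<sigma> powr (-(1 - \<alpha> / DIM('a)))))"
    by (simp add: n_def mult_ac)
qed

text \<open>
  Duality moves the potential onto \<open>indicator E\<close>, whose rearrangement is governed by the size of \<open>E\<close>
  alone; the bound is linear in \<open>(c, d)\<close>, which is what the iteration needs.
\<close>

lemma set_integral_riesz_le:
  fixes \<alpha> k l :: real
  assumes \<alpha>: "0 < \<alpha>" "\<alpha> < DIM('a::euclidean_space)"
    and k: "\<alpha> / DIM('a) < k" "k < 1" "\<alpha> / DIM('a) < l" "l < 1"
  obtains M where "M > 0" "\<And>(f :: 'a \<Rightarrow> real) c d E \<tau>.
    rearr_le f (\<lambda>s. c * s powr (-k) + d * s powr (-l)) \<Longrightarrow> (\<And>x. 0 \<le> f x) \<Longrightarrow> 0 \<le> c \<Longrightarrow> 0 \<le> d \<Longrightarrow>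
    E \<in> sets lebesgue \<Longrightarrow> emeasure lebesgue E = ennreal \<tau> \<Longrightarrow> \<tau> > 0 \<Longrightarrow>
    (\<integral>\<^sup>+x. ennreal (indicator E x) * riesz \<alpha> f x \<partial>lebesgue)
      \<le> ennreal (M * \<tau> * (c * \<tau> powr (-(k - \<alpha> / DIM('a))) + d * \<tau> powr (-(l - \<alpha> / DIM('a)))))"
proof -
  define n where "n = real DIM('a)"
  define \<nu> where "\<nu> = \<alpha> / n"
  have n: "n > 0" "\<alpha> < n" using \<alpha> by (auto simp: n_def)
  obtain M where M: "M > 0" "\<And>(E::'a set) \<tau> (x::'a). E \<in> sets lebesgue \<Longrightarrow> \<tau> > 0 \<Longrightarrow>
      emeasure lebesgue E \<le> ennreal \<tau> \<Longrightarrow> riesz \<alpha> (indicator E) x \<le> ennreal (M * \<tau> powr (\<alpha> / DIM('a)))"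
    using riesz_indicator_le[OF \<alpha>] by blast
  have \<nu>: "0 < \<nu>" "\<nu> < 1" "\<nu> < k" "\<nu> < l" using \<alpha> n k by (auto simp: \<nu>_def n_def)
  \<comment> \<open>The summands are the integrals over s <= \<tau> and s > \<tau>; their
    denominators show where k < 1 and \<nu> < k enter.\<close>
  define C where "C = (\<lambda>k. M * 2 powr k / (1 - k) + M * 2 powr (k + (1 - \<nu>)) / (k - \<nu>))"
  have Cpos: "C k > 0" if "\<nu> < k" "k < 1" for k
    using that M by (auto simp: C_def intro!: add_pos_pos)
  show ?thesis
  proof (rule that[of "max (C k) (C l)"])
    show "max (C k) (C l) > 0" using Cpos \<nu> k by (simp add: less_max_iff_disj)
  next
    fix f :: "'a \<Rightarrow> real" and E :: "'a set" and c d \<tau> :: real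
    assume f: "rearr_le f (\<lambda>s. c * s powr (-k) + d * s powr (-l))" "\<And>x. 0 \<le> f x" and cd: "0 \<le> c" "0 \<le> d"
      and E: "E \<in> sets lebesgue" "emeasure lebesgue E = ennreal \<tau>" "\<tau> > 0"
    define G where "G = (\<lambda>y. enn2real (riesz \<alpha> (indicator E) y))"
    have G1: "rearr_le G (\<lambda>s. M * \<tau> * s powr (-(1 - \<nu>)))"
      unfolding G_def \<nu>_def n_def by (rule riesz_indicator_rearr[OF \<alpha> M(1) _ E(1,3,2)]) (rule M(2))
    have riesz_le: "riesz \<alpha> (indicator E) y \<le> ennreal (M * \<tau> powr \<nu>)" for y
      using M(2)[OF E(1,3), of y] E by (simp add: \<nu>_def n_def)
    have Gle: "G y \<le> M * \<tau> powr \<nu>" for y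
      unfolding G_def using riesz_le[of y] M E by (intro enn2real_leI) auto
    have G0: "0 \<le> G y" for y by (simp add: G_def)
    have rG: "riesz \<alpha> (indicator E) y = ennreal (G y)" for y
      using riesz_le[of y] unfolding G_def by (metis ennreal_enn2real ennreal_less_top order_le_less_trans)
    have G2: "rearr_le G (\<lambda>s. M * \<tau> powr \<nu>)"
      by (rule rearr_le_const[OF rearr_le_measurable[OF G1] Gle])
    have ind: "(indicator E :: 'a \<Rightarrow> real) \<in> borel_measurable lebesgue" using E by measurable
    have pos: "0 \<le> c * s powr (-k) + d * s powr (-l)" for s using cd by simp
    have h1: "rearr_le (\<lambda>y. f y * G y) (\<lambda>s. (c * (s/2) powr (-k) + d * (s/2) powr (-l)) * (M * \<tau> powr \<nu>))"
      using rearr_le_mult[OF f(1) G2 f(2) G0 pos] .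
    have h2: "rearr_le (\<lambda>y. f y * G y) (\<lambda>s. (c * (s/2) powr (-k) + d * (s/2) powr (-l)) * (M * \<tau> * (s/2) powr (-(1-\<nu>))))"
      using rearr_le_mult[OF f(1) G1 f(2) G0 pos] .
    have half: "(s/2) powr (-e) = 2 powr e * s powr (-e)" if "s > 0" for s e :: real
      using that by (simp add: powr_divide powr_minus field_simps)
    have half2: "(s/2) powr (-e) * (s/2) powr (-e') = 2 powr (e + e') * s powr (-(e + e'))" if "s > 0" for s e e' :: real
      using half[OF that, of "e + e'"] that by (simp add: powr_add[symmetric])
    have "(\<integral>\<^sup>+x. ennreal (indicator E x) * riesz \<alpha> f x \<partial>lebesgue) =
        (\<integral>\<^sup>+x. ennreal (f x) * riesz \<alpha> (indicator E) x \<partial>lebesgue)"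
      by (rule nn_integral_riesz_dual) (use ind f rearr_le_measurable in auto)
    also have "\<dots> = (\<integral>\<^sup>+x. ennreal (f x * G x) \<partial>lebesgue)"
      using f(2) G0 by (simp add: rG ennreal_mult)
    \<comment> \<open>The uniform bound for \<open>G\<close> is used up to s = \<tau> and the
      decaying one beyond; at the splice both are M \<tau>^\<nu>.\<close>
    also have "\<dots> \<le> ennreal (c * (M * \<tau> powr \<nu> * 2 powr k) * (\<tau> powr (1 - k) / (1 - k)) +
         d * (M * \<tau> powr \<nu> * 2 powr l) * (\<tau> powr (1 - l) / (1 - l)) +
         c * (M * \<tau> * 2 powr (k + (1 - \<nu>))) * (\<tau> powr (1 - (k + (1 - \<nu>))) / ((k + (1 - \<nu>)) - 1)) +
         d * (M * \<tau> * 2 powr (l + (1 - \<nu>))) * (\<tau> powr (1 - (l + (1 - \<nu>))) / ((l + (1 - \<nu>)) - 1)))"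
    proof (rule nn_integral_rearr_le_powr[OF rearr_le_if[OF h1 h2, of \<tau>]])
      fix s :: real assume "0 < s" "s \<le> \<tau>"
      then show "(if s \<le> \<tau> then (c * (s / 2) powr - k + d * (s / 2) powr - l) * (M * \<tau> powr \<nu>)
           else (c * (s / 2) powr - k + d * (s / 2) powr - l) * (M * \<tau> * (s / 2) powr - (1 - \<nu>)))
          \<le> c * (M * \<tau> powr \<nu> * 2 powr k) * s powr - k + d * (M * \<tau> powr \<nu> * 2 powr l) * s powr - l"
        by (simp only: half if_True) (simp add: algebra_simps)
    next
      fix s :: real assume s: "\<tau> < s"
      then have s0: "s > 0" using E by simp
      have "(c * (s / 2) powr - k + d * (s / 2) powr - l) * (M * \<tau> * (s / 2) powr - (1 - \<nu>)) =
          c * M * \<tau> * ((s / 2) powr - k * (s / 2) powr - (1 - \<nu>)) +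
          d * M * \<tau> * ((s / 2) powr - l * (s / 2) powr - (1 - \<nu>))"
        by (simp add: distrib_left distrib_right mult_ac)
      also have "\<dots> = c * (M * \<tau> * 2 powr (k + (1 - \<nu>))) * s powr - (k + (1 - \<nu>)) +
          d * (M * \<tau> * 2 powr (l + (1 - \<nu>))) * s powr - (l + (1 - \<nu>))"
        unfolding half2[OF s0] by (simp only: mult_ac)
      finally show "(if s \<le> \<tau> then (c * (s / 2) powr - k + d * (s / 2) powr - l) * (M * \<tau> powr \<nu>)
           else (c * (s / 2) powr - k + d * (s / 2) powr - l) * (M * \<tau> * (s / 2) powr - (1 - \<nu>)))
          \<le> c * (M * \<tau> * 2 powr (k + (1 - \<nu>))) * s powr - (k + (1 - \<nu>)) +
          d * (M * \<tau> * 2 powr (l + (1 - \<nu>))) * s powr - (l + (1 - \<nu>))"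
        using s by simp
    qed (use E cd M k \<nu> f(2) G0 in auto)
    also have "c * (M * \<tau> powr \<nu> * 2 powr k) * (\<tau> powr (1 - k) / (1 - k)) +
         d * (M * \<tau> powr \<nu> * 2 powr l) * (\<tau> powr (1 - l) / (1 - l)) +
         c * (M * \<tau> * 2 powr (k + (1 - \<nu>))) * (\<tau> powr (1 - (k + (1 - \<nu>))) / ((k + (1 - \<nu>)) - 1)) +
         d * (M * \<tau> * 2 powr (l + (1 - \<nu>))) * (\<tau> powr (1 - (l + (1 - \<nu>))) / ((l + (1 - \<nu>)) - 1))
       = \<tau> * (C k * (c * \<tau> powr (-(k - \<nu>))) + C l * (d * \<tau> powr (-(l - \<nu>))))"
    proof -
      have 1: "\<tau> powr \<nu> * \<tau> powr (1 - e) = \<tau> * \<tau> powr (-(e - \<nu>))" for e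
      proof -
        have "\<tau> powr \<nu> * \<tau> powr (1 - e) = \<tau> powr (\<nu> + (1 - e))"
          by (simp only: powr_add)
        also have "\<nu> + (1 - e) = 1 + -(e - \<nu>)" by simp
        finally show ?thesis using E by (simp add: powr_add)
      qed
      have 2: "1 - (e + (1 - \<nu>)) = -(e - \<nu>)" "(e + (1 - \<nu>)) - 1 = e - \<nu>" for e by simp_all
      have 3: "x * (M * \<tau> powr \<nu> * 2 powr e) * (\<tau> powr (1 - e) / (1 - e)) =
          \<tau> * (M * 2 powr e / (1 - e) * (x * \<tau> powr (-(e - \<nu>))))" for x e
        using 1[of e] by (simp add: mult_ac)
      show ?thesis unfolding 2 3 C_def by (simp only: distrib_left distrib_right) (simp add: mult_ac)
    qed
    also have "\<dots> \<le> max (C k) (C l) * \<tau> * (c * \<tau> powr (-(k - \<nu>)) + d * \<tau> powr (-(l - \<nu>)))"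
    proof -
      have "C k * (c * \<tau> powr (-(k - \<nu>))) + C l * (d * \<tau> powr (-(l - \<nu>))) \<le>
          max (C k) (C l) * (c * \<tau> powr (-(k - \<nu>))) + max (C k) (C l) * (d * \<tau> powr (-(l - \<nu>)))"
        using cd by (intro add_mono mult_right_mono) auto
      from mult_left_mono[OF this, of \<tau>] show ?thesis
        using E(3) by (simp only: distrib_left mult_ac less_imp_le)
    qed
    finally show "(\<integral>\<^sup>+x. ennreal (indicator E x) * riesz \<alpha> f x \<partial>lebesgue)
      \<le> ennreal (max (C k) (C l) * \<tau> * (c * \<tau> powr (-(k - \<alpha> / DIM('a))) + d * \<tau> powr (-(l - \<alpha> / DIM('a)))))"
      by (simp add: \<nu>_def n_def ennreal_leI)
  qed
qed

section \<open>Boundedness\<close>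

text \<open>The measure with density \<open>f\<close> is finite, hence continuous from above along
  \<open>S\<close>.\<close>

lemma nn_integral_vanishing_tail:
  fixes f :: "'a::euclidean_space \<Rightarrow> ennreal"
  assumes f: "f \<in> borel_measurable lebesgue" "(\<integral>\<^sup>+x. f x \<partial>lebesgue) < \<infinity>"
    and S: "\<And>j::nat. S j \<in> sets lebesgue" "decseq S" "(\<Inter>j. S j) = {}" and e: "e > (0::ennreal)"
  shows "\<exists>j. (\<integral>\<^sup>+x. f x * indicator (S j) x \<partial>lebesgue) < e"
proof -
  define N where "N = density lebesgue f"
  have em: "emeasure N X = (\<integral>\<^sup>+x. f x * indicator X x \<partial>lebesgue)" if "X \<in> sets lebesgue" for X
    unfolding N_def using f that by (simp add: emeasure_density)
  have fin: "emeasure N (S j) \<noteq> \<infinity>" for j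
  proof -
    have "emeasure N (S j) \<le> (\<integral>\<^sup>+x. f x \<partial>lebesgue)"
      unfolding em[OF S(1)] by (intro nn_integral_mono) (auto simp: indicator_def)
    then show ?thesis using f(2) by auto
  qed
  have "(INF j. emeasure N (S j)) = emeasure N (\<Inter>j. S j)"
    by (rule INF_emeasure_decseq) (use S fin in \<open>auto simp: N_def\<close>)
  then have "(INF j. emeasure N (S j)) < e" using S e by simp
  then obtain j where "emeasure N (S j) < e" by (auto simp: INF_less_iff)
  then show ?thesis using em[OF S(1)] by auto
qed

text \<open>
  One of the two inequalities of the system; the other one is the same locale with the roles of
  \<open>U\<close> and \<open>V\<close> exchanged. Here \<open>A\<close> and \<open>B\<close> are the scale-invariant rates, tied together by the assumption \<open>QB\<close>.
\<close>

locale riesz_half =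
  fixes \<alpha> a Q A B C :: real and U V :: "'a::euclidean_space \<Rightarrow> real"
  assumes \<alpha>: "0 < \<alpha>" "\<alpha> < real DIM('a)"
    and a: "-\<alpha> < a" "a \<le> 0" and Q: "1 < Q"
    and A: "0 < A" "A < real DIM('a) - \<alpha>" and B: "0 < B" "B < real DIM('a) - \<alpha>"
    and QB: "Q * B = A + \<alpha> + a"
    and U_measurable: "U \<in> borel_measurable lebesgue" and V_measurable: "V \<in> borel_measurable lebesgue"
    and U_nonneg: "\<And>x. 0 \<le> U x" and V_nonneg: "\<And>x. 0 \<le> V x"
    and C: "0 < C"
    and U_le: "\<And>x. ennreal (U x) \<le> ennreal C * riesz \<alpha> (\<lambda>y. norm y powr a * V y powr Q) x"
    and V_int: "(\<integral>\<^sup>+x. ennreal (V x powr (real DIM('a) / B)) \<partial>lebesgue) < \<infinity>"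
begin

definition n :: real where "n = real DIM('a)"

lemma n: "0 < n" "\<alpha> < n" "A < n - \<alpha>" "B < n - \<alpha>"
  using \<alpha> A B by (auto simp: n_def)

definition \<omega> where "\<omega> = unit_ball_vol n"

lemma \<omega>: "\<omega> > 0" unfolding \<omega>_def using n by (intro unit_ball_vol_pos) simp

abbreviation source :: "'a \<Rightarrow> real" where "source \<equiv> \<lambda>y. norm y powr a * V y powr Q"

lemma weight_measurable: "(\<lambda>y::'a. norm y powr a) \<in> borel_measurable lebesgue"
  by (rule borel_measurable_lebesgue_of_borel) measurable

lemma V_powr_measurable: "(\<lambda>y. V y powr e) \<in> borel_measurable lebesgue"
  using V_measurable by measurable

lemma source_measurable: "source \<in> borel_measurable lebesgue"
  using weight_measurable V_powr_measurable by (rule borel_measurable_times)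

lemma indicator_source_measurable:
  "S \<in> sets lebesgue \<Longrightarrow> (\<lambda>y. indicator S y * source y) \<in> borel_measurable lebesgue"
  by (rule borel_measurable_times[OF borel_measurable_indicator source_measurable])

lemma source_nonneg: "0 \<le> source y" by simp

lemma rearr_weight: "rearr_le (\<lambda>y::'a. norm y powr a) (\<lambda>s. \<omega> powr (-a/n) * s powr (-(-a/n)))"
  using rearr_le_norm_powr0[of "-a", where 'a='a] a by (simp add: n_def \<omega>_def)

lemma rearr_kernel: "rearr_le (\<lambda>y. norm ((x::'a) - y) powr (\<alpha> - n)) (\<lambda>s. \<omega> powr (1 - \<alpha>/n) * s powr (-(1 - \<alpha>/n)))"
  using rearr_le_kernel[OF \<alpha>(2), of x] by (simp add: n_def \<omega>_def)

text \<open>The origin of all smallness: \<open>S\<close> will be the sets where V > j + 1 for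
  boundedness, and exteriors of balls for decay. Chebyshev turns a small tail integral into a small
  coefficient at the scale-invariant exponent B/n.\<close>

lemma V_tail:
  assumes S: "\<And>j::nat. S j \<in> sets lebesgue" "decseq S" "(\<Inter>j. S j) = {}" and e: "e > 0"
  shows "\<exists>j. rearr_le (\<lambda>y. indicator (S j) y * V y) (\<lambda>s. e * s powr (-(B / n)))"
proof -
  have I: "e powr (n / B) > 0" using e by simp
  obtain j where j: "(\<integral>\<^sup>+x. ennreal (V x powr (n / B)) * indicator (S j) x \<partial>lebesgue) < ennreal (e powr (n / B))"
    using nn_integral_vanishing_tail[OF _ V_int S, of "ennreal (e powr (n / B))"] I V_powr_measurable
    by (auto simp: n_def)
  have "(\<integral>\<^sup>+x. ennreal ((indicator (S j) x * V x) powr (1 / (B / n))) \<partial>lebesgue) =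
      (\<integral>\<^sup>+x. ennreal (V x powr (n / B)) * indicator (S j) x \<partial>lebesgue)"
    by (intro nn_integral_cong) (simp add: indicator_def)
  then have "(\<integral>\<^sup>+x. ennreal ((indicator (S j) x * V x) powr (1 / (B / n))) \<partial>lebesgue) \<le> ennreal (e powr (n / B))"
    using j by simp
  then have "rearr_le (\<lambda>y. indicator (S j) y * V y) (\<lambda>s. (e powr (n / B)) powr (B / n) * s powr (-(B / n)))"
    using S(1)[of j] V_measurable V_nonneg B n I by (intro rearr_le_of_powr_integral) (auto simp del: powr_powr)
  moreover have "(e powr (n / B)) powr (B / n) = e" using e B n by (simp add: powr_powr)
  ultimately show ?thesis by auto
qed

lemma V_rearr: obtains K where "K > 0" "rearr_le V (\<lambda>s. K * s powr (-(B / n)))"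
proof -
  obtain I where I: "(\<integral>\<^sup>+x. ennreal (V x powr (n / B)) \<partial>lebesgue) = ennreal I" "I \<ge> 0"
    using V_int unfolding n_def by (metis ennreal_cases infinity_ennreal_def less_irrefl)
  have "(\<integral>\<^sup>+x. ennreal (V x powr (1 / (B / n))) \<partial>lebesgue) \<le> ennreal (I + 1)"
    using I by (simp add: ennreal_leI)
  then have "rearr_le V (\<lambda>s. (I + 1) powr (B / n) * s powr (-(B / n)))"
    using V_measurable V_nonneg B n I by (intro rearr_le_of_powr_integral) auto
  then show ?thesis using that[of "(I + 1) powr (B / n)"] I by simp
qed

lemma rearr_le_powr_powr:
  assumes "rearr_le h (\<lambda>s. K * s powr (-k))" "0 \<le> K" "0 \<le> e" "\<And>y. 0 \<le> h y"
  shows "rearr_le (\<lambda>y. h y powr e) (\<lambda>s. K powr e * s powr (-(k * e)))"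
proof -
  have "rearr_le (\<lambda>y. h y powr e) (\<lambda>s. (K * s powr (-k)) powr e)"
    using assms by (intro rearr_le_powr) auto
  then show ?thesis using assms by (simp add: powr_mult powr_powr)
qed

text \<open>Here -a/n is the exponent of the weight. The full source has exponent (A + \<alpha>)/n,
  which the potential lowers to the critical A/n; dropping one factor of \<open>V\<close> takes away
  B/n.\<close>

lemma exponent_eqs:
  "-a/n + B/n * (Q - 1) = (A + \<alpha> - B) / n" "-a/n + B/n * Q = (A + \<alpha>) / n"
  using n QB by (simp_all add: field_simps)

text \<open>Where V <= L, one factor of \<open>V\<close> is bounded and its exponent B/n may be
  lowered to (B - \<delta>)/n; the other Q - 1 factors keep the critical exponent. This supplies the
  term of better order.\<close>

lemma low_part:
  assumes \<delta>: "0 < \<delta>" "\<delta> < B" and L: "L > 0"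
  obtains D where "D > 0" "rearr_le (\<lambda>y. indicator (- {y. L < V y}) y * source y) (\<lambda>s. D * s powr (-((A - \<delta> + \<alpha>) / n)))"
proof -
  define W where "W = (\<lambda>y. indicator (- {y. L < V y}) y * V y)"
  obtain K where K: "K > 0" "rearr_le V (\<lambda>s. K * s powr (-(B / n)))" by (rule V_rearr)
  have sets: "- {y. L < V y} \<in> sets lebesgue"
    using sets.compl_sets[OF sets_superlevel[OF V_measurable, of L]] by (simp add: Compl_eq_Diff_UNIV)
  have Wm: "W \<in> borel_measurable lebesgue"
    unfolding W_def using sets V_measurable by (intro borel_measurable_times borel_measurable_indicator)
  have W0: "0 \<le> W y" for y using V_nonneg by (simp add: W_def)
  have W1: "rearr_le W (\<lambda>s. L)"
    by (rule rearr_le_const[OF Wm]) (use L in \<open>auto simp: W_def indicator_def\<close>)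
  have W2: "rearr_le W (\<lambda>s. K * s powr (-(B / n)))"
    by (rule rearr_le_mono[OF K(2) Wm]) (use V_nonneg in \<open>auto simp: W_def indicator_def\<close>)
  \<comment> \<open>Up to s = 1 the power is at least 1, so the constant \<open>L\<close> suffices;
    beyond 1 the smaller decay exponent gives the larger value.\<close>
  have W3: "rearr_le W (\<lambda>s. max L K * s powr (-((B - \<delta>) / n)))"
  proof (rule rearr_le_mono_bound[OF rearr_le_if[OF W1 W2, of 1]])
    fix s :: real assume s: "s > 0"
    show "(if s \<le> 1 then L else K * s powr - (B / n)) \<le> max L K * s powr - ((B - \<delta>) / n)"
    proof (cases "s \<le> 1")
      case True
      have "1 \<le> s powr - ((B - \<delta>) / n)"
        using True s \<delta> n by (simp add: powr_minus one_le_inverse_iff powr_le1)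
      then have "L * 1 \<le> max L K * s powr - ((B - \<delta>) / n)"
        using L by (intro mult_mono) auto
      then show ?thesis using True by simp
    next
      case False
      then have "s powr - (B / n) \<le> s powr - ((B - \<delta>) / n)"
        using n \<delta> by (intro powr_mono) (auto simp: divide_right_mono)
      then have "K * s powr - (B / n) \<le> max L K * s powr - ((B - \<delta>) / n)"
        using L K by (intro mult_mono) auto
      then show ?thesis using False by simp
    qed
  qed
  define K0 where "K0 = \<omega> powr (-a/n) * K powr (Q - 1) * 2 powr (-a/n + B/n * (Q - 1))"
  have g: "rearr_le (\<lambda>y. norm y powr a * V y powr (Q - 1)) (\<lambda>s. K0 * s powr (-((A + \<alpha> - B) / n)))"
    unfolding K0_def exponent_eqs(1)[symmetric]
    by (rule rearr_le_mult_powr[OF rearr_weight rearr_le_powr_powr[OF K(2)]]) (use K Q V_nonneg in auto)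
  have "K0 > 0" using \<omega> K by (simp add: K0_def)
  have "rearr_le (\<lambda>y. (norm y powr a * V y powr (Q - 1)) * W y)
     (\<lambda>s. (K0 * max L K * 2 powr ((A + \<alpha> - B) / n + (B - \<delta>) / n)) * s powr (-((A + \<alpha> - B) / n + (B - \<delta>) / n)))"
    using rearr_le_mult_powr[OF g W3] \<open>K0 > 0\<close> W0 V_nonneg by simp
  moreover have "(A + \<alpha> - B) / n + (B - \<delta>) / n = (A - \<delta> + \<alpha>) / n" by (simp add: add_divide_distrib diff_divide_distrib)
  moreover have "(\<lambda>y. (norm y powr a * V y powr (Q - 1)) * W y) = (\<lambda>y. indicator (- {y. L < V y}) y * source y)"
  proof
    fix y
    have "V y powr (Q - 1) * V y = V y powr Q"
      using V_nonneg[of y] Q by (cases "V y = 0") (auto simp: powr_diff)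
    then show "(norm y powr a * V y powr (Q - 1)) * W y = indicator (- {y. L < V y}) y * source y"
      by (simp add: W_def indicator_def)
  qed
  ultimately have "rearr_le (\<lambda>y. indicator (- {y. L < V y}) y * source y)
     (\<lambda>s. (K0 * max L K * 2 powr ((A - \<delta> + \<alpha>) / n)) * s powr (-((A - \<delta> + \<alpha>) / n)))"
    by metis
  moreover have "K0 * max L K * 2 powr ((A - \<delta> + \<alpha>) / n) > 0" using \<open>K0 > 0\<close> L by (simp add: less_max_iff_disj)
  ultimately show ?thesis using that by blast
qed

text \<open>Only Q - 1 factors are restricted to {V > L} and made small. The last factor stays whole
  and carries any current bound \<open>\<phi>\<close>, so the result is linear in that
  bound.\<close>

lemma high_part:
  assumes e: "e > 0"
  obtains L where "L > 0" "\<And>\<phi>. rearr_le V \<phi> \<Longrightarrow> (\<And>s. s > 0 \<Longrightarrow> 0 \<le> \<phi> s) \<Longrightarrow>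
     rearr_le (\<lambda>y. indicator {y. L < V y} y * source y) (\<lambda>s. \<phi> (s/2) * (e * (s/2) powr (-((A + \<alpha> - B) / n))))"
proof -
  \<comment> \<open>Solved so that the constant in the bound for the weight times W^(Q-1) comes out
    as \<open>e\<close>.\<close>
  define e1 where "e1 = (e / (\<omega> powr (-a/n) * 2 powr (-a/n + B/n * (Q - 1)))) powr (1 / (Q - 1))"
  have e1: "e1 > 0" using e \<omega> by (simp add: e1_def)
  have "decseq (\<lambda>j::nat. {y. real j + 1 < V y})" by (auto simp: decseq_def)
  moreover have "(\<Inter>j::nat. {y. real j + 1 < V y}) = {}"
  proof -
    have "\<exists>j::nat. V y \<le> real j + 1" for y
      using real_arch_simple[of "V y"] by (metis add_increasing2 zero_le_one)
    then show ?thesis by (auto simp: set_eq_iff) (meson leD)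
  qed
  moreover have "{y. real j + 1 < V y} \<in> sets lebesgue" for j :: nat by (rule sets_superlevel[OF V_measurable])
  ultimately obtain j :: nat where j: "rearr_le (\<lambda>y. indicator {y. real j + 1 < V y} y * V y) (\<lambda>s. e1 * s powr (-(B / n)))"
    using V_tail[of "\<lambda>j::nat. {y. real j + 1 < V y}" e1] e1 by blast
  define L where "L = real j + 1"
  define W where "W = (\<lambda>y. indicator {y. L < V y} y * V y)"
  have W: "rearr_le W (\<lambda>s. e1 * s powr (-(B / n)))" using j by (simp add: W_def L_def)
  have W0: "0 \<le> W y" for y using V_nonneg by (simp add: W_def)
  have "rearr_le (\<lambda>y. norm y powr a * W y powr (Q - 1))
     (\<lambda>s. (\<omega> powr (-a/n) * e1 powr (Q - 1) * 2 powr (-a/n + B/n * (Q - 1))) * s powr (-((A + \<alpha> - B) / n)))"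
    unfolding exponent_eqs(1)[symmetric]
    by (rule rearr_le_mult_powr[OF rearr_weight rearr_le_powr_powr[OF W]]) (use e1 Q W0 in auto)
  moreover have "\<omega> powr (-a/n) * e1 powr (Q - 1) * 2 powr (-a/n + B/n * (Q - 1)) = e"
    using e \<omega> Q by (simp add: e1_def powr_powr)
  ultimately have g: "rearr_le (\<lambda>y. norm y powr a * W y powr (Q - 1)) (\<lambda>s. e * s powr (-((A + \<alpha> - B) / n)))"
    by simp
  have eq: "(\<lambda>y. V y * (norm y powr a * W y powr (Q - 1))) = (\<lambda>y. indicator {y. L < V y} y * source y)"
  proof
    fix y
    have "V y powr (Q - 1) * V y = V y powr Q"
      using V_nonneg[of y] Q by (cases "V y = 0") (auto simp: powr_diff)
    then show "V y * (norm y powr a * W y powr (Q - 1)) = indicator {y. L < V y} y * source y"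
      by (simp add: W_def indicator_def mult_ac)
  qed
  show ?thesis
  proof (rule that[of L])
    show "L > 0" by (simp add: L_def)
    fix \<phi> assume \<phi>: "rearr_le V \<phi>" "\<And>s. s > 0 \<Longrightarrow> 0 \<le> \<phi> s"
    show "rearr_le (\<lambda>y. indicator {y. L < V y} y * source y) (\<lambda>s. \<phi> (s/2) * (e * (s/2) powr (-((A + \<alpha> - B) / n))))"
      using rearr_le_mult[OF \<phi>(1) g V_nonneg _ \<phi>(2)] W0 unfolding eq by simp
  qed
qed

text \<open>\<open>d0\<close> depends on the cut-off level but not on \<open>c\<close> and
  \<open>d\<close>, and this uniformity allows the step to be repeated. The superlevel part
  contributes at most half of the old coefficients, the sublevel part only
  \<open>d0\<close>.\<close>

lemma half_step:
  assumes \<delta>: "0 < \<delta>" "\<delta> < A" "\<delta> < B"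
  shows "\<exists>d0\<ge>0. \<forall>c>0. \<forall>d\<ge>0. rearr_le V (\<lambda>s. c * s powr (-(B/n)) + d * s powr (-((B-\<delta>)/n))) \<longrightarrow>
     rearr_le U (\<lambda>s. c/2 * s powr (-(A/n)) + (d/2 + d0) * s powr (-((A-\<delta>)/n)))"
proof -
  define k where "k = (A + \<alpha>) / n"
  define l where "l = (A - \<delta> + \<alpha>) / n"
  have "\<alpha> / n < k" "k < 1" "\<alpha> / n < l" "l < 1"
    using \<delta> A n \<alpha> by (auto simp: k_def l_def field_simps)
  then obtain M where M: "M > 0" "\<And>(f :: 'a \<Rightarrow> real) c d E \<tau>.
    rearr_le f (\<lambda>s. c * s powr (-k) + d * s powr (-l)) \<Longrightarrow> (\<And>x. 0 \<le> f x) \<Longrightarrow> 0 \<le> c \<Longrightarrow> 0 \<le> d \<Longrightarrow>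
    E \<in> sets lebesgue \<Longrightarrow> emeasure lebesgue E = ennreal \<tau> \<Longrightarrow> \<tau> > 0 \<Longrightarrow>
    (\<integral>\<^sup>+x. ennreal (indicator E x) * riesz \<alpha> f x \<partial>lebesgue)
      \<le> ennreal (M * \<tau> * (c * \<tau> powr (-(k - \<alpha> / n)) + d * \<tau> powr (-(l - \<alpha> / n))))"
    using set_integral_riesz_le[OF \<alpha>, of k l] unfolding n_def by blast
  have kl: "k - \<alpha>/n = A/n" "l - \<alpha>/n = (A-\<delta>)/n" by (auto simp: k_def l_def add_divide_distrib)
  \<comment> \<open>Chosen so that C * M * e * 2 powr k = 1/2, with \<open>C\<close> from the
    inequality, \<open>M\<close> from the tested potential and the power of 2 from the halved
    arguments.\<close>
  define e where "e = 1 / (2 * C * M * 2 powr k)"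
  have e: "e > 0" using C M by (simp add: e_def)
  obtain L where L: "L > 0" "\<And>\<phi>. rearr_le V \<phi> \<Longrightarrow> (\<And>s. s > 0 \<Longrightarrow> 0 \<le> \<phi> s) \<Longrightarrow>
     rearr_le (\<lambda>y. indicator {y. L < V y} y * source y) (\<lambda>s. \<phi> (s/2) * (e * (s/2) powr (-((A + \<alpha> - B) / n))))"
    using high_part[OF e] by blast
  obtain D where D: "D > 0" "rearr_le (\<lambda>y. indicator (- {y. L < V y}) y * source y) (\<lambda>s. D * s powr (-l))"
    using low_part[OF \<delta>(1,3) L(1)] unfolding l_def by blast
  define d0 where "d0 = C * M * D"
  have d0: "d0 > 0" using C M D by (simp add: d0_def)
  show ?thesis
  proof (intro exI[of _ d0] conjI allI impI)
    fix c d :: real assume c: "c > 0" and d: "d \<ge> 0"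
      and V: "rearr_le V (\<lambda>s. c * s powr (-(B/n)) + d * s powr (-((B-\<delta>)/n)))"
    have f1: "rearr_le (\<lambda>y. indicator {y. L < V y} y * source y)
        (\<lambda>s. (c * e * 2 powr k) * s powr (-k) + (d * e * 2 powr k) * s powr (-l))"
    proof (rule rearr_le_mono_bound[OF L(2)[OF V]])
      fix s :: real assume s: "s > 0"
      have half2: "(s/2) powr (-x) * (s/2) powr (-y) = 2 powr (x + y) * s powr (-(x + y))" for x y :: real
      proof -
        have "(s/2) powr (-x) * (s/2) powr (-y) = (s/2) powr (-(x+y))" using s by (simp add: powr_add[symmetric])
        then show ?thesis using s by (simp only: powr_divide powr_minus) (simp add: divide_simps)
      qed
      have ex: "B/n + (A + \<alpha> - B)/n = k" "(B-\<delta>)/n + (A + \<alpha> - B)/n = l"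
        by (simp_all add: k_def l_def add_divide_distrib[symmetric] algebra_simps)
      \<comment> \<open>Writing both coefficients with 2 powr k lets the same factor 1/2 act on
        \<open>c\<close> and \<open>d\<close>.\<close>
      have "2 powr l \<le> 2 powr k" using \<delta> n by (intro powr_mono) (auto simp: k_def l_def divide_right_mono)
      then have le: "d * e * 2 powr l * s powr (-l) \<le> d * e * 2 powr k * s powr (-l)"
        using d e by (intro mult_right_mono mult_left_mono) auto
      have "(c * (s/2) powr - (B/n) + d * (s/2) powr - ((B-\<delta>)/n)) * (e * (s/2) powr - ((A + \<alpha> - B)/n))
        = c * e * ((s/2) powr - (B/n) * (s/2) powr - ((A + \<alpha> - B)/n)) +
          d * e * ((s/2) powr - ((B-\<delta>)/n) * (s/2) powr - ((A + \<alpha> - B)/n))"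
        by (simp only: distrib_right distrib_left mult_ac)
      also have "\<dots> = c * e * 2 powr k * s powr (-k) + d * e * 2 powr l * s powr (-l)"
        unfolding half2 ex by (simp only: mult_ac)
      finally show "(c * (s/2) powr - (B/n) + d * (s/2) powr - ((B-\<delta>)/n)) * (e * (s/2) powr - ((A + \<alpha> - B)/n))
         \<le> c * e * 2 powr k * s powr (-k) + d * e * 2 powr k * s powr (-l)"
        using le by simp
    qed (use c d in auto)
    have f2: "rearr_le (\<lambda>y. indicator (- {y. L < V y}) y * source y) (\<lambda>s. 0 * s powr (-k) + D * s powr (-l))"
      using D(2) by simp
    have set: "{y. L < V y} \<in> sets lebesgue" by (rule sets_superlevel[OF V_measurable])
    show "rearr_le U (\<lambda>s. c/2 * s powr (-(A/n)) + (d/2 + d0) * s powr (-((A-\<delta>)/n)))"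
    proof (rule rearr_le_of_set_integrals[OF U_measurable U_nonneg])
      fix s t :: real assume st: "0 < s" "s < t"
      have "t powr (-(A/n)) < s powr (-(A/n))" "t powr (-((A-\<delta>)/n)) < s powr (-((A-\<delta>)/n))"
        using st A \<delta> n by (auto intro!: powr_less_mono2_neg)
      then show "c/2 * t powr (-(A/n)) + (d/2 + d0) * t powr (-((A-\<delta>)/n)) <
          c/2 * s powr (-(A/n)) + (d/2 + d0) * s powr (-((A-\<delta>)/n))"
        using c d d0 by (intro add_strict_mono mult_strict_left_mono) auto
    next
      show "0 \<le> c/2 * s powr (-(A/n)) + (d/2 + d0) * s powr (-((A-\<delta>)/n))" for s
        using c d d0 by simp
    next
      fix E :: "'a set" and \<tau> assume E: "E \<in> sets lebesgue" "emeasure lebesgue E = ennreal \<tau>" "\<tau> > 0"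
      have Ei: "(\<lambda>x. ennreal (indicator E x)) \<in> borel_measurable lebesgue" using E by measurable
      have im: "(\<lambda>y. indicator S y * source y) \<in> borel_measurable lebesgue" if "S \<in> sets lebesgue" for S
        by (rule indicator_source_measurable[OF that])
      have set': "- {y. L < V y} \<in> sets lebesgue"
        using sets.compl_sets[OF set] by (simp add: Compl_eq_Diff_UNIV)
      let ?f1 = "\<lambda>y. indicator {y. L < V y} y * source y" and ?f2 = "\<lambda>y. indicator (- {y. L < V y}) y * source y"
      have "(\<integral>\<^sup>+x. ennreal (indicator E x) * ennreal (U x) \<partial>lebesgue) \<le>
          (\<integral>\<^sup>+x. ennreal C * (ennreal (indicator E x) * riesz \<alpha> ?f1 x + ennreal (indicator E x) * riesz \<alpha> ?f2 x) \<partial>lebesgue)"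
      proof (rule nn_integral_mono)
        fix x
        have "ennreal (indicator E x) * ennreal (U x) \<le> ennreal (indicator E x) * (ennreal C * riesz \<alpha> source x)"
          by (intro mult_left_mono U_le) auto
        also have "riesz \<alpha> source x = riesz \<alpha> ?f1 x + riesz \<alpha> ?f2 x"
          by (rule riesz_split[OF source_measurable source_nonneg set])
        finally show "ennreal (indicator E x) * ennreal (U x) \<le>
           ennreal C * (ennreal (indicator E x) * riesz \<alpha> ?f1 x + ennreal (indicator E x) * riesz \<alpha> ?f2 x)"
          by (simp add: distrib_left mult_ac)
      qed
      also have "\<dots> = ennreal C * ((\<integral>\<^sup>+x. ennreal (indicator E x) * riesz \<alpha> ?f1 x \<partial>lebesgue) +
          (\<integral>\<^sup>+x. ennreal (indicator E x) * riesz \<alpha> ?f2 x \<partial>lebesgue))"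
        using riesz_measurable[OF im[OF set], of \<alpha>] riesz_measurable[OF im[OF set'], of \<alpha>] Ei
        by (subst nn_integral_cmult, measurable) (subst nn_integral_add, auto)
      also have "\<dots> \<le> ennreal C * (ennreal (M * \<tau> * ((c * e * 2 powr k) * \<tau> powr (-(A/n)) + (d * e * 2 powr k) * \<tau> powr (-((A-\<delta>)/n)))) +
          ennreal (M * \<tau> * (0 * \<tau> powr (-(A/n)) + D * \<tau> powr (-((A-\<delta>)/n)))))"
        using M(2)[OF f1 _ _ _ E] M(2)[OF f2 _ _ _ E] c d e D
        by (intro mult_left_mono add_mono) (auto simp: kl)
      also have "\<dots> = ennreal (C * (M * \<tau> * ((c * e * 2 powr k) * \<tau> powr (-(A/n)) + (d * e * 2 powr k) * \<tau> powr (-((A-\<delta>)/n)))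
          + M * \<tau> * (0 * \<tau> powr (-(A/n)) + D * \<tau> powr (-((A-\<delta>)/n)))))"
        using C M c d e D E by (simp add: ennreal_plus ennreal_mult)
      also have "C * (M * \<tau> * ((c * e * 2 powr k) * \<tau> powr (-(A/n)) + (d * e * 2 powr k) * \<tau> powr (-((A-\<delta>)/n)))
          + M * \<tau> * (0 * \<tau> powr (-(A/n)) + D * \<tau> powr (-((A-\<delta>)/n)))) =
          \<tau> * ((C * M * e * 2 powr k) * c * \<tau> powr (-(A/n)) + ((C * M * e * 2 powr k) * d + C * M * D) * \<tau> powr (-((A-\<delta>)/n)))"
        by (simp add: algebra_simps)
      also have "C * M * e * 2 powr k = 1/2" using C M by (simp add: e_def)
      finally show "(\<integral>\<^sup>+x. ennreal (indicator E x) * ennreal (U x) \<partial>lebesgue) \<le>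
          ennreal (\<tau> * (c/2 * \<tau> powr (-(A/n)) + (d/2 + d0) * \<tau> powr (-((A-\<delta>)/n))))"
        by (simp add: d0_def)
    qed
  qed (use d0 in simp)
qed

text \<open>Source times kernel has exponent 1 + (A - Q \<delta>)/n < 1 under the improved bound and
  1 + A/n > 1 under the original one. Splicing at s = 1 bounds the potential uniformly in
  \<open>x\<close>.\<close>

lemma U_bounded_of_rearr:
  assumes \<delta>: "0 < \<delta>" "\<delta> < B" "A < Q * \<delta>"
    and V: "rearr_le V (\<lambda>s. D * s powr (-((B - \<delta>)/n)))" "D > 0"
  shows "\<exists>M. \<forall>x. U x \<le> M"
proof -
  obtain K where K: "K > 0" "rearr_le V (\<lambda>s. K * s powr (-(B / n)))" by (rule V_rearr)
  define \<theta> where "\<theta> = 1 - \<alpha>/n"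
  have bd: "\<exists>K'\<ge>0. \<forall>x. rearr_le (\<lambda>y. source y * norm (x - y) powr (\<alpha> - n))
       (\<lambda>s. K' * s powr (-((-a/n + k * Q) + \<theta>)))" if "rearr_le V (\<lambda>s. K * s powr (-k))" "K > 0" for K k
  proof -
    define K1 where "K1 = \<omega> powr (-a/n) * K powr Q * 2 powr (-a/n + k * Q)"
    have "K1 > 0" using \<omega> that by (simp add: K1_def)
    have "rearr_le source (\<lambda>s. K1 * s powr (-(-a/n + k * Q)))"
      unfolding K1_def
      using rearr_le_mult_powr[OF rearr_weight rearr_le_powr_powr[OF that(1), of Q]] that Q V_nonneg by simp
    from rearr_le_mult_powr[OF this rearr_kernel[folded \<theta>_def]]
    show ?thesis using \<open>K1 > 0\<close> \<omega>
      by (intro exI[of _ "K1 * \<omega> powr \<theta> * 2 powr (-a/n + k * Q + \<theta>)"]) auto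
  qed
  obtain K1 where K1: "K1 \<ge> 0" "\<And>x. rearr_le (\<lambda>y. source y * norm (x - y) powr (\<alpha> - n))
       (\<lambda>s. K1 * s powr (-((-a/n + (B-\<delta>)/n * Q) + \<theta>)))" using bd[OF V] by blast
  obtain K2 where K2: "K2 \<ge> 0" "\<And>x. rearr_le (\<lambda>y. source y * norm (x - y) powr (\<alpha> - n))
       (\<lambda>s. K2 * s powr (-((-a/n + B/n * Q) + \<theta>)))" using bd[OF K(2,1)] by blast
  define k1 where "k1 = (-a/n + (B-\<delta>)/n * Q) + \<theta>"
  define k2 where "k2 = (-a/n + B/n * Q) + \<theta>"
  have "k1 = 1 + (A - Q * \<delta>) / n" unfolding k1_def \<theta>_def using n QB by (simp add: field_simps)
  then have k1: "k1 < 1" using \<delta> n by (simp add: divide_less_0_iff)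
  have "k2 = 1 + A / n" unfolding k2_def \<theta>_def using n QB by (simp add: field_simps)
  then have k2: "k2 > 1" using A n by simp
  define R where "R = K1 * (1 powr (1 - k1) / (1 - k1)) + K2 * (1 powr (1 - k2) / (k2 - 1))"
  have R0: "R \<ge> 0" using K1 K2 k1 k2 by (simp add: R_def)
  have "riesz \<alpha> source x \<le> ennreal R" for x
    unfolding riesz_def R_def n_def[symmetric]
    by (rule nn_integral_le_two_powers[OF K1(2)[of x, folded k1_def] K2(2)[of x, folded k2_def]])
      (use K1 K2 k1 k2 in auto)
  then have "ennreal (U x) \<le> ennreal (C * R)" for x
    using order_trans[OF U_le[of x] mult_left_mono[of "riesz \<alpha> source x" "ennreal R" "ennreal C"]] C R0
    by (simp add: ennreal_mult)
  then show ?thesis using C R0 by (auto simp: ennreal_le_iff)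
qed

end

section \<open>Slow decay\<close>

text \<open>The superlevel sets for \<open>\<phi> j\<close> increase and cover the one for the
  limit. This removes the critical power once its coefficient tends to 0.\<close>

lemma rearr_le_limit:
  assumes h: "\<And>j::nat. rearr_le h (\<phi> j)"
    and dec: "\<And>s. s > 0 \<Longrightarrow> decseq (\<lambda>j. \<phi> j s)" and lim: "\<And>s. s > 0 \<Longrightarrow> (\<lambda>j. \<phi> j s) \<longlonglongrightarrow> \<psi> s"
  shows "rearr_le h \<psi>"
  unfolding rearr_le_def
proof (intro conjI allI impI)
  show "h \<in> borel_measurable lebesgue" by (rule rearr_le_measurable[OF h[of 0]])
  fix s :: real assume s: "s > 0"
  define S where "S = (\<lambda>j. {x. \<phi> j s < h x})"
  have S: "S j \<in> sets lebesgue" for j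
    unfolding S_def by (rule sets_superlevel[OF rearr_le_measurable[OF h[of 0]]])
  have inc: "incseq S"
    using dec[OF s] by (fastforce simp: incseq_def decseq_def S_def)
  have "{x. \<psi> s < h x} \<subseteq> (\<Union>j. S j)"
  proof
    fix x assume "x \<in> {x. \<psi> s < h x}"
    then have "\<forall>\<^sub>F j in sequentially. \<phi> j s < h x"
      using order_tendstoD(2)[OF lim[OF s]] by simp
    then obtain j where "\<phi> j s < h x" by (auto simp: eventually_sequentially)
    then show "x \<in> (\<Union>j. S j)" by (auto simp: S_def)
  qed
  then have "emeasure lebesgue {x. \<psi> s < h x} \<le> emeasure lebesgue (\<Union>j. S j)"
    using S by (intro emeasure_mono) auto
  also have "\<dots> = (SUP j. emeasure lebesgue (S j))"
    by (rule SUP_emeasure_incseq[symmetric]) (use S inc in auto)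
  also have "\<dots> \<le> ennreal s"
    unfolding S_def by (intro SUP_least rearr_leD[OF h s])
  finally show "emeasure lebesgue {x. \<psi> s < h x} \<le> ennreal s" .
qed

lemma emeasure_lebesgue_ball:
  "r \<ge> 0 \<Longrightarrow> emeasure lebesgue (ball (c::'a::euclidean_space) r) = ennreal (unit_ball_vol DIM('a) * r powr DIM('a))"
  by (cases "r = 0") (auto simp: emeasure_ball powr_realpow)

lemma sets_norm_intervals:
  "{y::'a::euclidean_space. norm y < r} \<in> sets lebesgue" "{y::'a. r \<le> norm y} \<in> sets lebesgue"
proof -
  have "{y::'a. norm y < r} = ball 0 r" "{y::'a. r \<le> norm y} = - ball 0 r" by auto
  then show "{y::'a. norm y < r} \<in> sets lebesgue" "{y::'a. r \<le> norm y} \<in> sets lebesgue" by auto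
qed

context riesz_half
begin

lemma emeasure_ball_\<omega>: "r > 0 \<Longrightarrow> emeasure lebesgue (ball (c::'a) r) \<le> ennreal (\<omega> * r powr n)"
  unfolding \<omega>_def n_def by (rule eq_refl[OF emeasure_lebesgue_ball]) simp

lemma rearr_source:
  fixes W :: "'a \<Rightarrow> real"
  assumes "rearr_le W (\<lambda>s. K * s powr (-(B/n)))" "0 \<le> K" "\<And>y. 0 \<le> W y"
  shows "rearr_le (\<lambda>y. norm y powr a * W y powr Q)
    (\<lambda>s. (\<omega> powr (-a/n) * 2 powr ((A+\<alpha>)/n) * K powr Q) * s powr (-((A+\<alpha>)/n)))"
proof -
  have "rearr_le (\<lambda>y. norm y powr a * W y powr Q)
    (\<lambda>s. (\<omega> powr (-a/n) * K powr Q * 2 powr (-a/n + B/n*Q)) * s powr (-(-a/n + B/n*Q)))"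
    by (rule rearr_le_mult_powr[OF rearr_weight rearr_le_powr_powr[OF assms(1)]]) (use assms Q in auto)
  then show ?thesis unfolding exponent_eqs(2) by (simp only: mult_ac)
qed

lemma tail_at_infinity:
  assumes "e > 0"
  obtains R where "R > 0" "rearr_le (\<lambda>y. indicator {y. R \<le> norm y} y * V y) (\<lambda>s. e * s powr (-(B / n)))"
proof -
  have "decseq (\<lambda>j::nat. {y::'a. real j + 1 \<le> norm y})" by (auto simp: decseq_def)
  moreover have "(\<Inter>j::nat. {y::'a. real j + 1 \<le> norm y}) = {}"
  proof -
    have "\<exists>j::nat. norm y < real j + 1" for y :: 'a
      using reals_Archimedean2[of "norm y"] by (metis add_strict_increasing2 zero_less_one less_add_one order_less_trans)
    then show ?thesis by (auto simp: set_eq_iff) (meson leD)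
  qed
  ultimately obtain j :: nat where "rearr_le (\<lambda>y. indicator {y. real j + 1 \<le> norm y} y * V y) (\<lambda>s. e * s powr (-(B / n)))"
    using V_tail[of "\<lambda>j::nat. {y. real j + 1 \<le> norm y}" e] assms sets_norm_intervals by blast
  then show ?thesis using that[of "real j + 1"] by simp
qed

text \<open>For |y| < |x|/2 the kernel is at most (|x|/2)^(\<alpha> - n), so only the mass of the
  source matters. The mass in a fixed ball is a constant, negligible since A < n - \<alpha>; outside
  that ball \<open>V\<close> has small weak norm, and the mass up to radius r is a small multiple of
  r^(n - A - \<alpha>).\<close>

lemma far_part:
  assumes \<eta>: "\<eta> > 0"
  obtains R where "R > 0" "\<And>x. R \<le> norm x \<Longrightarrow>
    riesz \<alpha> (\<lambda>y. indicator {y. norm y < norm x / 2} y * source y) x \<le> ennreal (\<eta> * norm x powr (-A))"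
proof -
  define k where "k = (A + \<alpha>) / n"
  have k: "k < 1" using n by (simp add: k_def)
  define c where "c = \<omega> powr (-a/n) * 2 powr k"
  have c: "c > 0" using \<omega> by (simp add: c_def)
  define c2 where "c2 = 2 powr (n - \<alpha>) * (2 * c / (1 - k) * (\<omega> * 2 powr (-n)) powr (1 - k))"
  have c2: "c2 > 0" using c k \<omega> by (simp add: c2_def)
  \<comment> \<open>Makes c2 * e powr Q = \<eta>/2, where \<open>c2\<close> collects the constants
    of the outer mass.\<close>
  define e where "e = (\<eta> / (2 * c2)) powr (1 / Q)"
  have e: "e > 0" "e powr Q = \<eta> / (2 * c2)" using \<eta> c2 Q by (simp_all add: e_def powr_powr)
  obtain R1 where R1: "R1 > 0" "rearr_le (\<lambda>y. indicator {y. R1 \<le> norm y} y * V y) (\<lambda>s. e * s powr (-(B / n)))"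
    using tail_at_infinity[OF e(1)] by blast
  define W where "W = (\<lambda>y. indicator {y. R1 \<le> norm y} y * V y)"
  have W0: "0 \<le> W y" for y using V_nonneg by (simp add: W_def)
  have sW: "rearr_le (\<lambda>y. norm y powr a * W y powr Q) (\<lambda>s. c * e powr Q * s powr (-k))"
    using rearr_source[OF R1(2) _ W0[unfolded W_def]] e by (simp add: W_def c_def k_def)
  obtain K where K: "K > 0" "rearr_le V (\<lambda>s. K * s powr (-(B / n)))" by (rule V_rearr)
  have sV: "rearr_le source (\<lambda>s. c * K powr Q * s powr (-k))"
    using rearr_source[OF K(2) _ V_nonneg] K by (simp add: c_def k_def)
  define I1 where "I1 = 2 * (c * K powr Q) / (1 - k) * (\<omega> * R1 powr n) powr (1 - k)"
  have I1: "(\<integral>\<^sup>+y. ennreal (indicator (ball 0 R1) y * source y) \<partial>lebesgue) \<le> ennreal I1"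
    unfolding I1_def by (rule set_integral_rearr_le[OF sV])
      (use c K k R1(1) \<omega> emeasure_ball_\<omega>[OF R1(1)] in simp_all)
  have I10: "I1 > 0" using c K k R1 \<omega> by (simp add: I1_def)
  \<comment> \<open>From this radius on, the fixed ball contributes at most (\<eta>/2)
    r^(-A).\<close>
  define R where "R = (2 powr (n - \<alpha>) * I1 * 2 / \<eta>) powr (1 / (n - \<alpha> - A))"
  have Rpos: "R > 0" using I10 \<eta> by (simp add: R_def)
  show ?thesis
  proof (rule that[OF Rpos])
    fix x :: 'a assume x: "R \<le> norm x"
    define r where "r = norm x"
    have r: "r > 0" "R \<le> r" using x Rpos by (auto simp: r_def)
    define f where "f = (\<lambda>y. indicator {y. norm y < r / 2} y * source y)"
    have fm: "f \<in> borel_measurable lebesgue" unfolding f_def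
      by (rule indicator_source_measurable[OF sets_norm_intervals(1)])
    have "riesz \<alpha> f x \<le> ennreal ((r/2) powr (\<alpha> - n)) * (\<integral>\<^sup>+y. ennreal (f y) \<partial>lebesgue)"
      unfolding n_def
    proof (rule riesz_far_le[OF fm _ \<alpha>(2)])
      fix y assume "f y \<noteq> 0"
      then have "norm y < r / 2" by (auto simp: f_def indicator_def split: if_splits)
      moreover have "r \<le> norm (x - y) + norm y" unfolding r_def using norm_triangle_ineq[of "x - y" y] by simp
      ultimately show "r / 2 \<le> norm (x - y)" by simp
    qed (use r in \<open>auto simp: f_def\<close>)
    also have "(\<integral>\<^sup>+y. ennreal (f y) \<partial>lebesgue) \<le> (\<integral>\<^sup>+y. ennreal (indicator (ball 0 R1) y * source y)
        + ennreal (indicator (ball 0 (r/2)) y * (norm y powr a * W y powr Q)) \<partial>lebesgue)"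
      by (intro nn_integral_mono) (auto simp: f_def W_def indicator_def not_less)
    also have "\<dots> = (\<integral>\<^sup>+y. ennreal (indicator (ball 0 R1) y * source y) \<partial>lebesgue)
        + (\<integral>\<^sup>+y. ennreal (indicator (ball 0 (r/2)) y * (norm y powr a * W y powr Q)) \<partial>lebesgue)"
      by (intro nn_integral_add measurable_compose[OF _ measurable_ennreal]
            borel_measurable_times[OF borel_measurable_indicator source_measurable]
            borel_measurable_times[OF borel_measurable_indicator rearr_le_measurable[OF sW]]) auto
    also have "\<dots> \<le> ennreal I1 + ennreal (2 * (c * e powr Q) / (1 - k) * (\<omega> * (r/2) powr n) powr (1 - k))"
      by (intro add_mono I1 set_integral_rearr_le[OF sW])
        (use r c k \<omega> emeasure_ball_\<omega>[of "r/2" 0] in simp_all)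
    also have "\<dots> = ennreal (I1 + 2 * (c * e powr Q) / (1 - k) * (\<omega> * (r/2) powr n) powr (1 - k))"
      using I10 c k by (intro ennreal_plus[symmetric]) auto
    finally have "riesz \<alpha> f x \<le> ennreal ((r/2) powr (\<alpha> - n) * (I1 + 2 * (c * e powr Q) / (1 - k) * (\<omega> * (r/2) powr n) powr (1 - k)))"
      using I10 c k by (simp add: ennreal_mult mult_left_mono)
    also have "(r/2) powr (\<alpha> - n) * (I1 + 2 * (c * e powr Q) / (1 - k) * (\<omega> * (r/2) powr n) powr (1 - k)) =
       2 powr (n - \<alpha>) * I1 * r powr (\<alpha> - n) + c2 * e powr Q * r powr (-A)"
    proof -
      have 1: "(r/2) powr (\<alpha> - n) = 2 powr (n - \<alpha>) * r powr (\<alpha> - n)"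
        using r by (simp add: powr_divide powr_diff)
      have nk: "n * (1 - k) = n - A - \<alpha>" using n by (simp add: k_def field_simps)
      have 2: "(\<omega> * (r/2) powr n) powr (1 - k) = (\<omega> * 2 powr (-n)) powr (1 - k) * r powr (n - A - \<alpha>)"
        using r \<omega> by (simp add: powr_divide powr_mult powr_powr powr_minus nk flip: nk) (simp add: powr_divide field_simps powr_powr powr_minus)
      have 3: "r powr (\<alpha> - n) * r powr (n - A - \<alpha>) = r powr (-A)" by (simp add: powr_add[symmetric])
      show ?thesis unfolding 1 2 c2_def 3[symmetric] by (simp add: algebra_simps)
    qed
    also have "2 powr (n - \<alpha>) * I1 * r powr (\<alpha> - n) \<le> \<eta> / 2 * r powr (-A)"
    proof -
      have "R powr (n - \<alpha> - A) = 2 powr (n - \<alpha>) * I1 * 2 / \<eta>"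
        using n I10 \<eta> by (simp add: R_def powr_powr)
      moreover have "R powr (n - \<alpha> - A) \<le> r powr (n - \<alpha> - A)"
        using r Rpos n by (intro powr_mono2) auto
      ultimately have "2 powr (n - \<alpha>) * I1 * 2 / \<eta> \<le> r powr (n - \<alpha> - A)" by simp
      then have "2 powr (n - \<alpha>) * I1 \<le> \<eta> / 2 * r powr (n - \<alpha> - A)"
        using \<eta> by (simp add: pos_divide_le_eq mult_ac)
      then have "2 powr (n - \<alpha>) * I1 * r powr (\<alpha> - n) \<le> \<eta> / 2 * r powr (n - \<alpha> - A) * r powr (\<alpha> - n)"
        by (intro mult_right_mono) auto
      also have "\<dots> = \<eta> / 2 * r powr (-A)" by (simp add: mult.assoc powr_add[symmetric])
      finally show ?thesis .
    qed
    also have "c2 * e powr Q = \<eta> / 2" using e c2 by simp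
    finally show "riesz \<alpha> (\<lambda>y. indicator {y. norm y < norm x / 2} y * source y) x \<le> ennreal (\<eta> * norm x powr (-A))"
      unfolding f_def r_def by (simp add: ennreal_leI)
  qed
qed

text \<open>This region contains the singularity of the kernel. The bound V <= l controls small
  sets, and the small weak norm of the tail controls large ones. The power A/B converts a size of
  \<open>V\<close> into the size of \<open>U\<close> with the same scaling.\<close>

lemma near_part:
  assumes \<eta>: "\<eta> > 0"
  obtains R where "R > 0" "\<And>x l. R \<le> norm x \<Longrightarrow> l > 0 \<Longrightarrow> (\<And>y. norm x / 2 \<le> norm y \<Longrightarrow> V y \<le> l) \<Longrightarrow>
    riesz \<alpha> (\<lambda>y. indicator (-{y. norm y < norm x / 2}) y * source y) x \<le> ennreal (\<eta> * (norm x powr (-A) + l powr (A/B)))"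
proof -
  define k where "k = (A + \<alpha>) / n"
  define \<theta> where "\<theta> = 1 - \<alpha> / n"
  have \<theta>: "\<theta> < 1" "1 - \<theta> = \<alpha> / n" using n \<alpha> by (auto simp: \<theta>_def)
  have k\<theta>: "k + \<theta> = 1 + A / n" using n by (simp add: k_def \<theta>_def add_divide_distrib)
  define c where "c = \<omega> powr (-a/n) * 2 powr k * \<omega> powr \<theta> * 2 powr (k + \<theta>)"
  have c: "c > 0" using \<omega> by (simp add: c_def)
  define c1 where "c1 = 2 powr (-a) * \<omega> powr \<theta> * n / \<alpha>"
  have c1: "c1 > 0" using \<omega> n \<alpha> by (simp add: c1_def)
  \<comment> \<open>\<open>\<eta>'\<close> and \<open>e\<close> are set so that each half is at most
    (\<eta>/2) T: c1 \<eta>'^(\<alpha>/A) = \<eta>/2 serves the first, and e^Q proportional to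
    \<eta> \<eta>' the second.\<close>
  define \<eta>' where "\<eta>' = (\<eta> / (2 * c1)) powr (A / \<alpha>)"
  have \<eta>': "\<eta>' > 0" "\<eta>' powr (\<alpha> / A) = \<eta> / (2 * c1)" using \<eta> c1 A \<alpha> by (simp_all add: \<eta>'_def powr_powr)
  define e where "e = (\<eta> * \<eta>' * A / (2 * c * n)) powr (1 / Q)"
  have e: "e > 0" "e powr Q = \<eta> * \<eta>' * A / (2 * c * n)" using \<eta> \<eta>' A c n Q by (simp_all add: e_def powr_powr)
  obtain R1 where R1: "R1 > 0" "rearr_le (\<lambda>y. indicator {y. R1 \<le> norm y} y * V y) (\<lambda>s. e * s powr (-(B / n)))"
    using tail_at_infinity[OF e(1)] by blast
  define W where "W = (\<lambda>y. indicator {y. R1 \<le> norm y} y * V y)"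
  have W0: "0 \<le> W y" for y using V_nonneg by (simp add: W_def)
  have sW: "rearr_le (\<lambda>y. norm y powr a * W y powr Q) (\<lambda>s. \<omega> powr (-a/n) * 2 powr k * e powr Q * s powr (-k))"
    using rearr_source[OF R1(2) _ W0[unfolded W_def]] e by (simp add: W_def k_def)
  show ?thesis
  \<comment> \<open>With this radius |y| >= |x|/2 forces |y| >= R1, where the tail is small.\<close>
  proof (rule that[of "2 * R1"])
    fix x :: 'a and l :: real assume x: "2 * R1 \<le> norm x" and l: "l > 0" and Vl: "\<And>y. norm x / 2 \<le> norm y \<Longrightarrow> V y \<le> l"
    define r where "r = norm x"
    have r: "r > 0" "R1 \<le> r / 2" using x R1 by (auto simp: r_def)
    define T where "T = r powr (-A) + l powr (A/B)"
    have T: "T > 0" "r powr (-A) \<le> T" "l powr (A/B) \<le> T" using r l by (auto simp: T_def add_pos_pos)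
    define f where "f = (\<lambda>y. indicator (-{y. norm y < r / 2}) y * source y)"
    have cs: "-{y::'a. norm y < r / 2} \<in> sets lebesgue"
      using sets.compl_sets[OF sets_norm_intervals(1), of "r/2"] by (simp add: Compl_eq_Diff_UNIV)
    have fm: "f \<in> borel_measurable lebesgue" unfolding f_def
      by (rule indicator_source_measurable[OF cs])
    have f0: "0 \<le> f y" for y by (simp add: f_def)
    have f1: "f y \<le> (r/2) powr a * l powr Q" for y
    proof (cases "norm y < r / 2")
      case False
      then have "norm y powr a \<le> (r/2) powr a" using a r by (intro powr_mono2') auto
      moreover have "V y powr Q \<le> l powr Q" using False Vl[of y] V_nonneg Q by (intro powr_mono2) (auto simp: r_def)
      ultimately show ?thesis using False by (simp add: f_def mult_mono)
    qed (simp add: f_def)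
    have c0: "0 < (r/2) powr a * l powr Q" using r l by simp
    have "rearr_le (\<lambda>y. f y * norm (x - y) powr (\<alpha> - n))
        (\<lambda>s. ((r/2) powr a * l powr Q) * (\<omega> powr (1 - \<alpha>/n) * s powr (-(1 - \<alpha>/n))))"
      by (rule rearr_le_mono[OF rearr_le_cmult[OF rearr_kernel[of x] c0]
            borel_measurable_times[OF fm kernel_measurable] mult_right_mono[OF f1]]) auto
    then have g1: "rearr_le (\<lambda>y. f y * norm (x - y) powr (\<alpha> - n)) (\<lambda>s. ((r/2) powr a * l powr Q * \<omega> powr \<theta>) * s powr (-\<theta>))"
      unfolding \<theta>_def by (simp only: mult.assoc)
    have f2: "rearr_le f (\<lambda>s. \<omega> powr (-a/n) * 2 powr k * e powr Q * s powr (-k))"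
    proof (rule rearr_le_mono[OF sW fm])
      fix y show "f y \<le> norm y powr a * W y powr Q"
        using r by (auto simp: f_def W_def indicator_def)
    qed auto
    have g2: "rearr_le (\<lambda>y. f y * norm (x - y) powr (\<alpha> - n)) (\<lambda>s. (c * e powr Q) * s powr (-(k+\<theta>)))"
      using rearr_le_mult_powr[OF f2 rearr_kernel[of x, folded \<theta>_def] f0] \<omega> by (simp add: c_def mult_ac)
    \<comment> \<open>with this splitting point the small factor \<open>e\<close> beats \<open>\<eta>'\<close> and both halves are multiples of \<open>T\<close>\<close>
    define s0 where "s0 = (T / \<eta>') powr (-(n / A))"
    have s0: "s0 > 0" using T \<eta>' by (simp add: s0_def)
    have s1: "s0 powr (1 - \<theta>) = (T / \<eta>') powr (-(\<alpha> / A))"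
      using n A unfolding \<theta>(2) s0_def by (simp add: powr_powr)
    have s2: "s0 powr (1 - (k + \<theta>)) = T / \<eta>'"
      using n A T \<eta>' unfolding k\<theta> s0_def by (simp add: powr_powr)
    have "riesz \<alpha> f x \<le> ennreal (((r/2) powr a * l powr Q * \<omega> powr \<theta>) * (s0 powr (1 - \<theta>) / (1 - \<theta>)) +
       (c * e powr Q) * (s0 powr (1 - (k+\<theta>)) / ((k+\<theta>) - 1)))"
      unfolding riesz_def n_def[symmetric]
      by (rule nn_integral_le_two_powers[OF g1 g2 _ s0]) (use f0 \<theta> k\<theta> A n c in auto)
    also have "((r/2) powr a * l powr Q * \<omega> powr \<theta>) * (s0 powr (1 - \<theta>) / (1 - \<theta>)) \<le> \<eta> / 2 * T"
    proof -
      \<comment> \<open>\<open>T\<close> dominates r^(-A) and l^(A/B), and the exponents Q B/A and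
        -a/A are nonnegative. By \<open>QB\<close> they add up to 1 + \<alpha>/A; the choice of
        \<open>s0\<close> removes the surplus \<alpha>/A.\<close>
      have "l powr Q = (l powr (A/B)) powr (Q * B / A)" using A B by (simp add: powr_powr)
      also have "\<dots> \<le> T powr (Q * B / A)" using T A B Q by (intro powr_mono2) auto
      finally have 1: "l powr Q \<le> T powr (Q * B / A)" .
      have "r powr a = (r powr (-A)) powr (-a / A)" using A by (simp add: powr_powr)
      also have "\<dots> \<le> T powr (-a / A)" using T A a by (intro powr_mono2) (auto simp: divide_nonpos_pos)
      finally have 2: "r powr a \<le> T powr (-a / A)" .
      have "Q * B / A + -a / A = 1 + \<alpha> / A" using A QB by (simp add: field_simps)
      then have 3: "T powr (Q * B / A) * T powr (-a / A) = T powr (1 + \<alpha> / A)" by (simp only: powr_add[symmetric])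
      have "(r/2) powr a * l powr Q = 2 powr (-a) * (l powr Q * r powr a)"
        using r by (simp add: powr_divide powr_minus field_simps)
      also have "\<dots> \<le> 2 powr (-a) * (T powr (Q * B / A) * T powr (-a / A))"
        using 1 2 by (intro mult_left_mono mult_mono) auto
      finally have 4: "(r/2) powr a * l powr Q \<le> 2 powr (-a) * T powr (1 + \<alpha> / A)" unfolding 3 .
      have "((r/2) powr a * l powr Q * \<omega> powr \<theta>) * (s0 powr (1 - \<theta>) / (1 - \<theta>)) =
          ((r/2) powr a * l powr Q) * (\<omega> powr \<theta> * ((T / \<eta>') powr (-(\<alpha> / A)) / (\<alpha> / n)))"
        unfolding s1 unfolding \<theta>(2) by simp
      also have "\<dots> \<le> (2 powr (-a) * T powr (1 + \<alpha> / A)) * (\<omega> powr \<theta> * ((T / \<eta>') powr (-(\<alpha> / A)) / (\<alpha> / n)))"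
        using \<alpha> n by (intro mult_right_mono 4) auto
      also have "\<dots> = c1 * \<eta>' powr (\<alpha> / A) * T"
        using T \<eta>' by (simp add: c1_def powr_add powr_divide powr_minus field_simps)
      also have "\<dots> = \<eta> / 2 * T" using c1 \<eta>' by simp
      finally show ?thesis .
    qed
    also have "(c * e powr Q) * (s0 powr (1 - (k+\<theta>)) / ((k+\<theta>) - 1)) = \<eta> / 2 * T"
      unfolding s2 unfolding e(2) k\<theta> using c \<eta>' A n by (simp add: field_simps)
    finally show "riesz \<alpha> (\<lambda>y. indicator (-{y. norm y < norm x / 2}) y * source y) x \<le> ennreal (\<eta> * (norm x powr (-A) + l powr (A/B)))"
      unfolding f_def r_def T_def by (simp add: ennreal_leI)
  qed (use R1 in simp)
qed

text \<open>For |x| >= 2 R the near region |y| >= |x|/2 lies in |y| >= R, where the assumption on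
  \<open>V\<close> holds. As \<eta> is arbitrary, the gain can outweigh the loss from doubling the
  radius.\<close>

lemma slow_step:
  assumes \<eta>: "\<eta> > 0"
  shows "\<exists>R1>0. \<forall>R\<ge>R1. \<forall>l>0. (\<forall>y. R \<le> norm y \<longrightarrow> V y \<le> l) \<longrightarrow>
      (\<forall>x. 2 * R \<le> norm x \<longrightarrow> U x \<le> \<eta> * (R powr (-A) + l powr (A/B)))"
proof -
  define \<eta>' where "\<eta>' = \<eta> / (2 * C)"
  have \<eta>': "\<eta>' > 0" using \<eta> C by (simp add: \<eta>'_def)
  obtain R1 where R1: "R1 > 0" "\<And>x. R1 \<le> norm x \<Longrightarrow>
    riesz \<alpha> (\<lambda>y. indicator {y. norm y < norm x / 2} y * source y) x \<le> ennreal (\<eta>' * norm x powr (-A))"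
    using far_part[OF \<eta>'] by blast
  obtain R2 where R2: "R2 > 0" "\<And>x l. R2 \<le> norm x \<Longrightarrow> l > 0 \<Longrightarrow> (\<And>y. norm x / 2 \<le> norm y \<Longrightarrow> V y \<le> l) \<Longrightarrow>
    riesz \<alpha> (\<lambda>y. indicator (-{y. norm y < norm x / 2}) y * source y) x \<le> ennreal (\<eta>' * (norm x powr (-A) + l powr (A/B)))"
    using near_part[OF \<eta>'] by blast
  show ?thesis
  proof (intro exI[of _ "max R1 R2"] conjI allI impI)
    show "max R1 R2 > 0" using R1 by simp
    fix R l :: real and x :: 'a
    assume R: "max R1 R2 \<le> R" and l: "0 < l" and V: "\<forall>y. R \<le> norm y \<longrightarrow> V y \<le> l" and x: "2 * R \<le> norm x"
    have R0: "R > 0" using R R1 by simp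
    define T where "T = R powr (-A) + l powr (A/B)"
    have xR: "norm x powr (-A) \<le> R powr (-A)" using R0 x A by (intro powr_mono2') auto
    have "ennreal (U x) \<le> ennreal C * riesz \<alpha> source x" by (rule U_le)
    also have "riesz \<alpha> source x = riesz \<alpha> (\<lambda>y. indicator {y. norm y < norm x / 2} y * source y) x
        + riesz \<alpha> (\<lambda>y. indicator (-{y. norm y < norm x / 2}) y * source y) x"
      by (rule riesz_split[OF source_measurable source_nonneg sets_norm_intervals(1)])
    also have "ennreal C * \<dots> \<le> ennreal C * (ennreal (\<eta>' * norm x powr (-A)) + ennreal (\<eta>' * (norm x powr (-A) + l powr (A/B))))"
      using R R0 x V l by (intro mult_left_mono add_mono R1(2) R2(2)) auto
    also have "\<dots> = ennreal (C * (\<eta>' * norm x powr (-A) + \<eta>' * (norm x powr (-A) + l powr (A/B))))"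
      using C \<eta>' by (simp add: ennreal_plus ennreal_mult)
    also have "\<dots> \<le> ennreal (C * (\<eta>' * T + \<eta>' * T))"
    proof -
      have "norm x powr (-A) \<le> T" using xR by (simp add: T_def add_increasing2)
      then show ?thesis using xR C \<eta>' by (intro ennreal_leI mult_left_mono add_mono) (auto simp: T_def)
    qed
    also have "C * (\<eta>' * T + \<eta>' * T) = \<eta> * T" using C by (simp add: \<eta>'_def)
    finally show "U x \<le> \<eta> * (R powr (-A) + l powr (A/B))"
      using \<eta> unfolding T_def by (subst (asm) ennreal_le_iff) auto
  qed
qed

end

section \<open>Fast decay\<close>

text \<open>\<kappa> < n gives integrability at the origin and \<kappa> > \<alpha> at infinity.
  Inside |y| < |x|/2 the kernel is frozen, outside the power is; in both parts the range of s above
  |x|^n uses the product bound of exponent 1 + (\<kappa> - \<alpha>)/n.\<close>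

lemma riesz_norm_powr:
  fixes \<alpha> \<kappa> :: real
  assumes "0 < \<alpha>" "\<alpha> < \<kappa>" "\<kappa> < DIM('a::euclidean_space)"
  obtains M where "M > 0" "\<And>x::'a. x \<noteq> 0 \<Longrightarrow> riesz \<alpha> (\<lambda>y. norm y powr (-\<kappa>)) x \<le> ennreal (M * norm x powr (\<alpha> - \<kappa>))"
proof -
  define n where "n = real DIM('a)"
  define \<omega> where "\<omega> = unit_ball_vol n"
  define \<theta> where "\<theta> = 1 - \<alpha> / n"
  define k where "k = \<kappa> / n"
  have n: "n > 0" "\<alpha> < \<kappa>" "\<kappa> < n" "0 < \<alpha>" "\<alpha> < n" using assms by (auto simp: n_def)
  have \<omega>: "\<omega> > 0" unfolding \<omega>_def using n by (intro unit_ball_vol_pos) simp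
  have k: "0 < k" "k < 1" using n by (auto simp: k_def)
  have \<theta>: "\<theta> < 1" "1 - \<theta> = \<alpha> / n" using n by (auto simp: \<theta>_def)
  have k\<theta>: "k + \<theta> = 1 + (\<kappa> - \<alpha>) / n" by (simp add: k_def \<theta>_def diff_divide_distrib)
  have k\<theta>1: "k + \<theta> > 1" unfolding k\<theta> using n by simp
  define K where "K = \<omega> powr k * \<omega> powr \<theta> * 2 powr (k + \<theta>)"
  define K' where "K' = K / ((k + \<theta>) - 1)"
  define M1 where "M1 = 2 powr (n - \<alpha>) * \<omega> powr k / (1 - k)"
  define M2 where "M2 = 2 powr \<kappa> * \<omega> powr \<theta> / (1 - \<theta>)"
  have pos: "K > 0" "K' > 0" "M1 > 0" "M2 > 0" using \<omega> k \<theta> k\<theta>1 n by (simp_all add: K_def K'_def M1_def M2_def)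
  show ?thesis
  proof (rule that[of "(M1 + K') + (M2 + K')"])
    show "(M1 + K') + (M2 + K') > 0" using pos by simp
    fix x :: 'a assume "x \<noteq> 0"
    define r where "r = norm x"
    have r: "r > 0" using \<open>x \<noteq> 0\<close> by (simp add: r_def)
    define f where "f = (\<lambda>y::'a. norm y powr (-\<kappa>))"
    have f0: "0 \<le> f y" for y by (simp add: f_def)
    have rf: "rearr_le f (\<lambda>s. \<omega> powr k * s powr (-k))"
      using rearr_le_norm_powr0[of \<kappa>, where 'a='a] n by (simp add: f_def \<omega>_def n_def k_def)
    note fm = rearr_le_measurable[OF rf]
    have rk: "rearr_le (\<lambda>y. norm (x - y) powr (\<alpha> - n)) (\<lambda>s. \<omega> powr \<theta> * s powr (-\<theta>))"
      using rearr_le_kernel[of \<alpha> x] n by (simp add: \<omega>_def n_def \<theta>_def)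
    have rfk: "rearr_le (\<lambda>y. f y * norm (x - y) powr (\<alpha> - n)) (\<lambda>s. K * s powr (-(k + \<theta>)))"
      unfolding K_def by (rule rearr_le_mult_powr[OF rf rk]) (auto simp: f0)
    define S where "S = {y::'a. norm y < r / 2}"
    have S: "S \<in> sets lebesgue" "-S \<in> sets lebesgue"
      unfolding S_def using sets_norm_intervals(1)[of "r/2", where 'a='a] sets.compl_sets[OF sets_norm_intervals(1)[of "r/2", where 'a='a]]
      by (simp_all add: Compl_eq_Diff_UNIV)
    have im: "(\<lambda>y. indicator T y * f y) \<in> borel_measurable lebesgue" if "T \<in> sets lebesgue" for T
      by (rule borel_measurable_times[OF borel_measurable_indicator[OF that] fm])
    have top: "rearr_le (\<lambda>y. indicator T y * f y * norm (x - y) powr (\<alpha> - n)) (\<lambda>s. K * s powr (-(k + \<theta>)))"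
      if "T \<in> sets lebesgue" for T
      by (rule rearr_le_mono[OF rfk borel_measurable_times[OF im[OF that] kernel_measurable]])
        (auto simp: indicator_def f0)
    have s0: "r powr n > 0" using r by simp
    have r1: "(r powr n) powr (1 - k) = r powr (n - \<kappa>)"
    proof -
      have "n * (1 - k) = n - \<kappa>" using n by (simp add: k_def right_diff_distrib)
      then show ?thesis by (simp only: powr_powr)
    qed
    have r2: "(r powr n) powr (1 - (k + \<theta>)) = r powr (\<alpha> - \<kappa>)"
    proof -
      have "n * (1 - (k + \<theta>)) = \<alpha> - \<kappa>" unfolding k\<theta> using n by simp
      then show ?thesis by (simp only: powr_powr)
    qed
    have r3: "(r powr n) powr (1 - \<theta>) = r powr \<alpha>" unfolding \<theta>(2) using n by (simp add: powr_powr)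
    have "riesz \<alpha> (\<lambda>y. indicator S y * f y) x \<le>
       ennreal (((r/2) powr (\<alpha> - n) * \<omega> powr k) * ((r powr n) powr (1 - k) / (1 - k)) + K * ((r powr n) powr (1 - (k + \<theta>)) / ((k + \<theta>) - 1)))"
      unfolding riesz_def n_def[symmetric]
    proof (rule nn_integral_le_two_powers[OF _ top[OF S(1)]])
      have c: "(r/2) powr (\<alpha> - n) > 0" using r by simp
      have le: "indicator S y * f y * norm (x - y) powr (\<alpha> - n) \<le> (r/2) powr (\<alpha> - n) * f y" for y
      proof (cases "y \<in> S")
        case True
        have "r \<le> norm (x - y) + norm y" unfolding r_def using norm_triangle_ineq[of "x - y" y] by simp
        then have "norm (x - y) powr (\<alpha> - n) \<le> (r/2) powr (\<alpha> - n)"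
          using True r n by (intro powr_mono2') (auto simp: S_def)
        from mult_left_mono[OF this f0[of y]] show ?thesis using True by (simp add: mult.commute)
      qed (use f0 in simp)
      have "rearr_le (\<lambda>y. indicator S y * f y * norm (x - y) powr (\<alpha> - n)) (\<lambda>s. (r/2) powr (\<alpha> - n) * (\<omega> powr k * s powr (-k)))"
        by (rule rearr_le_mono[OF rearr_le_cmult[OF rf c] borel_measurable_times[OF im[OF S(1)] kernel_measurable] le]) auto
      then show "rearr_le (\<lambda>y. indicator S y * f y * norm (x - y) powr (\<alpha> - n)) (\<lambda>s. (r/2) powr (\<alpha> - n) * \<omega> powr k * s powr (-k))"
        by (simp only: mult.assoc)
    qed (use pos f0 s0 k k\<theta>1 in auto)
    also have "((r/2) powr (\<alpha> - n) * \<omega> powr k) * ((r powr n) powr (1 - k) / (1 - k)) + K * ((r powr n) powr (1 - (k + \<theta>)) / ((k + \<theta>) - 1))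
       = (M1 + K') * r powr (\<alpha> - \<kappa>)"
    proof -
      have 1: "(r/2) powr (\<alpha> - n) = 2 powr (n - \<alpha>) * r powr (\<alpha> - n)" using r by (simp add: powr_divide powr_diff)
      have 2: "r powr (\<alpha> - n) * r powr (n - \<kappa>) = r powr (\<alpha> - \<kappa>)" by (simp add: powr_add[symmetric])
      have "(2 powr (n - \<alpha>) * r powr (\<alpha> - n) * \<omega> powr k) * (r powr (n - \<kappa>) / (1 - k)) =
          M1 * (r powr (\<alpha> - n) * r powr (n - \<kappa>))"
        by (simp add: M1_def mult_ac)
      then show ?thesis unfolding r1 r2 1 2 K'_def by (simp add: distrib_right)
    qed
    finally have 1: "riesz \<alpha> (\<lambda>y. indicator S y * f y) x \<le> ennreal ((M1 + K') * r powr (\<alpha> - \<kappa>))" .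
    have "riesz \<alpha> (\<lambda>y. indicator (-S) y * f y) x \<le>
       ennreal (((r/2) powr (-\<kappa>) * \<omega> powr \<theta>) * ((r powr n) powr (1 - \<theta>) / (1 - \<theta>)) + K * ((r powr n) powr (1 - (k + \<theta>)) / ((k + \<theta>) - 1)))"
      unfolding riesz_def n_def[symmetric]
    proof (rule nn_integral_le_two_powers[OF _ top[OF S(2)]])
      have c: "(r/2) powr (-\<kappa>) > 0" using r by simp
      have le: "indicator (-S) y * f y * norm (x - y) powr (\<alpha> - n) \<le> (r/2) powr (-\<kappa>) * norm (x - y) powr (\<alpha> - n)" for y
      proof (cases "y \<in> S")
        case False
        then have "f y \<le> (r/2) powr (-\<kappa>)" unfolding f_def
          using r n by (intro powr_mono2') (auto simp: S_def)
        then show ?thesis using False by (simp add: mult_right_mono)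
      qed simp
      have "rearr_le (\<lambda>y. indicator (-S) y * f y * norm (x - y) powr (\<alpha> - n)) (\<lambda>s. (r/2) powr (-\<kappa>) * (\<omega> powr \<theta> * s powr (-\<theta>)))"
        by (rule rearr_le_mono[OF rearr_le_cmult[OF rk c] borel_measurable_times[OF im[OF S(2)] kernel_measurable] le]) auto
      then show "rearr_le (\<lambda>y. indicator (-S) y * f y * norm (x - y) powr (\<alpha> - n)) (\<lambda>s. (r/2) powr (-\<kappa>) * \<omega> powr \<theta> * s powr (-\<theta>))"
        by (simp only: mult.assoc)
    qed (use pos f0 s0 \<theta> k\<theta>1 in auto)
    also have "((r/2) powr (-\<kappa>) * \<omega> powr \<theta>) * ((r powr n) powr (1 - \<theta>) / (1 - \<theta>)) + K * ((r powr n) powr (1 - (k + \<theta>)) / ((k + \<theta>) - 1))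
       = (M2 + K') * r powr (\<alpha> - \<kappa>)"
    proof -
      have 1: "(r/2) powr (-\<kappa>) = 2 powr \<kappa> * r powr (-\<kappa>)" using r by (simp add: powr_divide powr_minus field_simps)
      have 2: "r powr (-\<kappa>) * r powr \<alpha> = r powr (\<alpha> - \<kappa>)" by (simp add: powr_add[symmetric])
      have "(2 powr \<kappa> * r powr (-\<kappa>) * \<omega> powr \<theta>) * (r powr \<alpha> / (1 - \<theta>)) = M2 * (r powr (-\<kappa>) * r powr \<alpha>)"
        by (simp add: M2_def mult_ac)
      then show ?thesis unfolding r3 r2 1 2 K'_def by (simp add: distrib_right)
    qed
    finally have 2: "riesz \<alpha> (\<lambda>y. indicator (-S) y * f y) x \<le> ennreal ((M2 + K') * r powr (\<alpha> - \<kappa>))" .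
    have "riesz \<alpha> f x \<le> ennreal ((M1 + K') * r powr (\<alpha> - \<kappa>)) + ennreal ((M2 + K') * r powr (\<alpha> - \<kappa>))"
      unfolding riesz_split[OF fm f0 S(1)] by (rule add_mono[OF 1 2])
    also have "\<dots> = ennreal (((M1 + K') + (M2 + K')) * r powr (\<alpha> - \<kappa>))"
      unfolding distrib_right using pos by (intro ennreal_plus[symmetric]) auto
    finally show "riesz \<alpha> (\<lambda>y. norm y powr (-\<kappa>)) x \<le> ennreal (((M1 + K') + (M2 + K')) * norm x powr (\<alpha> - \<kappa>))"
      by (simp add: f_def r_def)
  qed
qed

lemma norm_powr_measurable: "(\<lambda>y::'a::euclidean_space. norm y powr e) \<in> borel_measurable lebesgue"
  by (rule borel_measurable_lebesgue_of_borel) measurable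

text \<open>Inside the ball of radius \<open>R\<close> boundedness suffices, as |y|^(-k) >= R^(-k)
  there. The point 0 is excluded because \<open>powr\<close> gives 0 there.\<close>

lemma norm_powr_bound_everywhere:
  fixes h :: "'a::real_normed_vector \<Rightarrow> real"
  assumes "\<And>y. h y \<le> M" "\<And>y. R \<le> norm y \<Longrightarrow> h y \<le> D * norm y powr (-k)" "R > 0" "k \<ge> 0" "M > 0"
  obtains D' where "D' > 0" "\<And>y. y \<noteq> 0 \<Longrightarrow> h y \<le> D' * norm y powr (-k)"
proof (rule that[of "max D (M * R powr k)"])
  show "max D (M * R powr k) > 0" using assms by (simp add: less_max_iff_disj)
  fix y :: 'a assume y: "y \<noteq> 0"
  show "h y \<le> max D (M * R powr k) * norm y powr (-k)"
  proof (cases "R \<le> norm y")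
    case True
    have "D * norm y powr (-k) \<le> max D (M * R powr k) * norm y powr (-k)" by (intro mult_right_mono) auto
    then show ?thesis using assms(2)[OF True] by simp
  next
    case False
    then have "norm y powr k \<le> R powr k" using assms by (intro powr_mono2) auto
    then have "1 \<le> R powr k * norm y powr (-k)" using y by (simp add: powr_minus field_simps)
    then have "M \<le> M * R powr k * norm y powr (-k)" using assms(5) by (simp add: mult.assoc)
    also have "\<dots> \<le> max D (M * R powr k) * norm y powr (-k)" by (intro mult_right_mono) auto
    finally show ?thesis using assms(1)[of y] by simp
  qed
qed

text \<open>Outside |y| < |x|/2 the source is at most a multiple of |x|^(\<kappa> - e)
  |y|^(-\<kappa>), whose potential is of order |x|^(\<alpha> - e) and goes into the summand 1.
  Inside, the kernel is at most a multiple of |x|^(\<alpha> - n). The integral is left open so that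
  the integrable and the logarithmic case can share the estimate.\<close>

lemma riesz_far_near:
  fixes f :: "'a::euclidean_space \<Rightarrow> real" and \<alpha> e M :: real
  assumes \<alpha>: "0 < \<alpha>" "\<alpha> < DIM('a)" and f: "f \<in> borel_measurable lebesgue" "\<And>y. 0 \<le> f y"
    and e: "DIM('a) \<le> e" and le: "\<And>y. y \<noteq> 0 \<Longrightarrow> f y \<le> M * norm y powr (-e)" and M: "M > 0"
  obtains D where "D > 0" "\<And>x. 1 \<le> norm x \<Longrightarrow> riesz \<alpha> f x \<le>
     ennreal (D * norm x powr (\<alpha> - DIM('a))) * (1 + (\<integral>\<^sup>+y. ennreal (indicator {y. norm y < norm x / 2} y * f y) \<partial>lebesgue))"
proof -
  define n where "n = real DIM('a)"
  \<comment> \<open>any exponent strictly between \<open>\<alpha>\<close> and \<open>n\<close> would do\<close>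
  define \<kappa> where "\<kappa> = (\<alpha> + n) / 2"
  have \<kappa>: "\<alpha> < \<kappa>" "\<kappa> < n" "\<kappa> < e" "0 < e - \<kappa>" using \<alpha> e by (auto simp: \<kappa>_def n_def)
  obtain M1 where M1: "M1 > 0" "\<And>x::'a. x \<noteq> 0 \<Longrightarrow> riesz \<alpha> (\<lambda>y. norm y powr (-\<kappa>)) x \<le> ennreal (M1 * norm x powr (\<alpha> - \<kappa>))"
    using riesz_norm_powr[OF \<alpha>(1) \<kappa>(1)] \<kappa>(2) unfolding n_def by blast
  define D1 where "D1 = M * 2 powr (e - \<kappa>) * M1"
  define D where "D = max D1 (2 powr (n - \<alpha>))"
  show ?thesis
  proof (rule that[of D])
    show "D > 0" by (simp add: D_def less_max_iff_disj)
    fix x :: 'a assume x: "1 \<le> norm x"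
    define r where "r = norm x"
    have r: "r \<ge> 1" using x by (simp add: r_def)
    define S where "S = {y::'a. norm y < r / 2}"
    have S: "S \<in> sets lebesgue" unfolding S_def by (rule sets_norm_intervals)
    have "riesz \<alpha> (\<lambda>y. indicator (-S) y * f y) x \<le> riesz \<alpha> (\<lambda>y. (M * (r/2) powr (-(e - \<kappa>))) * norm y powr (-\<kappa>)) x"
    proof (rule riesz_mono)
      fix y
      show "indicator (-S) y * f y \<le> (M * (r/2) powr (-(e - \<kappa>))) * norm y powr (-\<kappa>)"
      proof (cases "y \<in> S")
        case False
        then have y: "r / 2 \<le> norm y" "y \<noteq> 0" using r by (auto simp: S_def)
        have "norm y powr (-e) = norm y powr (-(e - \<kappa>)) * norm y powr (-\<kappa>)" by (simp add: powr_add[symmetric])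
        also have "\<dots> \<le> (r/2) powr (-(e - \<kappa>)) * norm y powr (-\<kappa>)"
          using y r \<kappa> by (intro mult_right_mono powr_mono2') auto
        finally have "M * norm y powr (-e) \<le> M * ((r/2) powr (-(e - \<kappa>)) * norm y powr (-\<kappa>))"
          using M by (intro mult_left_mono) auto
        then show ?thesis using False le[OF y(2)] by (simp add: mult.assoc)
      qed (use M in simp)
    qed
    also have "\<dots> = ennreal (M * (r/2) powr (-(e - \<kappa>))) * riesz \<alpha> (\<lambda>y. norm y powr (-\<kappa>)) x"
      by (rule riesz_cmult[OF norm_powr_measurable]) (use M in auto)
    also have "\<dots> \<le> ennreal (M * (r/2) powr (-(e - \<kappa>))) * ennreal (M1 * r powr (\<alpha> - \<kappa>))"
      unfolding r_def by (intro mult_left_mono M1(2)) (use x in auto)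
    also have "\<dots> = ennreal (D1 * r powr (\<alpha> - e))"
    proof -
      have "(r/2) powr (-(e - \<kappa>)) = 2 powr (e - \<kappa>) * r powr (-(e - \<kappa>))"
        using r by (simp add: powr_divide powr_diff)
      moreover have "r powr (-(e - \<kappa>)) * r powr (\<alpha> - \<kappa>) = r powr (\<alpha> - e)" by (simp add: powr_add[symmetric])
      moreover have "M * (2 powr (e - \<kappa>) * r powr (-(e - \<kappa>))) * (M1 * r powr (\<alpha> - \<kappa>)) =
          D1 * (r powr (-(e - \<kappa>)) * r powr (\<alpha> - \<kappa>))"
        by (simp only: D1_def mult_ac)
      ultimately have "M * (r/2) powr (-(e - \<kappa>)) * (M1 * r powr (\<alpha> - \<kappa>)) = D1 * r powr (\<alpha> - e)"
        by simp
      moreover have "ennreal (M * (r/2) powr (-(e - \<kappa>))) * ennreal (M1 * r powr (\<alpha> - \<kappa>)) =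
          ennreal (M * (r/2) powr (-(e - \<kappa>)) * (M1 * r powr (\<alpha> - \<kappa>)))"
        using M M1 by (intro ennreal_mult[symmetric]) auto
      ultimately show ?thesis by simp
    qed
    also have "\<dots> \<le> ennreal (D * r powr (\<alpha> - n))"
      using r e M M1 by (intro ennreal_leI mult_mono powr_mono) (auto simp: D_def D1_def n_def le_max_iff_disj)
    finally have 1: "riesz \<alpha> (\<lambda>y. indicator (-S) y * f y) x \<le> ennreal (D * r powr (\<alpha> - n))" .
    have "riesz \<alpha> (\<lambda>y. indicator S y * f y) x \<le> ennreal ((r/2) powr (\<alpha> - n)) * (\<integral>\<^sup>+y. ennreal (indicator S y * f y) \<partial>lebesgue)"
      unfolding n_def
    proof (rule riesz_far_le)
      show "(\<lambda>y. indicator S y * f y) \<in> borel_measurable lebesgue"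
        by (rule borel_measurable_times[OF borel_measurable_indicator[OF S] f(1)])
      fix y assume "indicator S y * f y \<noteq> 0"
      then have "norm y < r / 2" by (auto simp: S_def indicator_def split: if_splits)
      moreover have "r \<le> norm (x - y) + norm y" unfolding r_def using norm_triangle_ineq[of "x - y" y] by simp
      ultimately show "r / 2 \<le> norm (x - y)" by simp
    qed (use r f \<alpha> in auto)
    also have "\<dots> \<le> ennreal (D * r powr (\<alpha> - n)) * (\<integral>\<^sup>+y. ennreal (indicator S y * f y) \<partial>lebesgue)"
    proof (intro mult_right_mono ennreal_leI)
      have "(r/2) powr (\<alpha> - n) = 2 powr (n - \<alpha>) * r powr (\<alpha> - n)" using r by (simp add: powr_divide powr_diff)
      also have "\<dots> \<le> D * r powr (\<alpha> - n)" by (intro mult_right_mono) (auto simp: D_def)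
      finally show "(r/2) powr (\<alpha> - n) \<le> D * r powr (\<alpha> - n)" .
    qed simp
    finally have 2: "riesz \<alpha> (\<lambda>y. indicator S y * f y) x \<le> ennreal (D * r powr (\<alpha> - n)) * (\<integral>\<^sup>+y. ennreal (indicator S y * f y) \<partial>lebesgue)" .
    have "riesz \<alpha> f x \<le> ennreal (D * r powr (\<alpha> - n)) * (1 + (\<integral>\<^sup>+y. ennreal (indicator S y * f y) \<partial>lebesgue))"
      unfolding riesz_split[OF f S] using add_mono[OF 2 1] by (simp add: distrib_left add.commute)
    then show "riesz \<alpha> f x \<le> ennreal (D * norm x powr (\<alpha> - DIM('a))) *
        (1 + (\<integral>\<^sup>+y. ennreal (indicator {y. norm y < norm x / 2} y * f y) \<partial>lebesgue))"
      by (simp add: r_def S_def n_def)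
  qed
qed

text \<open>The constant is explicit because the logarithmic case lets e approach the dimension and
  needs the blow-up 1 / (e/n - 1). With f(0) = 0 the power bounds extend to every point.\<close>

lemma nn_integral_le_of_norm_powr_bounds:
  fixes f :: "'a::euclidean_space \<Rightarrow> real" and a e M N :: real
  assumes f: "f \<in> borel_measurable lebesgue" "\<And>y. 0 \<le> f y"
    and a: "-DIM('a) < a" "a \<le> 0" and e: "DIM('a) < e" and MN: "0 < M" "0 < N"
    and le: "\<And>y. y \<noteq> 0 \<Longrightarrow> f y \<le> M * norm y powr a" "\<And>y. y \<noteq> 0 \<Longrightarrow> f y \<le> N * norm y powr (-e)"
    and f00: "f 0 = 0"
  shows "(\<integral>\<^sup>+y. ennreal (f y) \<partial>lebesgue) \<le>
    ennreal (M * unit_ball_vol DIM('a) powr (-a / DIM('a)) / (1 + a / DIM('a)) +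
      N * unit_ball_vol DIM('a) powr (e / DIM('a)) / (e / DIM('a) - 1))"
proof -
  define n where "n = real DIM('a)"
  define \<omega> where "\<omega> = unit_ball_vol n"
  have n: "n > 0" "-n < a" "n < e" using a e by (auto simp: n_def)
  have \<omega>: "\<omega> > 0" unfolding \<omega>_def using n by (intro unit_ball_vol_pos) simp
  have 1: "rearr_le f (\<lambda>s. M * (\<omega> powr (-a/n) * s powr (-(-a/n))))"
    by (rule rearr_le_mono[OF rearr_le_cmult[OF rearr_le_norm_powr0[of "-a", where 'a='a] MN(1)] f(1)])
      (use a le(1) f00 MN in \<open>auto simp: \<omega>_def n_def\<close>, metis le(1) mult_eq_0_iff norm_zero order_refl powr_0)
  have 2: "rearr_le f (\<lambda>s. N * (\<omega> powr (e/n) * s powr (-(e/n))))"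
    by (rule rearr_le_mono[OF rearr_le_cmult[OF rearr_le_norm_powr0[of e, where 'a='a] MN(2)] f(1)])
      (use n le(2) f00 MN in \<open>auto simp: \<omega>_def n_def\<close>, metis le(2) mult_eq_0_iff norm_zero order_refl powr_0)
  have "(\<integral>\<^sup>+y. ennreal (f y) \<partial>lebesgue) \<le>
    ennreal (M * \<omega> powr (-a/n) * (1 powr (1 - (-a/n)) / (1 - (-a/n))) + N * \<omega> powr (e/n) * (1 powr (1 - e/n) / (e/n - 1)))"
    by (rule nn_integral_le_two_powers[OF 1[folded mult.assoc] 2[folded mult.assoc] f(2)])
      (use n MN in \<open>auto simp: field_simps\<close>)
  then show ?thesis by (simp add: \<omega>_def n_def)
qed

text \<open>Seen from far away an integrable source acts like a point mass, so its potential decays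
  like the kernel.\<close>

lemma riesz_fast_decay:
  fixes f :: "'a::euclidean_space \<Rightarrow> real" and \<alpha> a e M :: real
  assumes \<alpha>: "0 < \<alpha>" "\<alpha> < DIM('a)" and f: "f \<in> borel_measurable lebesgue" "\<And>y. 0 \<le> f y" "f 0 = 0"
    and a: "-DIM('a) < a" "a \<le> 0" and e: "DIM('a) < e" and M: "0 < M"
    and le: "\<And>y. y \<noteq> 0 \<Longrightarrow> f y \<le> M * norm y powr a" "\<And>y. y \<noteq> 0 \<Longrightarrow> f y \<le> M * norm y powr (-e)"
  obtains D where "D > 0" "\<And>x. 1 \<le> norm x \<Longrightarrow> riesz \<alpha> f x \<le> ennreal (D * norm x powr (\<alpha> - DIM('a)))"
proof -
  obtain D where D: "D > 0" "\<And>x. 1 \<le> norm x \<Longrightarrow> riesz \<alpha> f x \<le>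
     ennreal (D * norm x powr (\<alpha> - DIM('a))) * (1 + (\<integral>\<^sup>+y. ennreal (indicator {y. norm y < norm x / 2} y * f y) \<partial>lebesgue))"
    using riesz_far_near[OF \<alpha> f(1,2) less_imp_le[OF e] le(2) M] by blast
  define I where "I = M * unit_ball_vol DIM('a) powr (-a / DIM('a)) / (1 + a / DIM('a)) +
      M * unit_ball_vol DIM('a) powr (e / DIM('a)) / (e / DIM('a) - 1)"
  have I: "(\<integral>\<^sup>+y. ennreal (f y) \<partial>lebesgue) \<le> ennreal I"
    unfolding I_def by (rule nn_integral_le_of_norm_powr_bounds[OF f(1,2) a e M M le f(3)])
  have "-1 < a / DIM('a)" "1 < e / DIM('a)" using a e by (simp_all add: field_simps)
  then have I0: "I \<ge> 0" using M by (simp add: I_def)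
  show ?thesis
  proof (rule that[of "D * (1 + I)"])
    show "D * (1 + I) > 0" using D I0 by simp
    fix x :: 'a assume x: "1 \<le> norm x"
    have "(\<integral>\<^sup>+y. ennreal (indicator {y. norm y < norm x / 2} y * f y) \<partial>lebesgue) \<le> (\<integral>\<^sup>+y. ennreal (f y) \<partial>lebesgue)"
      using f(2) by (intro nn_integral_mono ennreal_leI) (auto simp: indicator_def)
    then have "riesz \<alpha> f x \<le> ennreal (D * norm x powr (\<alpha> - DIM('a))) * (1 + ennreal I)"
      using I by (intro order_trans[OF D(2)[OF x]] mult_left_mono add_left_mono) auto
    also have "\<dots> = ennreal (D * (1 + I) * norm x powr (\<alpha> - DIM('a)))"
      using I0 D by (subst ennreal_1[symmetric], subst ennreal_plus[symmetric])
        (auto simp: ennreal_mult[symmetric] mult_ac simp del: ennreal_1 ennreal_plus)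
    finally show "riesz \<alpha> f x \<le> ennreal (D * (1 + I) * norm x powr (\<alpha> - DIM('a)))" .
  qed
qed

text \<open>\<open>M\<close> depends on the exponents only; this and linearity in \<open>c\<close>
  and \<open>d\<close> are what the contraction at infinity requires.\<close>

lemma riesz_le_two_norm_powr:
  fixes \<alpha> \<kappa>\<^sub>1 \<kappa>\<^sub>2 :: real
  assumes \<alpha>: "0 < \<alpha>" and \<kappa>: "\<alpha> < \<kappa>\<^sub>1" "\<kappa>\<^sub>1 < DIM('a::euclidean_space)" "\<alpha> < \<kappa>\<^sub>2" "\<kappa>\<^sub>2 < DIM('a)"
  obtains M where "M > 0" "\<And>(f :: 'a \<Rightarrow> real) c d x. 0 \<le> c \<Longrightarrow> 0 \<le> d \<Longrightarrow>
    (\<And>y. f y \<le> c * norm y powr (-\<kappa>\<^sub>1) + d * norm y powr (-\<kappa>\<^sub>2)) \<Longrightarrow> x \<noteq> 0 \<Longrightarrow>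
    riesz \<alpha> f x \<le> ennreal (M * (c * norm x powr (\<alpha> - \<kappa>\<^sub>1) + d * norm x powr (\<alpha> - \<kappa>\<^sub>2)))"
proof -
  obtain M1 where M1: "M1 > 0" "\<And>x::'a. x \<noteq> 0 \<Longrightarrow> riesz \<alpha> (\<lambda>y. norm y powr (-\<kappa>\<^sub>1)) x \<le> ennreal (M1 * norm x powr (\<alpha> - \<kappa>\<^sub>1))"
    using riesz_norm_powr[OF \<alpha> \<kappa>(1,2)] by blast
  obtain M2 where M2: "M2 > 0" "\<And>x::'a. x \<noteq> 0 \<Longrightarrow> riesz \<alpha> (\<lambda>y. norm y powr (-\<kappa>\<^sub>2)) x \<le> ennreal (M2 * norm x powr (\<alpha> - \<kappa>\<^sub>2))"
    using riesz_norm_powr[OF \<alpha> \<kappa>(3,4)] by blast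
  show ?thesis
  proof (rule that[of "max M1 M2"])
    show "max M1 M2 > 0" using M1 by (simp add: less_max_iff_disj)
    fix f :: "'a \<Rightarrow> real" and c d :: real and x :: 'a
    assume cd: "0 \<le> c" "0 \<le> d" and f: "\<And>y. f y \<le> c * norm y powr (-\<kappa>\<^sub>1) + d * norm y powr (-\<kappa>\<^sub>2)" and x: "x \<noteq> 0"
    have "riesz \<alpha> f x \<le> riesz \<alpha> (\<lambda>y. c * norm y powr (-\<kappa>\<^sub>1) + d * norm y powr (-\<kappa>\<^sub>2)) x"
      by (rule riesz_mono[OF f])
    also have "\<dots> = ennreal c * riesz \<alpha> (\<lambda>y. norm y powr (-\<kappa>\<^sub>1)) x + ennreal d * riesz \<alpha> (\<lambda>y. norm y powr (-\<kappa>\<^sub>2)) x"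
      using cd by (simp add: riesz_add riesz_cmult norm_powr_measurable borel_measurable_times)
    also have "\<dots> \<le> ennreal c * ennreal (max M1 M2 * norm x powr (\<alpha> - \<kappa>\<^sub>1)) + ennreal d * ennreal (max M1 M2 * norm x powr (\<alpha> - \<kappa>\<^sub>2))"
      using order_trans[OF M1(2)[OF x] ennreal_leI[OF mult_right_mono[of M1 "max M1 M2"]]]
        order_trans[OF M2(2)[OF x] ennreal_leI[OF mult_right_mono[of M2 "max M1 M2"]]]
      by (intro add_mono mult_left_mono) auto
    also have "\<dots> = ennreal (c * (max M1 M2 * norm x powr (\<alpha> - \<kappa>\<^sub>1)) + d * (max M1 M2 * norm x powr (\<alpha> - \<kappa>\<^sub>2)))"
      using cd M1 by (simp add: ennreal_plus ennreal_mult)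
    also have "c * (max M1 M2 * norm x powr (\<alpha> - \<kappa>\<^sub>1)) + d * (max M1 M2 * norm x powr (\<alpha> - \<kappa>\<^sub>2)) =
        max M1 M2 * (c * norm x powr (\<alpha> - \<kappa>\<^sub>1) + d * norm x powr (\<alpha> - \<kappa>\<^sub>2))"
      by (simp add: distrib_left mult_ac)
    finally show "riesz \<alpha> f x \<le> ennreal (max M1 M2 * (c * norm x powr (\<alpha> - \<kappa>\<^sub>1) + d * norm x powr (\<alpha> - \<kappa>\<^sub>2)))" .
  qed
qed

section \<open>Contraction at infinity and final rates for one inequality\<close>

context riesz_half
begin

lemma source_zero: "source 0 = 0" by simp

lemma U_le_of_riesz_le:
  assumes "riesz \<alpha> source x \<le> ennreal r" "0 \<le> r"
  shows "U x \<le> C * r"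
proof -
  have "ennreal (U x) \<le> ennreal C * ennreal r"
    using order_trans[OF U_le mult_left_mono[OF assms(1)]] by simp
  then have "ennreal (U x) \<le> ennreal (C * r)" using C assms by (simp add: ennreal_mult)
  then show ?thesis using C assms by (subst (asm) ennreal_le_iff) auto
qed

text \<open>Pointwise counterpart of \<open>half_step\<close>: Q - 1 factors of \<open>V\<close> are
  replaced by the slow decay with small \<epsilon>, the last one by the current bound. The better
  order at infinity is +\<delta>, and A + \<delta> < n - \<alpha> keeps the source exponent A +
  \<delta> + \<alpha> below \<open>n\<close>.\<close>

lemma contraction_step:
  assumes \<delta>: "\<delta> > 0" "A + \<delta> < n - \<alpha>"
  shows "\<exists>\<epsilon>0>0. \<forall>\<epsilon> R0 M0. 0 < \<epsilon> \<longrightarrow> \<epsilon> \<le> \<epsilon>0 \<longrightarrow> R0 > 0 \<longrightarrow> M0 > 0 \<longrightarrow> (\<forall>y. V y \<le> M0) \<longrightarrow>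
    (\<forall>y. R0 \<le> norm y \<longrightarrow> V y \<le> \<epsilon> * norm y powr (-B)) \<longrightarrow>
    (\<exists>d0\<ge>0. \<forall>c\<ge>0. \<forall>d\<ge>0. (\<forall>y. R0 \<le> norm y \<longrightarrow> V y \<le> c * norm y powr (-B) + d * norm y powr (-(B+\<delta>))) \<longrightarrow>
       (\<forall>x. R0 \<le> norm x \<longrightarrow> U x \<le> c/2 * norm x powr (-A) + (d/2 + d0) * norm x powr (-(A+\<delta>))))"
proof -
  define \<kappa>\<^sub>1 where "\<kappa>\<^sub>1 = A + \<alpha>"
  define \<kappa>\<^sub>2 where "\<kappa>\<^sub>2 = A + \<delta> + \<alpha>"
  have "\<alpha> < \<kappa>\<^sub>1" "\<kappa>\<^sub>1 < DIM('a)" "\<alpha> < \<kappa>\<^sub>2" "\<kappa>\<^sub>2 < DIM('a)"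
    using \<delta> A by (auto simp: \<kappa>\<^sub>1_def \<kappa>\<^sub>2_def n_def)
  then obtain M where M: "M > 0" "\<And>(f :: 'a \<Rightarrow> real) c d x. 0 \<le> c \<Longrightarrow> 0 \<le> d \<Longrightarrow>
    (\<And>y. f y \<le> c * norm y powr (-\<kappa>\<^sub>1) + d * norm y powr (-\<kappa>\<^sub>2)) \<Longrightarrow> x \<noteq> 0 \<Longrightarrow>
    riesz \<alpha> f x \<le> ennreal (M * (c * norm x powr (\<alpha> - \<kappa>\<^sub>1) + d * norm x powr (\<alpha> - \<kappa>\<^sub>2)))"
    using riesz_le_two_norm_powr[OF \<alpha>(1), of \<kappa>\<^sub>1 \<kappa>\<^sub>2, where 'a='a] by blast
  \<comment> \<open>The threshold at which the coefficients are exactly halved: C * M * \<epsilon>0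
    powr (Q - 1) = 1/2.\<close>
  define \<epsilon>0 where "\<epsilon>0 = (1 / (2 * C * M)) powr (1 / (Q - 1))"
  have \<epsilon>0: "\<epsilon>0 > 0" "\<epsilon>0 powr (Q - 1) = 1 / (2 * C * M)" using C M Q by (simp_all add: \<epsilon>0_def powr_powr)
  show ?thesis
  proof (rule exI[of _ \<epsilon>0], intro conjI allI impI)
    fix \<epsilon> R0 M0 :: real assume \<epsilon>: "0 < \<epsilon>" "\<epsilon> \<le> \<epsilon>0" and R0: "R0 > 0" and M0: "M0 > 0" "\<forall>y. V y \<le> M0"
      and slow: "\<forall>y. R0 \<le> norm y \<longrightarrow> V y \<le> \<epsilon> * norm y powr (-B)"
    define E where "E = \<epsilon> powr (Q - 1)"
    have "E \<le> \<epsilon>0 powr (Q - 1)" unfolding E_def using \<epsilon> Q by (intro powr_mono2) auto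
    then have E: "E \<ge> 0" "C * M * E \<le> 1/2" using C M unfolding \<epsilon>0(2) by (auto simp: E_def field_simps)
    \<comment> \<open>Covers |y| < R0, where only boundedness is known: a +
      \<open>\<kappa>\<^sub>2\<close> is positive, so |y|^a is at most a constant times |y| to the
      power -\<open>\<kappa>\<^sub>2\<close>. It depends on neither \<open>c\<close> nor
      \<open>d\<close>.\<close>
    define D where "D = M0 powr Q * R0 powr (a + \<kappa>\<^sub>2)"
    have D: "D \<ge> 0" by (simp add: D_def)
    define d0 where "d0 = C * M * D"
    show "\<exists>d0\<ge>0. \<forall>c\<ge>0. \<forall>d\<ge>0. (\<forall>y. R0 \<le> norm y \<longrightarrow> V y \<le> c * norm y powr (-B) + d * norm y powr (-(B+\<delta>))) \<longrightarrow>
       (\<forall>x. R0 \<le> norm x \<longrightarrow> U x \<le> c/2 * norm x powr (-A) + (d/2 + d0) * norm x powr (-(A+\<delta>)))"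
    proof (intro exI[of _ d0] conjI allI impI)
      show "d0 \<ge> 0" using C M D by (simp add: d0_def)
      fix c d :: real and x :: 'a
      assume c: "0 \<le> c" and d: "0 \<le> d" and V: "\<forall>y. R0 \<le> norm y \<longrightarrow> V y \<le> c * norm y powr (-B) + d * norm y powr (-(B+\<delta>))"
        and x: "R0 \<le> norm x"
      have bound: "source y \<le> (E * c) * norm y powr (-\<kappa>\<^sub>1) + (E * d + D) * norm y powr (-\<kappa>\<^sub>2)" for y
      proof (cases "R0 \<le> norm y")
        case True
        then have y: "norm y > 0" using R0 by linarith
        have "V y powr Q = V y powr (Q - 1) * V y"
          using V_nonneg[of y] Q by (cases "V y = 0") (auto simp: powr_diff)
        also have "\<dots> \<le> (\<epsilon> * norm y powr (-B)) powr (Q - 1) * (c * norm y powr (-B) + d * norm y powr (-(B+\<delta>)))"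
          using slow V True V_nonneg Q by (intro mult_mono powr_mono2) auto
        also have "\<dots> = E * norm y powr (-B * (Q - 1)) * (c * norm y powr (-B) + d * norm y powr (-(B+\<delta>)))"
          using \<epsilon> by (simp add: E_def powr_mult powr_powr)
        finally have "source y \<le> norm y powr a * (E * norm y powr (-B * (Q - 1)) * (c * norm y powr (-B) + d * norm y powr (-(B+\<delta>))))"
          by (intro mult_left_mono) auto
        also have "\<dots> = E * c * (norm y powr a * norm y powr (-B * (Q - 1)) * norm y powr (-B)) +
            E * d * (norm y powr a * norm y powr (-B * (Q - 1)) * norm y powr (-(B+\<delta>)))"
          by (simp only: distrib_left mult_ac)
        also have "norm y powr a * norm y powr (-B * (Q - 1)) * norm y powr (-B) = norm y powr (-\<kappa>\<^sub>1)"
        proof -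
          have "a + -B * (Q - 1) + -B = -\<kappa>\<^sub>1" using QB by (simp add: \<kappa>\<^sub>1_def algebra_simps)
          then show ?thesis by (simp only: powr_add[symmetric])
        qed
        also have "norm y powr a * norm y powr (-B * (Q - 1)) * norm y powr (-(B+\<delta>)) = norm y powr (-\<kappa>\<^sub>2)"
        proof -
          have "a + -B * (Q - 1) + -(B+\<delta>) = -\<kappa>\<^sub>2" using QB by (simp add: \<kappa>\<^sub>2_def algebra_simps)
          then show ?thesis by (simp only: powr_add[symmetric])
        qed
        also have "E * c * norm y powr (-\<kappa>\<^sub>1) + E * d * norm y powr (-\<kappa>\<^sub>2) \<le> (E * c) * norm y powr (-\<kappa>\<^sub>1) + (E * d + D) * norm y powr (-\<kappa>\<^sub>2)"
          using D by (intro add_left_mono mult_right_mono) auto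
        finally show ?thesis .
      next
        case False
        show ?thesis
        proof (cases "y = 0")
          case y: False
          have "norm y powr a = norm y powr (a + \<kappa>\<^sub>2) * norm y powr (-\<kappa>\<^sub>2)" by (simp add: powr_add[symmetric])
          also have "\<dots> \<le> R0 powr (a + \<kappa>\<^sub>2) * norm y powr (-\<kappa>\<^sub>2)"
            using False a A \<delta> by (intro mult_right_mono powr_mono2) (auto simp: \<kappa>\<^sub>2_def)
          finally have "source y \<le> (R0 powr (a + \<kappa>\<^sub>2) * norm y powr (-\<kappa>\<^sub>2)) * M0 powr Q"
            using M0 V_nonneg Q by (intro mult_mono powr_mono2) auto
          also have "\<dots> = D * norm y powr (-\<kappa>\<^sub>2)" by (simp add: D_def mult_ac)
          also have "\<dots> \<le> (E * c) * norm y powr (-\<kappa>\<^sub>1) + (E * d + D) * norm y powr (-\<kappa>\<^sub>2)"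
            using E c d by (simp add: distrib_right)
          finally show ?thesis .
        qed simp
      qed
      have x0: "x \<noteq> 0" using x R0 by auto
      have "riesz \<alpha> source x \<le> ennreal (M * (E * c * norm x powr (\<alpha> - \<kappa>\<^sub>1) + (E * d + D) * norm x powr (\<alpha> - \<kappa>\<^sub>2)))"
        by (rule M(2)[OF _ _ bound x0]) (use E c d D in auto)
      then have "U x \<le> C * (M * (E * c * norm x powr (\<alpha> - \<kappa>\<^sub>1) + (E * d + D) * norm x powr (\<alpha> - \<kappa>\<^sub>2)))"
        using M E c d D by (intro U_le_of_riesz_le) auto
      also have "\<dots> = (C * M * E) * (c * norm x powr (-A)) + ((C * M * E) * d + d0) * norm x powr (-(A+\<delta>))"
        by (simp add: \<kappa>\<^sub>1_def \<kappa>\<^sub>2_def d0_def algebra_simps)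
      also have "\<dots> \<le> 1/2 * (c * norm x powr (-A)) + (1/2 * d + d0) * norm x powr (-(A+\<delta>))"
        using c d E(2) by (intro add_mono mult_right_mono) auto
      finally show "U x \<le> c/2 * norm x powr (-A) + (d/2 + d0) * norm x powr (-(A+\<delta>))" by simp
    qed
  qed (use \<epsilon>0 in simp)
qed

lemma source_le_of_bounds:
  assumes "\<And>y. V y \<le> M" "\<And>y. y \<noteq> 0 \<Longrightarrow> V y \<le> D * norm y powr (-k)" "M > 0" "D > 0"
  shows "\<And>y. source y \<le> max (M powr Q) (D powr Q) * norm y powr a"
    "\<And>y. y \<noteq> 0 \<Longrightarrow> source y \<le> max (M powr Q) (D powr Q) * norm y powr (-(Q * k - a))"
proof -
  fix y :: 'a
  have "V y powr Q \<le> M powr Q" using assms(1) V_nonneg Q by (intro powr_mono2) auto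
  then have "norm y powr a * V y powr Q \<le> norm y powr a * max (M powr Q) (D powr Q)"
    by (intro mult_left_mono) auto
  then show "source y \<le> max (M powr Q) (D powr Q) * norm y powr a" by (simp add: mult.commute)
  assume y: "y \<noteq> 0"
  have "V y powr Q \<le> (D * norm y powr (-k)) powr Q" using assms(2)[OF y] V_nonneg Q by (intro powr_mono2) auto
  also have "\<dots> = D powr Q * norm y powr (-(Q * k))" using assms by (simp add: powr_mult powr_powr mult.commute)
  also have "\<dots> \<le> max (M powr Q) (D powr Q) * norm y powr (-(Q * k))" by (intro mult_right_mono) auto
  finally have "source y \<le> norm y powr a * (max (M powr Q) (D powr Q) * norm y powr (-(Q * k)))"
    by (intro mult_left_mono) auto
  also have "\<dots> = max (M powr Q) (D powr Q) * (norm y powr a * norm y powr (-(Q * k)))" by (simp add: mult_ac)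
  also have "norm y powr a * norm y powr (-(Q * k)) = norm y powr (-(Q * k - a))" by (simp add: powr_add[symmetric])
  finally show "source y \<le> max (M powr Q) (D powr Q) * norm y powr (-(Q * k - a))" .
qed

text \<open>The exponent Q k - a > n makes the source integrable at infinity, and a > -\<alpha> > -n
  together with boundedness of \<open>V\<close> makes it integrable at 0.\<close>

lemma U_fast:
  assumes "\<And>y. V y \<le> M" "\<And>y. y \<noteq> 0 \<Longrightarrow> V y \<le> D * norm y powr (-k)" "M > 0" "D > 0" and k: "n < Q * k - a"
  shows "\<exists>K>0. \<forall>x. 1 \<le> norm x \<longrightarrow> U x \<le> K * norm x powr (\<alpha> - n)"
proof -
  define N where "N = max (M powr Q) (D powr Q)"
  have N: "N > 0" using assms by (simp add: N_def less_max_iff_disj)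
  have b1: "source y \<le> N * norm y powr a" for y
    unfolding N_def by (rule source_le_of_bounds(1)[where k = k]) (use assms in auto)
  have b2: "source y \<le> N * norm y powr (-(Q * k - a))" if "y \<noteq> 0" for y
    unfolding N_def by (rule source_le_of_bounds(2)) (use assms that in auto)
  have a': "-DIM('a) < a" using a \<alpha> by linarith
  obtain D' where D': "D' > 0" "\<And>x. 1 \<le> norm x \<Longrightarrow> riesz \<alpha> source x \<le> ennreal (D' * norm x powr (\<alpha> - DIM('a)))"
    using riesz_fast_decay[OF \<alpha> source_measurable source_nonneg source_zero a' a(2) k[unfolded n_def] N b1 b2] by blast
  have "U x \<le> C * (D' * norm x powr (\<alpha> - n))" if "1 \<le> norm x" for x
    using D' that by (intro U_le_of_riesz_le) (auto simp: n_def)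
  then show ?thesis using C D' by (intro exI[of _ "C * D'"]) (auto simp: mult_ac)
qed

text \<open>For an exponent strictly between \<alpha> and \<open>n\<close> the homogeneous estimate
  applies to the source directly, without splitting.\<close>

lemma U_intermediate:
  assumes "\<And>y. V y \<le> M" "\<And>y. y \<noteq> 0 \<Longrightarrow> V y \<le> D * norm y powr (-k)" "M > 0" "D > 0" and k: "\<alpha> < Q * k - a" "Q * k - a < n"
  shows "\<exists>K>0. \<forall>x. 1 \<le> norm x \<longrightarrow> U x \<le> K * norm x powr (\<alpha> - (Q * k - a))"
proof -
  define N where "N = max (M powr Q) (D powr Q)"
  define e where "e = Q * k - a"
  have N: "N > 0" using assms by (simp add: N_def less_max_iff_disj)
  have b2: "source y \<le> N * norm y powr (-(Q * k - a))" if "y \<noteq> 0" for y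
    unfolding N_def by (rule source_le_of_bounds(2)) (use assms that in auto)
  note b2 = b2[folded e_def]
  obtain M' where M': "M' > 0" "\<And>x::'a. x \<noteq> 0 \<Longrightarrow> riesz \<alpha> (\<lambda>y. norm y powr (-e)) x \<le> ennreal (M' * norm x powr (\<alpha> - e))"
    using riesz_norm_powr[OF \<alpha>(1), of e] k by (auto simp: e_def n_def)
  have "U x \<le> C * (N * M' * norm x powr (\<alpha> - e))" if x: "1 \<le> norm x" for x
  proof (rule U_le_of_riesz_le)
    have x0: "x \<noteq> 0" using x by auto
    have le: "source y \<le> N * norm y powr (-e)" for y using b2[of y] by (cases "y = 0") auto
    have "riesz \<alpha> source x \<le> riesz \<alpha> (\<lambda>y. N * norm y powr (-e)) x" by (rule riesz_mono[OF le])
    also have "\<dots> = ennreal N * riesz \<alpha> (\<lambda>y. norm y powr (-e)) x"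
      by (rule riesz_cmult[OF norm_powr_measurable]) (use N in auto)
    also have "\<dots> \<le> ennreal N * ennreal (M' * norm x powr (\<alpha> - e))" by (intro mult_left_mono M'(2) x0) simp
    also have "\<dots> = ennreal (N * M' * norm x powr (\<alpha> - e))" using N M' by (simp add: ennreal_mult mult.assoc)
    finally show "riesz \<alpha> source x \<le> ennreal (N * M' * norm x powr (\<alpha> - e))" .
  qed (use N M' in auto)
  then show ?thesis using C N M' by (intro exI[of _ "C * (N * M')"]) (auto simp: mult_ac e_def)
qed

text \<open>At exponent \<open>n\<close> the mass of the source in a ball of radius r grows at most
  like ln r, and this factor multiplies the kernel rate.\<close>

lemma U_log:
  assumes "\<And>y. V y \<le> M" "\<And>y. y \<noteq> 0 \<Longrightarrow> V y \<le> D * norm y powr (-k)" "M > 0" "D > 0" and k: "Q * k - a = n"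
  shows "\<exists>K>0. \<forall>x. 3 \<le> norm x \<longrightarrow> U x \<le> K * (norm x powr (\<alpha> - n) * ln (norm x))"
proof -
  define N where "N = max (M powr Q) (D powr Q)"
  have N: "N > 0" using assms by (simp add: N_def less_max_iff_disj)
  have b1: "source y \<le> N * norm y powr a" for y
    unfolding N_def by (rule source_le_of_bounds(1)[where k = k]) (use assms in auto)
  have b2: "source y \<le> N * norm y powr (-(Q * k - a))" if "y \<noteq> 0" for y
    unfolding N_def by (rule source_le_of_bounds(2)) (use assms that in auto)
  note b2 = b2[unfolded k]
  have a': "-DIM('a) < a" using a \<alpha> by linarith
  obtain D' where D': "D' > 0" "\<And>x. 1 \<le> norm x \<Longrightarrow> riesz \<alpha> source x \<le>
     ennreal (D' * norm x powr (\<alpha> - n)) * (1 + (\<integral>\<^sup>+y. ennreal (indicator {y. norm y < norm x / 2} y * source y) \<partial>lebesgue))"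
    using riesz_far_near[OF \<alpha> source_measurable source_nonneg, of n N] b2 N unfolding n_def by blast
  define I0 where "I0 = N * \<omega> powr (-a / n) / (1 + a / n)"
  \<comment> \<open>A bound uniform in \<epsilon> <= 1: the exponent (n + \<epsilon>)/n is at most 2
    because n >= 1.\<close>
  define w where "w = max \<omega> 1 powr 2"
  define I1 where "I1 = N * exp 1 * w * n"
  have an: "1 + a / n > 0" using a' n by (simp add: n_def field_simps)
  have I0: "I0 \<ge> 0" using N an by (simp add: I0_def)
  have I1: "I1 \<ge> 0" using N n by (simp add: I1_def w_def)
  \<comment> \<open>The radius 3 serves to give ln r >= 1, through exp 1 <= 3; additive constants
    can then be absorbed in the logarithm.\<close>
  have log1: "ln r \<ge> 1" if "r \<ge> 3" for r :: real
  proof -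
    have "exp 1 \<le> r" using exp_le that by linarith
    then show ?thesis using that by (subst ln_ge_iff) auto
  qed
  have int: "(\<integral>\<^sup>+y. ennreal (indicator {y. norm y < r / 2} y * source y) \<partial>lebesgue) \<le> ennreal (I0 + I1 * ln r)" if r: "r \<ge> 3" for r
  proof -
    \<comment> \<open>on \<open>|y| < r\<close> the critical power is at most \<open>exp 1\<close> times the power \<open>-(n + \<epsilon>)\<close>, whose integral is of order \<open>1 / \<epsilon>\<close>\<close>
    define \<epsilon> where "\<epsilon> = 1 / ln r"
    have lr: "ln r \<ge> 1" by (rule log1[OF r])
    have \<epsilon>: "\<epsilon> > 0" "\<epsilon> \<le> 1" using lr by (auto simp: \<epsilon>_def)
    have re: "r powr \<epsilon> = exp 1" using lr r by (simp add: powr_def \<epsilon>_def)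
    define f where "f = (\<lambda>y::'a. indicator {y. norm y < r / 2} y * source y)"
    have fm: "f \<in> borel_measurable lebesgue" unfolding f_def
      by (rule indicator_source_measurable[OF sets_norm_intervals(1)])
    have f1: "f y \<le> N * norm y powr a" for y using b1[of y] N by (auto simp: f_def indicator_def)
    have f2: "f y \<le> (N * exp 1) * norm y powr (-(n + \<epsilon>))" if y: "y \<noteq> 0" for y
    proof (cases "norm y < r / 2")
      case True
      have "norm y powr (-n) = norm y powr \<epsilon> * norm y powr (-(n + \<epsilon>))" by (simp add: powr_add[symmetric])
      also have "\<dots> \<le> r powr \<epsilon> * norm y powr (-(n + \<epsilon>))"
        using True \<epsilon> r by (intro mult_right_mono powr_mono2) auto
      finally have "N * norm y powr (-n) \<le> N * (exp 1 * norm y powr (-(n + \<epsilon>)))"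
        using N unfolding re by (intro mult_left_mono) auto
      then show ?thesis using True b2[OF y] by (simp add: f_def mult.assoc)
    qed (use N in \<open>simp add: f_def\<close>)
    have "(\<integral>\<^sup>+y. ennreal (f y) \<partial>lebesgue) \<le> ennreal (N * unit_ball_vol DIM('a) powr (-a / DIM('a)) / (1 + a / DIM('a)) +
      (N * exp 1) * unit_ball_vol DIM('a) powr ((n + \<epsilon>) / DIM('a)) / ((n + \<epsilon>) / DIM('a) - 1))"
      by (rule nn_integral_le_of_norm_powr_bounds[OF fm _ a' a(2) _ N _ f1 f2]) (use N \<epsilon> in \<open>auto simp: f_def n_def\<close>)
    also have "\<dots> = ennreal (I0 + (N * exp 1) * \<omega> powr ((n + \<epsilon>) / n) / ((n + \<epsilon>) / n - 1))"
      by (simp add: I0_def \<omega>_def n_def)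
    also have "\<dots> \<le> ennreal (I0 + I1 * ln r)"
    proof (intro ennreal_leI add_left_mono)
      have e1: "(n + \<epsilon>) / n - 1 = 1 / (n * ln r)" using n lr by (simp add: \<epsilon>_def field_simps)
      have n1: "n \<ge> 1" using DIM_positive[where 'a='a] unfolding n_def by linarith
      have "\<omega> powr ((n + \<epsilon>) / n) \<le> max \<omega> 1 powr ((n + \<epsilon>) / n)" using \<omega> n \<epsilon> by (intro powr_mono2) auto
      also have "\<dots> \<le> w" unfolding w_def using n n1 \<epsilon> by (intro powr_mono) (auto simp: field_simps)
      finally have "(N * exp 1) * \<omega> powr ((n + \<epsilon>) / n) * (n * ln r) \<le> (N * exp 1) * w * (n * ln r)"
        using N n lr by (intro mult_right_mono mult_left_mono) auto
      then show "(N * exp 1) * \<omega> powr ((n + \<epsilon>) / n) / ((n + \<epsilon>) / n - 1) \<le> I1 * ln r"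
        unfolding e1 by (simp add: I1_def mult_ac)
    qed
    finally show ?thesis by (simp add: f_def)
  qed
  have "U x \<le> C * (D' * (1 + I0 + I1) * (norm x powr (\<alpha> - n) * ln (norm x)))" if x: "3 \<le> norm x" for x
  proof (rule U_le_of_riesz_le)
    have l: "ln (norm x) \<ge> 1" by (rule log1[OF x])
    have "1 * 1 \<le> (1 + I0) * ln (norm x)" "I0 * 1 \<le> I0 * ln (norm x)"
      using I0 l by (intro mult_mono mult_left_mono; simp)+
    then have l2: "1 + (I0 + I1 * ln (norm x)) \<le> (1 + I0 + I1) * ln (norm x)" using l by (simp add: distrib_right)
    have "riesz \<alpha> source x \<le> ennreal (D' * norm x powr (\<alpha> - n)) * (1 + ennreal (I0 + I1 * ln (norm x)))"
      using int[OF x] x by (intro order_trans[OF D'(2)] mult_left_mono add_left_mono) auto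
    also have "1 + ennreal (I0 + I1 * ln (norm x)) = ennreal (1 + (I0 + I1 * ln (norm x)))"
      using I0 I1 l by (subst ennreal_plus) auto
    also have "ennreal (D' * norm x powr (\<alpha> - n)) * \<dots> \<le> ennreal (D' * norm x powr (\<alpha> - n)) * ennreal ((1 + I0 + I1) * ln (norm x))"
      by (intro mult_left_mono ennreal_leI l2) simp
    also have "\<dots> = ennreal (D' * (1 + I0 + I1) * (norm x powr (\<alpha> - n) * ln (norm x)))"
      using D' I0 I1 l by (subst ennreal_mult[symmetric]) (auto simp: mult_ac)
    finally show "riesz \<alpha> source x \<le> ennreal (D' * (1 + I0 + I1) * (norm x powr (\<alpha> - n) * ln (norm x)))" .
    show "0 \<le> D' * (1 + I0 + I1) * (norm x powr (\<alpha> - n) * ln (norm x))" using D' I0 I1 l by simp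
  qed
  then show ?thesis using C D' I0 I1
    by (intro exI[of _ "C * (D' * (1 + I0 + I1))"]) (auto simp: mult.assoc)
qed

end

section \<open>The coupled system\<close>

lemma tendsto_div_power2: "(\<lambda>j::nat. (K::real) / 2 ^ j) \<longlonglongrightarrow> 0"
  using tendsto_mult_right_zero[OF LIMSEQ_realpow_zero[of "1/2::real"], of K]
  by (simp add: power_divide)

text \<open>\<open>gap\<close> says that some \<delta> has both Q \<delta> > n - \<alpha> - A, which
  makes the source of \<open>U\<close> integrable, and A + \<delta>, B + \<delta> < n - \<alpha>, as
  the contraction at infinity demands. It is asymmetric because only \<open>U\<close> is to reach
  the kernel rate in all cases.\<close>

locale riesz_system =
  UV: riesz_half \<alpha> a Q A B C U V + VU: riesz_half \<alpha> b P B A C V U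
  for \<alpha> a b Q P A B C :: real and U V :: "'a::euclidean_space \<Rightarrow> real" +
  assumes gap: "real DIM('a) - \<alpha> - A < Q * (real DIM('a) - \<alpha> - max A B)"
begin

text \<open>The two half steps run in parallel. After j rounds the critical coefficient is K/2^j
  while the other one is still \<open>D\<close>, so the limit leaves the better power alone.\<close>

lemma rearr_improved:
  assumes \<delta>: "0 < \<delta>" "\<delta> < A" "\<delta> < B"
  obtains D where "D > 0" "rearr_le U (\<lambda>s. D * s powr (-((A-\<delta>)/UV.n)))" "rearr_le V (\<lambda>s. D * s powr (-((B-\<delta>)/UV.n)))"
proof -
  obtain d1 where d1: "d1 \<ge> 0" "\<And>c d. c > 0 \<Longrightarrow> d \<ge> 0 \<Longrightarrow> rearr_le V (\<lambda>s. c * s powr (-(B/UV.n)) + d * s powr (-((B-\<delta>)/UV.n))) \<Longrightarrow>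
     rearr_le U (\<lambda>s. c/2 * s powr (-(A/UV.n)) + (d/2 + d1) * s powr (-((A-\<delta>)/UV.n)))"
    using UV.half_step[OF \<delta>] by blast
  obtain d2 where d2: "d2 \<ge> 0" "\<And>c d. c > 0 \<Longrightarrow> d \<ge> 0 \<Longrightarrow> rearr_le U (\<lambda>s. c * s powr (-(A/UV.n)) + d * s powr (-((A-\<delta>)/UV.n))) \<Longrightarrow>
     rearr_le V (\<lambda>s. c/2 * s powr (-(B/UV.n)) + (d/2 + d2) * s powr (-((B-\<delta>)/UV.n)))"
    using VU.half_step[OF \<delta>(1,3,2)] by blast
  \<comment> \<open>Any D >= 2 (d1 + d2) is preserved by d -> d/2 + d1 and d -> d/2 + d2; the 1
    makes it positive.\<close>
  define D where "D = 2 * (d1 + d2) + 1"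
  have D: "D > 0" "D/2 + d1 \<le> D" "D/2 + d2 \<le> D" using d1(1) d2(1) by (auto simp: D_def)
  obtain K1 where K1: "K1 > 0" "rearr_le V (\<lambda>s. K1 * s powr (-(B/UV.n)))" by (rule UV.V_rearr)
  obtain K2 where K2: "K2 > 0" "rearr_le U (\<lambda>s. K2 * s powr (-(A/UV.n)))" by (rule VU.V_rearr)
  define K where "K = max K1 K2"
  have K: "K > 0" using K1 by (simp add: K_def less_max_iff_disj)
  have it: "rearr_le U (\<lambda>s. K / 2^j * s powr (-(A/UV.n)) + D * s powr (-((A-\<delta>)/UV.n))) \<and>
      rearr_le V (\<lambda>s. K / 2^j * s powr (-(B/UV.n)) + D * s powr (-((B-\<delta>)/UV.n)))" for j :: nat
  proof (induction j)
    case 0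
    have "K1 * s powr (-(B/UV.n)) \<le> K * s powr (-(B/UV.n)) + D * s powr (-((B-\<delta>)/UV.n))"
      "K2 * s powr (-(A/UV.n)) \<le> K * s powr (-(A/UV.n)) + D * s powr (-((A-\<delta>)/UV.n))" for s
      using D by (auto simp: K_def intro!: add_increasing2 mult_right_mono)
    then show ?case using rearr_le_mono_bound[OF K1(2)] rearr_le_mono_bound[OF K2(2)] by simp
  next
    case (Suc j)
    have Kj: "K / 2^j > 0" using K by simp
    have U: "rearr_le U (\<lambda>s. K / 2^j / 2 * s powr (-(A/UV.n)) + (D/2 + d1) * s powr (-((A-\<delta>)/UV.n)))"
      by (rule d1(2)[OF Kj less_imp_le[OF D(1)] conjunct2[OF Suc.IH]])
    have V: "rearr_le V (\<lambda>s. K / 2^j / 2 * s powr (-(B/UV.n)) + (D/2 + d2) * s powr (-((B-\<delta>)/UV.n)))"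
      by (rule d2(2)[OF Kj less_imp_le[OF D(1)] conjunct1[OF Suc.IH]])
    have eq: "K / 2^j / 2 = K / 2^Suc j" by simp
    show ?case
    proof
      show "rearr_le U (\<lambda>s. K / 2^Suc j * s powr (-(A/UV.n)) + D * s powr (-((A-\<delta>)/UV.n)))"
        by (rule rearr_le_mono_bound[OF U[unfolded eq]]) (intro add_left_mono mult_right_mono D, simp)
      show "rearr_le V (\<lambda>s. K / 2^Suc j * s powr (-(B/UV.n)) + D * s powr (-((B-\<delta>)/UV.n)))"
        by (rule rearr_le_mono_bound[OF V[unfolded eq]]) (intro add_left_mono mult_right_mono D, simp)
    qed
  qed
  have lim: "(\<lambda>j. K / 2^j * x + y) \<longlonglongrightarrow> y" for x y :: real
    using tendsto_add[OF tendsto_mult_left_zero[OF tendsto_div_power2[of K], of x] tendsto_const[of y]] by simp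
  have dec: "decseq (\<lambda>j. K / 2^j * x + y)" if "x \<ge> 0" for x y :: real
    unfolding decseq_def using that K
    by (auto intro!: add_right_mono mult_right_mono divide_left_mono power_increasing)
  show ?thesis
  proof (rule that[OF D(1)])
    show "rearr_le U (\<lambda>s. D * s powr (-((A-\<delta>)/UV.n)))"
      by (rule rearr_le_limit[where \<phi> = "\<lambda>j s. K / 2^j * s powr (-(A/UV.n)) + D * s powr (-((A-\<delta>)/UV.n))"])
        (use it lim dec in auto)
    show "rearr_le V (\<lambda>s. D * s powr (-((B-\<delta>)/UV.n)))"
      by (rule rearr_le_limit[where \<phi> = "\<lambda>j s. K / 2^j * s powr (-(B/UV.n)) + D * s powr (-((B-\<delta>)/UV.n))"])
        (use it lim dec in auto)
  qed
qed

lemma bounded_solution: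
  obtains M where "M > 0" "\<And>x. U x \<le> M" "\<And>x. V x \<le> M"
proof -
  have Q: "1 < Q" "1 < P" "A > 0" "B > 0" by (rule UV.Q VU.Q UV.A UV.B)+
  \<comment> \<open>Q B = A + \<alpha> + a > A and the mirrored identity are used here. Together the
    four inequalities yield \<delta> < min A B with Q \<delta> > A and P \<delta> > B.\<close>
  have "A < Q * A" "A < Q * B" "B < P * B" "B < P * A"
    using Q UV.QB VU.QB UV.a VU.a UV.\<alpha> by simp_all
  then have "max (A / Q) (B / P) < min A B" using Q by (simp add: pos_divide_less_eq mult.commute)
  then obtain \<delta> where "max (A / Q) (B / P) < \<delta>" "\<delta> < min A B" using dense by blast
  then have \<delta>: "A / Q < \<delta>" "B / P < \<delta>" "\<delta> < A" "\<delta> < B" by auto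
  have \<delta>0: "0 < \<delta>" using \<delta>(1) Q by (meson divide_pos_pos less_trans zero_less_one)
  have \<delta>1: "A < Q * \<delta>" "B < P * \<delta>" using \<delta>(1,2) Q by (simp_all add: pos_divide_less_eq mult.commute)
  obtain D where D: "D > 0" "rearr_le U (\<lambda>s. D * s powr (-((A-\<delta>)/UV.n)))" "rearr_le V (\<lambda>s. D * s powr (-((B-\<delta>)/UV.n)))"
    using rearr_improved[OF \<delta>0 \<delta>(3,4)] by blast
  obtain M1 where M1: "\<And>x. U x \<le> M1" using UV.U_bounded_of_rearr[OF \<delta>0 \<delta>(4) \<delta>1(1) D(3,1)] by blast
  obtain M2 where M2: "\<And>x. V x \<le> M2" using VU.U_bounded_of_rearr[OF \<delta>0 \<delta>(3) \<delta>1(2) D(2,1)] by blast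
  show ?thesis
  proof (rule that[of "max 1 (max M1 M2)"])
    show "U x \<le> max 1 (max M1 M2)" "V x \<le> max 1 (max M1 M2)" for x
      using M1[of x] M2[of x] by simp_all
  qed simp
qed

text \<open>One step takes \<zeta> at radius R to \<rho> max 1 \<zeta> at radius 2 R, so after
  finitely many doublings \<zeta> is at most \<rho> and remains so. Reading this off on dyadic
  shells gives the claim.\<close>

lemma slow_decay:
  assumes \<epsilon>: "\<epsilon> > 0"
  obtains R0 where "R0 > 0" "\<And>x. R0 \<le> norm x \<Longrightarrow> U x \<le> \<epsilon> * norm x powr (-A)" "\<And>x. R0 \<le> norm x \<Longrightarrow> V x \<le> \<epsilon> * norm x powr (-B)"
proof -
  have AB: "A > 0" "B > 0" by (rule UV.A UV.B)+
  \<comment> \<open>\<open>\<zeta>\<close> is the scale-invariant size of the solution outside the ball of radius \<open>R\<close>; passing to \<open>2 * R\<close> multiplies it by \<open>\<rho>\<close>\<close>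
  define \<rho> where "\<rho> = min (1/2) (min (\<epsilon> powr (1/A)) (\<epsilon> powr (1/B)) / 2)"
  have \<rho>: "0 < \<rho>" "\<rho> \<le> 1/2" "2 * \<rho> \<le> \<epsilon> powr (1/A)" "2 * \<rho> \<le> \<epsilon> powr (1/B)"
    using \<epsilon> by (auto simp: \<rho>_def min_def)
  \<comment> \<open>The factor 2 is the cost of placing |x| between consecutive dyadic
    radii.\<close>
  have \<rho>\<epsilon>: "(2*\<rho>) powr A \<le> \<epsilon>" "(2*\<rho>) powr B \<le> \<epsilon>"
    using powr_mono2[of A "2*\<rho>" "\<epsilon> powr (1/A)"] powr_mono2[of B "2*\<rho>" "\<epsilon> powr (1/B)"] \<rho> AB \<epsilon>
    by (simp_all add: powr_powr)
  \<comment> \<open>The outer 1/2 absorbs the sum of the two terms of a step; inside, \<rho>/2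
    combines the gain \<rho> with the change of radius from R to 2 R.\<close>
  define \<eta> where "\<eta> = (\<lambda>e. (\<rho>/2) powr e / 2)"
  have \<eta>: "\<eta> e > 0" for e using \<rho> by (simp add: \<eta>_def)
  obtain R1 where R1: "R1 > 0" "\<forall>R\<ge>R1. \<forall>l>0. (\<forall>y. R \<le> norm y \<longrightarrow> V y \<le> l) \<longrightarrow>
      (\<forall>x. 2 * R \<le> norm x \<longrightarrow> U x \<le> \<eta> A * (R powr (-A) + l powr (A/B)))"
    using UV.slow_step[OF \<eta>] by blast
  obtain R2 where R2: "R2 > 0" "\<forall>R\<ge>R2. \<forall>l>0. (\<forall>y. R \<le> norm y \<longrightarrow> U y \<le> l) \<longrightarrow>
      (\<forall>x. 2 * R \<le> norm x \<longrightarrow> V x \<le> \<eta> B * (R powr (-B) + l powr (B/A)))"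
    using VU.slow_step[OF \<eta>] by blast
  define Rm where "Rm = max R1 R2"
  have Rm: "Rm > 0" using R1 by (simp add: Rm_def less_max_iff_disj)
  define S where "S = (\<lambda>\<zeta> R. \<forall>x. R \<le> norm x \<longrightarrow> U x \<le> (\<zeta>/R) powr A \<and> V x \<le> (\<zeta>/R) powr B)"
  have combine: "\<eta> e * (R powr (-e) + (\<zeta>/R) powr e) \<le> (\<rho> * max 1 \<zeta> / (2*R)) powr e"
    if "R > 0" "\<zeta> > 0" "e > 0" for R \<zeta> e
  proof -
    have "R powr (-e) = (1/R) powr e" using that by (simp add: powr_minus powr_divide field_simps)
    also have "\<dots> \<le> (max 1 \<zeta> / R) powr e" using that by (intro powr_mono2 divide_right_mono) auto
    finally have 1: "R powr (-e) \<le> (max 1 \<zeta> / R) powr e" .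
    have 2: "(\<zeta>/R) powr e \<le> (max 1 \<zeta> / R) powr e" using that by (intro powr_mono2 divide_right_mono) auto
    have "\<eta> e * (R powr (-e) + (\<zeta>/R) powr e) \<le> \<eta> e * ((max 1 \<zeta> / R) powr e + (max 1 \<zeta> / R) powr e)"
      using 1 2 \<eta>[of e] by (intro mult_left_mono add_mono) auto
    also have "\<dots> = (\<rho>/2) powr e * (max 1 \<zeta> / R) powr e" by (simp add: \<eta>_def)
    also have "\<dots> = (\<rho>/2 * (max 1 \<zeta> / R)) powr e" using \<rho> that by (intro powr_mult[symmetric])
    finally show ?thesis by (simp add: mult_ac)
  qed
  have step: "S (\<rho> * max 1 \<zeta>) (2 * R)" if S: "S \<zeta> R" and R: "R \<ge> Rm" and \<zeta>: "\<zeta> > 0" for \<zeta> R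
    unfolding S_def
  proof (intro allI impI conjI)
    fix x :: 'a assume x: "2 * R \<le> norm x"
    have R0: "R > 0" using R Rm by simp
    have "U x \<le> \<eta> A * (R powr (-A) + ((\<zeta>/R) powr B) powr (A/B))"
      using R1(2) S R \<zeta> R0 x unfolding S_def Rm_def by simp
    also have "((\<zeta>/R) powr B) powr (A/B) = (\<zeta>/R) powr A" using AB by (simp add: powr_powr)
    finally show "U x \<le> (\<rho> * max 1 \<zeta> / (2 * R)) powr A" using combine[OF R0 \<zeta> AB(1)] by linarith
    have "V x \<le> \<eta> B * (R powr (-B) + ((\<zeta>/R) powr A) powr (B/A))"
      using R2(2) S R \<zeta> R0 x unfolding S_def Rm_def by simp
    also have "((\<zeta>/R) powr A) powr (B/A) = (\<zeta>/R) powr B" using AB by (simp add: powr_powr)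
    finally show "V x \<le> (\<rho> * max 1 \<zeta> / (2 * R)) powr B" using combine[OF R0 \<zeta> AB(2)] by linarith
  qed
  obtain M where M: "M > 0" "\<And>x. U x \<le> M" "\<And>x. V x \<le> M" using bounded_solution by blast
  \<comment> \<open>Boundedness supplies some finite \<zeta> at the first radius; how large it is
    does not matter, since \<rho>^j \<zeta>0 tends to 0.\<close>
  define \<zeta>0 where "\<zeta>0 = Rm * max (M powr (1/A)) (M powr (1/B))"
  have \<zeta>0: "\<zeta>0 > 0" using Rm M by (simp add: \<zeta>0_def less_max_iff_disj)
  have "M powr (1/A) \<le> \<zeta>0 / Rm" "M powr (1/B) \<le> \<zeta>0 / Rm" using Rm by (simp_all add: \<zeta>0_def)
  then have "(M powr (1/A)) powr A \<le> (\<zeta>0 / Rm) powr A" "(M powr (1/B)) powr B \<le> (\<zeta>0 / Rm) powr B"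
    using AB by (auto intro!: powr_mono2)
  then have "M \<le> (\<zeta>0 / Rm) powr A" "M \<le> (\<zeta>0 / Rm) powr B" using M AB by (simp_all add: powr_powr)
  then have S0: "S \<zeta>0 Rm" unfolding S_def using M by (meson order_trans)
  have mono: "S \<zeta>' R" if "S \<zeta> R" "\<zeta> \<le> \<zeta>'" "R > 0" "\<zeta> > 0" for \<zeta> \<zeta>' R
  proof -
    have "(\<zeta>/R) powr A \<le> (\<zeta>'/R) powr A" "(\<zeta>/R) powr B \<le> (\<zeta>'/R) powr B"
      using that AB by (auto intro!: powr_mono2 divide_right_mono)
    then show ?thesis using that(1) unfolding S_def by (meson order_trans)
  qed
  have it: "S (max \<rho> (\<rho>^j * \<zeta>0)) (2^j * Rm)" for j :: nat
  proof (induction j)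
    case 0
    then show ?case using mono[OF S0 _ Rm \<zeta>0] by simp
  next
    case (Suc j)
    define \<zeta> where "\<zeta> = max \<rho> (\<rho>^j * \<zeta>0)"
    have \<zeta>: "\<zeta> > 0" using \<rho> by (simp add: \<zeta>_def less_max_iff_disj)
    have "Rm \<le> 2^j * Rm" using Rm by simp
    then have "S (\<rho> * max 1 \<zeta>) (2 * (2^j * Rm))" using step Suc.IH \<zeta> unfolding \<zeta>_def by blast
    moreover have "\<rho> * max 1 \<zeta> \<le> max \<rho> (\<rho>^Suc j * \<zeta>0)"
    proof -
      have "\<rho> * \<rho> \<le> \<rho>" using \<rho> by (simp add: mult_left_le)
      moreover have "\<rho> * max 1 \<zeta> = max \<rho> (max (\<rho> * \<rho>) (\<rho>^Suc j * \<zeta>0))"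
        using \<rho> by (simp add: \<zeta>_def max_mult_distrib_left mult.assoc)
      ultimately show ?thesis by simp
    qed
    ultimately show ?case using mono[of "\<rho> * max 1 \<zeta>"] \<rho> \<zeta> Rm
      by (simp add: mult.assoc less_max_iff_disj)
  qed
  have "(\<lambda>j. \<rho>^j) \<longlonglongrightarrow> 0" using \<rho> by (intro LIMSEQ_realpow_zero) auto
  then have "(\<lambda>j. \<rho>^j * \<zeta>0) \<longlonglongrightarrow> 0" by (rule tendsto_mult_left_zero)
  then have "\<forall>\<^sub>F j in sequentially. \<rho>^j * \<zeta>0 < \<rho>" using \<rho>(1) by (rule order_tendstoD(2))
  then obtain J where J: "\<And>j. j \<ge> J \<Longrightarrow> \<rho>^j * \<zeta>0 < \<rho>" by (auto simp: eventually_sequentially)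
  have fin: "U x \<le> \<epsilon> * norm x powr (-A) \<and> V x \<le> \<epsilon> * norm x powr (-B)" if x: "2^J * Rm \<le> norm x" for x
  proof -
    have x0: "norm x > 0" using x Rm by (meson less_le_trans mult_pos_pos zero_less_numeral zero_less_power)
    obtain N where N: "norm x / Rm < 2^N" using real_arch_pow[of 2 "norm x / Rm"] by auto
    define k where "k = (LEAST k. norm x < 2^k * Rm)"
    have ex: "norm x < 2^N * Rm" using N Rm by (simp add: pos_divide_less_eq)
    have k1: "norm x < 2^k * Rm" unfolding k_def using ex by (rule LeastI)
    have "J < k"
    proof (rule ccontr)
      assume "\<not> J < k"
      then have "2^k * Rm \<le> 2^J * Rm" using Rm by (intro mult_right_mono power_increasing) auto
      then show False using x k1 by linarith
    qed
    then obtain j where j: "k = Suc j" "J \<le> j" by (cases k) auto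
    have k2: "2^j * Rm \<le> norm x"
      using not_less_Least[of j "\<lambda>k. norm x < 2^k * Rm"] j unfolding k_def[symmetric] by simp
    have Sj: "S \<rho> (2^j * Rm)" using it[of j] J[OF j(2)] by (simp add: max_def)
    have "\<rho> / (2^j * Rm) \<le> 2 * \<rho> / norm x"
      using k1 x0 \<rho> Rm unfolding j by (simp add: field_simps)
    then have le: "(\<rho> / (2^j * Rm)) powr e \<le> (2 * \<rho>) powr e * norm x powr (-e)" if "e > 0" for e
      using powr_mono2[of e "\<rho> / (2^j * Rm)" "2 * \<rho> / norm x"] that \<rho> Rm x0
      by (simp add: powr_divide powr_minus_divide)
    have le2: "(2 * \<rho>) powr A * norm x powr (-A) \<le> \<epsilon> * norm x powr (-A)"
        "(2 * \<rho>) powr B * norm x powr (-B) \<le> \<epsilon> * norm x powr (-B)"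
      using \<rho>\<epsilon> by (auto intro!: mult_right_mono)
    show ?thesis using Sj k2 le[OF AB(1)] le[OF AB(2)] le2 unfolding S_def by (meson order_trans)
  qed
  show ?thesis by (rule that[of "2^J * Rm"]) (use fin Rm in auto)
qed

text \<open>Slow decay is invoked with an \<epsilon> small enough for both contractions and at one
  common radius. The iteration then runs as in \<open>rearr_improved\<close>, now pointwise.\<close>

lemma improved_decay:
  assumes \<delta>: "\<delta> > 0" "A + \<delta> < UV.n - \<alpha>" "B + \<delta> < UV.n - \<alpha>"
  obtains R0 D where "R0 > 0" "D > 0" "\<And>x. R0 \<le> norm x \<Longrightarrow> U x \<le> D * norm x powr (-(A+\<delta>))"
    "\<And>x. R0 \<le> norm x \<Longrightarrow> V x \<le> D * norm x powr (-(B+\<delta>))"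
proof -
  obtain e1 where e1: "e1 > 0" "\<forall>\<epsilon> R0 M0. 0 < \<epsilon> \<longrightarrow> \<epsilon> \<le> e1 \<longrightarrow> R0 > 0 \<longrightarrow> M0 > 0 \<longrightarrow> (\<forall>y. V y \<le> M0) \<longrightarrow>
    (\<forall>y. R0 \<le> norm y \<longrightarrow> V y \<le> \<epsilon> * norm y powr (-B)) \<longrightarrow>
    (\<exists>d0\<ge>0. \<forall>c\<ge>0. \<forall>d\<ge>0. (\<forall>y. R0 \<le> norm y \<longrightarrow> V y \<le> c * norm y powr (-B) + d * norm y powr (-(B+\<delta>))) \<longrightarrow>
       (\<forall>x. R0 \<le> norm x \<longrightarrow> U x \<le> c/2 * norm x powr (-A) + (d/2 + d0) * norm x powr (-(A+\<delta>))))"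
    using UV.contraction_step[OF \<delta>(1,2)] by blast
  obtain e2 where e2: "e2 > 0" "\<forall>\<epsilon> R0 M0. 0 < \<epsilon> \<longrightarrow> \<epsilon> \<le> e2 \<longrightarrow> R0 > 0 \<longrightarrow> M0 > 0 \<longrightarrow> (\<forall>y. U y \<le> M0) \<longrightarrow>
    (\<forall>y. R0 \<le> norm y \<longrightarrow> U y \<le> \<epsilon> * norm y powr (-A)) \<longrightarrow>
    (\<exists>d0\<ge>0. \<forall>c\<ge>0. \<forall>d\<ge>0. (\<forall>y. R0 \<le> norm y \<longrightarrow> U y \<le> c * norm y powr (-A) + d * norm y powr (-(A+\<delta>))) \<longrightarrow>
       (\<forall>x. R0 \<le> norm x \<longrightarrow> V x \<le> c/2 * norm x powr (-B) + (d/2 + d0) * norm x powr (-(B+\<delta>))))"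
    using VU.contraction_step[OF \<delta>(1,3)] by blast
  define \<epsilon> where "\<epsilon> = min e1 e2"
  have \<epsilon>: "\<epsilon> > 0" "\<epsilon> \<le> e1" "\<epsilon> \<le> e2" using e1(1) e2(1) by (auto simp: \<epsilon>_def)
  obtain M where M: "M > 0" "\<And>x. U x \<le> M" "\<And>x. V x \<le> M" using bounded_solution by blast
  obtain R0 where R0: "R0 > 0" "\<And>x. R0 \<le> norm x \<Longrightarrow> U x \<le> \<epsilon> * norm x powr (-A)" "\<And>x. R0 \<le> norm x \<Longrightarrow> V x \<le> \<epsilon> * norm x powr (-B)"
    using slow_decay[OF \<epsilon>(1)] by blast
  have slow: "\<forall>y. R0 \<le> norm y \<longrightarrow> U y \<le> \<epsilon> * norm y powr (-A)" "\<forall>y. R0 \<le> norm y \<longrightarrow> V y \<le> \<epsilon> * norm y powr (-B)"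
    and all: "\<forall>y. U y \<le> M" "\<forall>y. V y \<le> M"
    using R0 M by auto
  obtain d1 where d1: "d1 \<ge> 0" "\<forall>c\<ge>0. \<forall>d\<ge>0. (\<forall>y. R0 \<le> norm y \<longrightarrow> V y \<le> c * norm y powr (-B) + d * norm y powr (-(B+\<delta>))) \<longrightarrow>
       (\<forall>x. R0 \<le> norm x \<longrightarrow> U x \<le> c/2 * norm x powr (-A) + (d/2 + d1) * norm x powr (-(A+\<delta>)))"
    using e1(2)[THEN spec, THEN spec, THEN spec, THEN mp, OF \<epsilon>(1), THEN mp, OF \<epsilon>(2), THEN mp, OF R0(1),
      THEN mp, OF M(1), THEN mp, OF all(2), THEN mp, OF slow(2)] by blast
  obtain d2 where d2: "d2 \<ge> 0" "\<forall>c\<ge>0. \<forall>d\<ge>0. (\<forall>y. R0 \<le> norm y \<longrightarrow> U y \<le> c * norm y powr (-A) + d * norm y powr (-(A+\<delta>))) \<longrightarrow>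
       (\<forall>x. R0 \<le> norm x \<longrightarrow> V x \<le> c/2 * norm x powr (-B) + (d/2 + d2) * norm x powr (-(B+\<delta>)))"
    using e2(2)[THEN spec, THEN spec, THEN spec, THEN mp, OF \<epsilon>(1), THEN mp, OF \<epsilon>(3), THEN mp, OF R0(1),
      THEN mp, OF M(1), THEN mp, OF all(1), THEN mp, OF slow(1)] by blast
  define D where "D = 2 * (d1 + d2) + 1"
  have D: "D > 0" "D/2 + d1 \<le> D" "D/2 + d2 \<le> D" using d1(1) d2(1) by (auto simp: D_def)
  have it: "\<forall>x. R0 \<le> norm x \<longrightarrow> U x \<le> \<epsilon>/2^j * norm x powr (-A) + D * norm x powr (-(A+\<delta>)) \<and>
      V x \<le> \<epsilon>/2^j * norm x powr (-B) + D * norm x powr (-(B+\<delta>))" for j :: nat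
  proof (induction j)
    case 0
    show ?case using R0(2,3) D by (simp add: add_increasing2)
  next
    case (Suc j)
    have c: "\<epsilon>/2^j \<ge> 0" using \<epsilon> by simp
    have U: "\<forall>x. R0 \<le> norm x \<longrightarrow> U x \<le> \<epsilon>/2^j/2 * norm x powr (-A) + (D/2 + d1) * norm x powr (-(A+\<delta>))"
      using d1(2) c less_imp_le[OF D(1)] Suc.IH by blast
    have V: "\<forall>x. R0 \<le> norm x \<longrightarrow> V x \<le> \<epsilon>/2^j/2 * norm x powr (-B) + (D/2 + d2) * norm x powr (-(B+\<delta>))"
      using d2(2) c less_imp_le[OF D(1)] Suc.IH by blast
    show ?case
    proof (intro allI impI conjI)
      fix x :: 'a assume x: "R0 \<le> norm x"
      have "(D/2 + d1) * norm x powr (-(A+\<delta>)) \<le> D * norm x powr (-(A+\<delta>))"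
        "(D/2 + d2) * norm x powr (-(B+\<delta>)) \<le> D * norm x powr (-(B+\<delta>))"
        using D by (auto intro!: mult_right_mono)
      moreover have "\<epsilon>/2^j/2 = \<epsilon>/2^Suc j" by simp
      ultimately show "U x \<le> \<epsilon>/2^Suc j * norm x powr (-A) + D * norm x powr (-(A+\<delta>))"
        "V x \<le> \<epsilon>/2^Suc j * norm x powr (-B) + D * norm x powr (-(B+\<delta>))"
        using U[rule_format, OF x] V[rule_format, OF x] by (simp_all only:)
    qed
  qed
  have lim: "(\<lambda>j. \<epsilon> / 2^j * x + y) \<longlonglongrightarrow> y" for x y :: real
    using tendsto_add[OF tendsto_mult_left_zero[OF tendsto_div_power2[of \<epsilon>], of x] tendsto_const[of y]] by simp
  show ?thesis
  proof (rule that[OF R0(1) D(1)])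
    fix x :: 'a assume x: "R0 \<le> norm x"
    show "U x \<le> D * norm x powr (-(A+\<delta>))"
      by (rule LIMSEQ_le_const[OF lim[of "norm x powr (-A)"]]) (use it x in blast)
    show "V x \<le> D * norm x powr (-(B+\<delta>))"
      by (rule LIMSEQ_le_const[OF lim[of "norm x powr (-B)"]]) (use it x in blast)
  qed
qed

text \<open>The improved decay of \<open>V\<close> gives a source of exponent Q (B + \<delta>) - a =
  A + \<alpha> + Q \<delta>, and \<open>gap\<close> permits a \<delta> for which this exceeds the
  dimension.\<close>

lemma U_decay:
  obtains K where "K > 0" "\<And>x. x \<noteq> 0 \<Longrightarrow> U x \<le> K * norm x powr (-(UV.n - \<alpha>))"
proof -
  define m where "m = UV.n - \<alpha> - max A B"
  have m: "m > 0" using UV.n by (simp add: m_def)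
  have Q: "1 < Q" by (rule UV.Q)
  have "(UV.n - \<alpha> - A) / Q < m" using gap Q by (simp add: m_def UV.n_def pos_divide_less_eq mult.commute)
  moreover have "0 < (UV.n - \<alpha> - A) / Q" using UV.n Q by simp
  ultimately obtain \<delta> where \<delta>: "(UV.n - \<alpha> - A) / Q < \<delta>" "\<delta> < m" "0 < \<delta>"
    using dense[of "(UV.n - \<alpha> - A) / Q" m] by auto
  have \<delta>Q: "UV.n - \<alpha> - A < Q * \<delta>" using \<delta> Q by (simp add: pos_divide_less_eq mult.commute)
  have "A + \<delta> < UV.n - \<alpha>" "B + \<delta> < UV.n - \<alpha>" using \<delta> by (auto simp: m_def)
  then obtain R0 D where R0: "R0 > 0" "D > 0" "\<And>x. R0 \<le> norm x \<Longrightarrow> V x \<le> D * norm x powr (-(B+\<delta>))"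
    using improved_decay[OF \<delta>(3)] by metis
  obtain M where M: "M > 0" "\<And>x. U x \<le> M" "\<And>x. V x \<le> M" using bounded_solution by blast
  have "B + \<delta> \<ge> 0" using UV.B \<delta> by simp
  then obtain D' where D': "D' > 0" "\<And>y. y \<noteq> 0 \<Longrightarrow> V y \<le> D' * norm y powr (-(B+\<delta>))"
    using norm_powr_bound_everywhere[OF M(3) R0(3) R0(1) _ M(1)] by blast
  have "Q * (B + \<delta>) - a = A + \<alpha> + Q * \<delta>" using UV.QB by (simp add: distrib_left)
  then have "UV.n < Q * (B + \<delta>) - a" using \<delta>Q by simp
  then obtain K where K: "\<forall>x. 1 \<le> norm x \<longrightarrow> U x \<le> K * norm x powr (\<alpha> - UV.n)"
    using UV.U_fast[OF M(3) D'(2) M(1) D'(1)] by blast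
  have "U x \<le> K * norm x powr (-(UV.n - \<alpha>))" if "1 \<le> norm x" for x using K that by simp
  from norm_powr_bound_everywhere[OF M(2) this _ _ M(1)] show ?thesis
    using that UV.n by (metis diff_ge_0_iff_ge less_imp_le zero_less_one)
qed

text \<open>With \<open>U\<close> at the kernel rate the source of \<open>V\<close> has exponent P
  (n - \<alpha>) - b, and its position relative to n decides. Implications with one constant, all
  from radius 3 on, keep the three cases in one statement.\<close>

lemma V_decay:
  obtains K where "K > 0"
    "UV.n < P * (UV.n - \<alpha>) - b \<Longrightarrow> \<forall>x. 3 \<le> norm x \<longrightarrow> V x \<le> K * norm x powr (\<alpha> - UV.n)"
    "P * (UV.n - \<alpha>) - b = UV.n \<Longrightarrow> \<forall>x. 3 \<le> norm x \<longrightarrow> V x \<le> K * (norm x powr (\<alpha> - UV.n) * ln (norm x))"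
    "P * (UV.n - \<alpha>) - b < UV.n \<Longrightarrow> \<forall>x. 3 \<le> norm x \<longrightarrow> V x \<le> K * norm x powr (\<alpha> - (P * (UV.n - \<alpha>) - b))"
proof -
  obtain K where K: "K > 0" "\<And>x. x \<noteq> 0 \<Longrightarrow> U x \<le> K * norm x powr (-(UV.n - \<alpha>))" using U_decay by blast
  obtain M where M: "M > 0" "\<And>x. U x \<le> M" "\<And>x. V x \<le> M" using bounded_solution by blast
  \<comment> \<open>Since P A = B + \<alpha> + b, this puts the source exponent above \<alpha>, as
    the intermediate case demands.\<close>
  have "P * A < P * (UV.n - \<alpha>)" using UV.n VU.Q by simp
  then have e: "\<alpha> < P * (UV.n - \<alpha>) - b" using VU.QB UV.B by simp
  consider (1) "UV.n < P * (UV.n - \<alpha>) - b" | (2) "P * (UV.n - \<alpha>) - b = UV.n" | (3) "P * (UV.n - \<alpha>) - b < UV.n" by linarith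
  then show ?thesis
  proof cases
    case 1
    then obtain K' where "K' > 0" "\<forall>x. 1 \<le> norm x \<longrightarrow> V x \<le> K' * norm x powr (\<alpha> - UV.n)"
      using VU.U_fast[OF M(2) K(2) M(1) K(1)] by blast
    then show ?thesis using 1 by (intro that[of K']) auto
  next
    case 2
    then obtain K' where "K' > 0" "\<forall>x. 3 \<le> norm x \<longrightarrow> V x \<le> K' * (norm x powr (\<alpha> - UV.n) * ln (norm x))"
      using VU.U_log[OF M(2) K(2) M(1) K(1)] by blast
    then show ?thesis using 2 by (intro that[of K']) auto
  next
    case 3
    then obtain K' where "K' > 0" "\<forall>x. 1 \<le> norm x \<longrightarrow> V x \<le> K' * norm x powr (\<alpha> - (P * (UV.n - \<alpha>) - b))"
      using VU.U_intermediate[OF M(2) K(2) M(1) K(1) e] by blast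
    then show ?thesis using 3 by (intro that[of K']) auto
  qed
qed

end

section \<open>Wolff potentials\<close>

lemma ennpowr_ennreal: "0 \<le> z \<Longrightarrow> ennpowr (ennreal z) s = ennreal (z powr s)"
  by (simp add: ennpowr_def)

lemma ennpowr_mono:
  assumes "x \<le> y" "0 \<le> s"
  shows "ennpowr x s \<le> ennpowr y s"
proof (cases "y = \<infinity>")
  case False
  then have "enn2real x \<le> enn2real y" "x \<noteq> \<infinity>"
    using assms(1) by (auto intro!: enn2real_mono simp: less_top)
  then show ?thesis using False assms(2) by (auto simp: ennpowr_def intro!: ennreal_leI powr_mono2)
qed (simp add: ennpowr_def)

lemma AE_lebesgue_neq: "AE y in lebesgue. y \<noteq> (x::'a::euclidean_space)"
  by (rule AE_completion[OF AE_lborel_singleton])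

text \<open>
  A ball of radius \<open>t\<close> around \<open>x\<close> has mass at most \<open>t\<close> to the power \<open>n - \<alpha>\<close> times \<open>I\<close>, and the exponent \<open>s\<close> in the
  Wolff potential is at least \<open>1\<close>, so \<open>s - 1\<close> of the factors may be replaced by \<open>I\<close>; Tonelli evaluates the rest.
\<close>

lemma wolff_le_riesz:
  fixes f :: "real ^ 'n \<Rightarrow> real" and \<beta> \<gamma> I :: real
  assumes \<alpha>: "\<beta> * \<gamma> < CARD('n)" and \<gamma>: "1 < \<gamma>" "\<gamma> \<le> 2"
    and f: "f \<in> borel_measurable lebesgue" "\<And>y. 0 \<le> f y"
    and I: "riesz (\<beta> * \<gamma>) f x = ennreal I" "0 \<le> I"
  shows "wolff_potential \<beta> \<gamma> f x \<le> ennreal (I powr (1 / (\<gamma> - 1)) / (CARD('n) - \<beta> * \<gamma>))"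
proof -
  define n where "n = real CARD('n)"
  define \<alpha> where "\<alpha> = \<beta> * \<gamma>"
  define s where "s = 1 / (\<gamma> - 1)"
  have s: "1 \<le> s" using \<gamma> by (simp add: s_def)
  have n\<alpha>: "\<alpha> < n" using \<alpha> by (simp add: n_def \<alpha>_def)
  define \<mu> where "\<mu> = (\<lambda>t. \<integral>\<^sup>+y\<in>ball x t. ennreal (f y) \<partial>lebesgue)"
  have \<mu>_eq: "(\<integral>\<^sup>+y\<in>ball x t. ennreal (f y) \<partial>lebesgue) = \<mu> t" for t by (simp add: \<mu>_def)
  have \<mu>: "\<mu> t \<le> ennreal (t powr (n - \<alpha>) * I)" if t: "t > 0" for t
  proof -
    have "\<mu> t \<le> (\<integral>\<^sup>+y. ennreal (t powr (n - \<alpha>)) * ennreal (f y * norm (x - y) powr (\<alpha> - n)) \<partial>lebesgue)"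
      unfolding \<mu>_def
    proof (rule nn_integral_mono_AE)
      show "AE y in lebesgue. ennreal (f y) * indicator (ball x t) y \<le>
          ennreal (t powr (n - \<alpha>)) * ennreal (f y * norm (x - y) powr (\<alpha> - n))"
        using AE_lebesgue_neq[of x]
      proof eventually_elim
        fix y assume y: "y \<noteq> x"
        show "ennreal (f y) * indicator (ball x t) y \<le>
          ennreal (t powr (n - \<alpha>)) * ennreal (f y * norm (x - y) powr (\<alpha> - n))"
        proof (cases "y \<in> ball x t")
          case True
          then have d: "0 < norm (x - y)" "norm (x - y) \<le> t" using y by (auto simp: dist_norm)
          have "1 = t powr (n - \<alpha>) * t powr (\<alpha> - n)" using t by (simp add: powr_add[symmetric])
          also have "\<dots> \<le> t powr (n - \<alpha>) * norm (x - y) powr (\<alpha> - n)"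
            using d n\<alpha> by (intro mult_left_mono powr_mono2') auto
          finally have "f y * 1 \<le> f y * (t powr (n - \<alpha>) * norm (x - y) powr (\<alpha> - n))"
            by (intro mult_left_mono f(2))
          then have "ennreal (f y) \<le> ennreal (t powr (n - \<alpha>) * (f y * norm (x - y) powr (\<alpha> - n)))"
            by (intro ennreal_leI) (simp add: mult_ac)
          then show ?thesis using True f(2) by (simp add: ennreal_mult)
        qed simp
      qed
    qed
    also have "\<dots> = ennreal (t powr (n - \<alpha>)) * riesz \<alpha> f x"
      unfolding riesz_def using borel_measurable_times[OF f(1) kernel_measurable[of x "\<alpha> - n"]]
      by (simp add: nn_integral_cmult n_def)
    also have "\<dots> = ennreal (t powr (n - \<alpha>) * I)" using I by (simp add: \<alpha>_def ennreal_mult)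
    finally show ?thesis .
  qed
  \<comment> \<open>\<open>w\<close> combines 1/t with the normalisation t^(\<alpha> - n) of the
    mass; extension by 0 encodes the domain t > 0.\<close>
  define w where "w = (\<lambda>t::real. if t > 0 then t powr (\<alpha> - n - 1) else 0)"
  have w0: "0 \<le> w t" for t by (simp add: w_def)
  have wm: "w \<in> borel_measurable lebesgue"
    unfolding w_def by (intro borel_measurable_lebesgue_of_borel measurable_If) auto
  define J where "J = I powr (s - 1)"
  have J0: "J \<ge> 0" by (simp add: J_def)
  define F :: "real \<times> (real^'n) \<Rightarrow> ennreal" where
    "F = (\<lambda>z. ennreal (w (fst z)) * (ennreal (f (snd z)) * indicator {z. norm (x - snd z) < fst z} z))"
  have F: "F \<in> borel_measurable (lebesgue \<Otimes>\<^sub>M lebesgue)"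
  proof -
    have 1: "(\<lambda>z::real \<times> (real^'n). fst z) \<in> borel_measurable (lebesgue \<Otimes>\<^sub>M lebesgue)"
      by (rule measurable_compose[OF measurable_fst measurable_ident_lebesgue])
    have 2: "(\<lambda>z::real \<times> (real^'n). norm (x - snd z)) \<in> borel_measurable (lebesgue \<Otimes>\<^sub>M lebesgue)"
      by (rule measurable_compose[OF measurable_compose[OF measurable_snd measurable_ident_lebesgue], of "\<lambda>y. norm (x - y)"]) measurable
    have "{z \<in> space (lebesgue \<Otimes>\<^sub>M lebesgue). norm (x - snd z) < fst z} \<in> sets (lebesgue \<Otimes>\<^sub>M lebesgue :: (real \<times> (real^'n)) measure)"
      using borel_measurable_less[OF 2 1] .
    then have 3: "{z::real \<times> (real^'n). norm (x - snd z) < fst z} \<in> sets (lebesgue \<Otimes>\<^sub>M lebesgue)"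
      by (simp add: space_pair_measure)
    have 4: "(\<lambda>z::real \<times> (real^'n). w (fst z)) \<in> borel_measurable (lebesgue \<Otimes>\<^sub>M lebesgue)"
      by (rule measurable_compose[OF measurable_fst wm])
    have 5: "(\<lambda>z::real \<times> (real^'n). f (snd z)) \<in> borel_measurable (lebesgue \<Otimes>\<^sub>M lebesgue)"
      by (rule measurable_compose[OF measurable_snd f(1)])
    show ?thesis unfolding F_def
      by (intro borel_measurable_times_ennreal borel_measurable_indicator[OF 3]
          measurable_compose[OF 4 measurable_ennreal] measurable_compose[OF 5 measurable_ennreal])
  qed
  have fi: "(\<lambda>y. ennreal (f y) * indicator (ball x t) y) \<in> borel_measurable lebesgue" for t
    using f(1) by (intro borel_measurable_times_ennreal measurable_compose[OF f(1) measurable_ennreal] borel_measurable_indicator) auto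
  have "wolff_potential \<beta> \<gamma> f x \<le> (\<integral>\<^sup>+t. ennreal J * (\<integral>\<^sup>+y. F (t, y) \<partial>lebesgue) \<partial>lebesgue)"
    unfolding wolff_potential_def \<mu>_eq n_def[symmetric] \<alpha>_def[symmetric] s_def[symmetric]
  proof (rule nn_integral_mono)
    fix t :: real
    show "ennpowr (\<mu> t / ennreal (t powr (n - \<alpha>))) s * ennreal (1 / t) * indicator {0<..} t \<le>
        ennreal J * (\<integral>\<^sup>+y. F (t, y) \<partial>lebesgue)"
    proof (cases "t > 0")
      case t: True
      obtain m where m: "\<mu> t = ennreal m" "m \<ge> 0"
        using \<mu>[OF t] by (metis ennreal_cases ennreal_less_top not_less top.extremum_uniqueI)
      have tp: "t powr (n - \<alpha>) > 0" using t by simp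
      define z where "z = m / t powr (n - \<alpha>)"
      have z0: "0 \<le> z" using m by (simp add: z_def)
      have "m \<le> t powr (n - \<alpha>) * I" using \<mu>[OF t] I(2) unfolding m(1) by (subst (asm) ennreal_le_iff) auto
      then have zI: "z \<le> I" using tp by (simp add: z_def pos_divide_le_eq mult.commute)
      have "z powr s \<le> J * z"
      proof (cases "z = 0")
        case False
        then have "z powr s = z powr (s - 1) * z" using z0 by (simp add: powr_diff)
        also have "\<dots> \<le> J * z" unfolding J_def using z0 zI s by (intro mult_right_mono powr_mono2) auto
        finally show ?thesis .
      qed (use J0 in simp)
      then have le: "z powr s * (1 / t) \<le> J * (w t * m)"
      proof -
        have "w t * m = z * (1 / t)"
          using t by (simp add: w_def z_def powr_diff powr_minus powr_add field_simps)
        then have "J * (w t * m) = (J * z) * (1 / t)" by simp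
        then show ?thesis using \<open>z powr s \<le> J * z\<close> t by (simp add: divide_right_mono)
      qed
      have "\<mu> t / ennreal (t powr (n - \<alpha>)) = ennreal z"
        unfolding m(1) z_def using m tp by (simp add: divide_ennreal)
      then have "ennpowr (\<mu> t / ennreal (t powr (n - \<alpha>))) s * ennreal (1 / t) = ennreal (z powr s * (1 / t))"
        using z0 t by (simp only: ennpowr_ennreal) (simp add: ennreal_mult[symmetric])
      also have "\<dots> \<le> ennreal (J * (w t * m))" by (rule ennreal_leI[OF le])
      also have "\<dots> = ennreal J * (ennreal (w t) * \<mu> t)" using J0 w0 m by (simp add: ennreal_mult)
      also have "ennreal (w t) * \<mu> t = (\<integral>\<^sup>+y. F (t, y) \<partial>lebesgue)"
      proof -
        have "F (t, y) = ennreal (w t) * (ennreal (f y) * indicator (ball x t) y)" for y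
          by (auto simp: F_def indicator_def dist_norm)
        then show ?thesis unfolding \<mu>_def using fi by (simp add: nn_integral_cmult)
      qed
      finally show ?thesis using t by simp
    qed simp
  qed
  also have "\<dots> = ennreal J * (\<integral>\<^sup>+t. \<integral>\<^sup>+y. F (t, y) \<partial>lebesgue \<partial>lebesgue)"
  proof (rule nn_integral_cmult)
    interpret sigma_finite_measure "lebesgue :: (real^'n) measure" by (rule sigma_finite_lebesgue)
    show "(\<lambda>t. \<integral>\<^sup>+y. F (t, y) \<partial>lebesgue) \<in> borel_measurable lebesgue"
      using borel_measurable_nn_integral_fst[OF F] by simp
  qed
  also have "(\<integral>\<^sup>+t. \<integral>\<^sup>+y. F (t, y) \<partial>lebesgue \<partial>lebesgue) = (\<integral>\<^sup>+y. \<integral>\<^sup>+t. F (t, y) \<partial>lebesgue \<partial>lebesgue)"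
    by (rule nn_integral_Fubini_lebesgue[OF F])
  also have "\<dots> = (\<integral>\<^sup>+y. ennreal (1 / (n - \<alpha>)) * ennreal (f y * norm (x - y) powr (\<alpha> - n)) \<partial>lebesgue)"
  proof (rule nn_integral_cong_AE)
    show "AE y in lebesgue. (\<integral>\<^sup>+t. F (t, y) \<partial>lebesgue) = ennreal (1 / (n - \<alpha>)) * ennreal (f y * norm (x - y) powr (\<alpha> - n))"
      using AE_lebesgue_neq[of x]
    proof eventually_elim
      fix y assume "y \<noteq> x"
      define r where "r = norm (x - y)"
      have r: "r > 0" using \<open>y \<noteq> x\<close> by (simp add: r_def)
      have "(\<integral>\<^sup>+t. F (t, y) \<partial>lebesgue) =
          (\<integral>\<^sup>+t. ennreal (f y) * (ennreal (t powr (-(n - \<alpha> + 1))) * indicator {r<..} t) \<partial>lborel)"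
        unfolding nn_integral_completion using r
        by (intro nn_integral_cong) (auto simp: F_def w_def r_def indicator_def algebra_simps dest: le_less_trans[OF norm_ge_zero])
      also have "\<dots> = ennreal (f y) * (\<integral>\<^sup>+t. ennreal (t powr (-(n - \<alpha> + 1))) * indicator {r<..} t \<partial>lborel)"
        by (rule nn_integral_cmult) measurable
      also have "\<dots> = ennreal (f y) * ennreal (r powr (1 - (n - \<alpha> + 1)) / ((n - \<alpha> + 1) - 1))"
        using n\<alpha> r by (subst nn_integral_powr_above) auto
      also have "\<dots> = ennreal (f y * (r powr (\<alpha> - n) / (n - \<alpha>)))"
        using f(2) n\<alpha> by (subst ennreal_mult[symmetric]) auto
      also have "f y * (r powr (\<alpha> - n) / (n - \<alpha>)) = 1 / (n - \<alpha>) * (f y * r powr (\<alpha> - n))" by simp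
      also have "ennreal \<dots> = ennreal (1 / (n - \<alpha>)) * ennreal (f y * r powr (\<alpha> - n))"
        using f(2) n\<alpha> by (intro ennreal_mult) auto
      finally show "(\<integral>\<^sup>+t. F (t, y) \<partial>lebesgue) = ennreal (1 / (n - \<alpha>)) * ennreal (f y * norm (x - y) powr (\<alpha> - n))"
        unfolding r_def .
    qed
  qed
  also have "\<dots> = ennreal (1 / (n - \<alpha>)) * riesz \<alpha> f x"
    unfolding riesz_def using borel_measurable_times[OF f(1) kernel_measurable[of x "\<alpha> - n"]]
    by (simp add: nn_integral_cmult n_def)
  also have "\<dots> = ennreal (1 / (n - \<alpha>) * I)" using I n\<alpha> by (subst ennreal_mult) (auto simp: \<alpha>_def)
  also have "ennreal J * \<dots> = ennreal (J * (1 / (n - \<alpha>) * I))" using J0 I n\<alpha> by (subst ennreal_mult) auto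
  also have "J * (1 / (n - \<alpha>) * I) = I powr s / (n - \<alpha>)"
    using I(2) by (cases "I = 0") (auto simp: J_def powr_diff)
  finally show ?thesis by (simp add: s_def n_def \<alpha>_def)
qed

text \<open>Only radii above \<open>T\<close> are kept; there the integrand is at least a constant
  times t^(-k-1), whose integral is explicit. j = 0 serves a fixed mass seen from afar, j = e - n a
  source of size |y|^(-e).\<close>

lemma wolff_ge:
  fixes f :: "real ^ 'n \<Rightarrow> real" and \<beta> \<gamma> T m j k :: real
  assumes \<gamma>: "1 < \<gamma>" and T: "T > 0" and m: "m \<ge> 0"
    and lower: "\<And>t. T < t \<Longrightarrow> ennreal (m * t powr (-j)) \<le> (\<integral>\<^sup>+y\<in>ball x t. ennreal (f y) \<partial>lebesgue)"
    and k: "k = (CARD('n) - \<beta> * \<gamma> + j) / (\<gamma> - 1)" "k > 0"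
  shows "ennreal (m powr (1 / (\<gamma> - 1)) * T powr (-k) / k) \<le> wolff_potential \<beta> \<gamma> f x"
proof -
  define n where "n = real CARD('n)"
  define \<alpha> where "\<alpha> = \<beta> * \<gamma>"
  define s where "s = 1 / (\<gamma> - 1)"
  have s: "0 < s" using \<gamma> by (simp add: s_def)
  have ks: "(n - \<alpha> + j) * s = k" by (simp add: k s_def n_def \<alpha>_def)
  have "ennreal (m powr s * T powr (-k) / k) = ennreal (m powr s) * ennreal (T powr (1 - (k + 1)) / ((k + 1) - 1))"
    using k(2) by (subst ennreal_mult[symmetric]) auto
  also have "\<dots> = ennreal (m powr s) * (\<integral>\<^sup>+t. ennreal (t powr (-(k+1))) * indicator {T<..} t \<partial>lborel)"
    using k T by (subst nn_integral_powr_above) auto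
  also have "\<dots> = (\<integral>\<^sup>+t. ennreal (m powr s) * (ennreal (t powr (-(k+1))) * indicator {T<..} t) \<partial>lebesgue)"
    unfolding nn_integral_completion by (rule nn_integral_cmult[symmetric]) measurable
  also have "\<dots> \<le> wolff_potential \<beta> \<gamma> f x"
    unfolding wolff_potential_def n_def[symmetric] \<alpha>_def[symmetric] s_def[symmetric]
  proof (rule nn_integral_mono)
    fix t :: real
    define \<mu> where "\<mu> = (\<integral>\<^sup>+y\<in>ball x t. ennreal (f y) \<partial>lebesgue)"
    show "ennreal (m powr s) * (ennreal (t powr (-(k+1))) * indicator {T<..} t) \<le>
       ennpowr (\<mu> / ennreal (t powr (n - \<alpha>))) s * ennreal (1 / t) * indicator {0<..} t"
    proof (cases "T < t")
      case True
      then have t: "t > 0" using T by simp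
      define z where "z = m * t powr (-j) / t powr (n - \<alpha>)"
      have z0: "z \<ge> 0" using m by (simp add: z_def)
      have zeq: "z = m * t powr (-(n - \<alpha> + j))"
        using t by (simp add: z_def powr_diff powr_add powr_minus field_simps)
      have "m powr s * t powr (-(k+1)) = z powr s * (1 / t)"
      proof -
        have "z powr s = m powr s * t powr (-((n - \<alpha> + j) * s))"
          unfolding zeq by (simp only: powr_mult powr_powr mult_minus_left)
        moreover have "t powr (-(k+1)) = t powr (-k) * (1 / t)"
          using t by (simp add: powr_diff)
        ultimately show ?thesis unfolding ks by simp
      qed
      then have "ennreal (m powr s) * ennreal (t powr (-(k+1))) = ennpowr (ennreal z) s * ennreal (1 / t)"
        using z0 t by (simp add: ennpowr_ennreal ennreal_mult[symmetric])
      also have "\<dots> \<le> ennpowr (\<mu> / ennreal (t powr (n - \<alpha>))) s * ennreal (1 / t)"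
      proof (intro mult_right_mono ennpowr_mono)
        have "ennreal z = ennreal (m * t powr (-j)) / ennreal (t powr (n - \<alpha>))"
          unfolding z_def using m t by (intro divide_ennreal[symmetric]) auto
        also have "\<dots> \<le> \<mu> / ennreal (t powr (n - \<alpha>))"
          unfolding \<mu>_def by (intro divide_right_mono_ennreal lower True)
        finally show "ennreal z \<le> \<mu> / ennreal (t powr (n - \<alpha>))" .
      qed (use s in auto)
      finally show ?thesis using True t by simp
    qed simp
  qed
  finally show ?thesis by (simp add: s_def)
qed

section \<open>Shells, mass bounds and membership in L^p\<close>

lemma emeasure_shell:
  fixes r :: real
  assumes "r > 0"
  shows "ennreal (unit_ball_vol DIM('a::euclidean_space) * r powr DIM('a)) \<le> emeasure lebesgue {y::'a. r \<le> norm y \<and> norm y < 2 * r}"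
proof -
  define v where "v = unit_ball_vol DIM('a) * r powr DIM('a)"
  have v: "v \<ge> 0" by (simp add: v_def)
  \<comment> \<open>In dimension at least 1 the shell is therefore no smaller than the inner
    ball.\<close>
  have "(2::real) \<le> 2 powr DIM('a)"
    using powr_mono[of 1 "DIM('a)" 2] DIM_positive[where 'a='a] by simp
  then have "2 * v \<le> 2 powr DIM('a) * v" using v by (intro mult_right_mono)
  then have "ennreal v \<le> ennreal (2 powr DIM('a) * v - v)" by (intro ennreal_leI) simp
  also have "\<dots> = ennreal (2 powr DIM('a) * v) - ennreal v" using v by (intro ennreal_minus[symmetric])
  also have "\<dots> = emeasure lebesgue (ball (0::'a) (2*r)) - emeasure lebesgue (ball (0::'a) r)"
    using assms by (simp only: emeasure_lebesgue_ball less_imp_le mult_pos_pos zero_less_numeral v_def) (simp add: powr_mult mult_ac)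
  also have "\<dots> = emeasure lebesgue (ball (0::'a) (2*r) - ball 0 r)"
    using assms by (intro emeasure_Diff[symmetric]) (auto simp: emeasure_ball)
  also have "ball (0::'a) (2*r) - ball 0 r = {y. r \<le> norm y \<and> norm y < 2 * r}" by auto
  finally show ?thesis unfolding v_def .
qed

lemma shell_sets: "{y::'a::euclidean_space. r \<le> norm y \<and> norm y < R} \<in> sets lebesgue"
proof -
  have "{y::'a. r \<le> norm y \<and> norm y < R} = ball 0 R - ball 0 r" by auto
  then show ?thesis by simp
qed

lemma shell_integral_ge:
  fixes r e :: real
  assumes "r > 0" "e \<ge> 0"
  shows "ennreal (unit_ball_vol DIM('a::euclidean_space) * r powr DIM('a) * (2 * r) powr (-e)) \<le>
    (\<integral>\<^sup>+y\<in>{y::'a. r \<le> norm y \<and> norm y < 2 * r}. ennreal (norm y powr (-e)) \<partial>lebesgue)"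
proof -
  let ?S = "{y::'a. r \<le> norm y \<and> norm y < 2 * r}"
  have "ennreal (unit_ball_vol DIM('a) * r powr DIM('a) * (2 * r) powr (-e)) \<le>
      ennreal ((2 * r) powr (-e)) * emeasure lebesgue ?S"
    using mult_left_mono[OF emeasure_shell[OF assms(1), where 'a='a], of "ennreal ((2 * r) powr (-e))"]
    by (simp add: ennreal_mult[symmetric] mult.commute)
  also have "\<dots> = (\<integral>\<^sup>+y. ennreal ((2 * r) powr (-e)) * indicator ?S y \<partial>lebesgue)"
    by (rule nn_integral_cmult_indicator[symmetric, OF shell_sets])
  also have "\<dots> \<le> (\<integral>\<^sup>+y\<in>?S. ennreal (norm y powr (-e)) \<partial>lebesgue)"
    using assms by (intro nn_integral_mono) (auto simp: indicator_def intro!: ennreal_leI powr_mono2')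
  finally show ?thesis .
qed

text \<open>By scale invariance |y|^(-n) has the same lower bound on each of the \<open>J\<close>
  dyadic shells; the induction adds one shell at a time.\<close>

lemma log_integral_ge:
  "ennreal (real J * (unit_ball_vol DIM('a::euclidean_space) * 2 powr (-real DIM('a)))) \<le>
    (\<integral>\<^sup>+y\<in>{y::'a. 1 \<le> norm y \<and> norm y < 2 ^ J}. ennreal (norm y powr (-real DIM('a))) \<partial>lebesgue)"
proof (induction J)
  case (Suc J)
  define c where "c = unit_ball_vol DIM('a) * 2 powr (-real DIM('a))"
  have c: "c \<ge> 0" by (simp add: c_def)
  define S where "S = (\<lambda>a b. {y::'a. a \<le> norm y \<and> norm y < b})"
  define h where "h = (\<lambda>y::'a. ennreal (norm y powr (-real DIM('a))))"
  have hm: "(\<lambda>y. h y * indicator (S a b) y) \<in> borel_measurable lebesgue" for a b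
    unfolding h_def S_def using norm_powr_measurable[of "-real DIM('a)"]
    by (intro borel_measurable_times_ennreal borel_measurable_indicator shell_sets
        measurable_compose[OF norm_powr_measurable measurable_ennreal])
  have "ennreal (real (Suc J) * c) = ennreal (real J * c) + ennreal c"
    using c by (simp add: distrib_right ennreal_plus[symmetric] add.commute del: ennreal_plus)
  also have "\<dots> \<le> (\<integral>\<^sup>+y. h y * indicator (S 1 (2^J)) y \<partial>lebesgue) + (\<integral>\<^sup>+y. h y * indicator (S (2^J) (2 * 2^J)) y \<partial>lebesgue)"
  proof (rule add_mono)
    show "ennreal (real J * c) \<le> (\<integral>\<^sup>+y. h y * indicator (S 1 (2^J)) y \<partial>lebesgue)"
      using Suc.IH by (simp add: c_def S_def h_def)
    have "c = unit_ball_vol DIM('a) * (2^J) powr DIM('a) * (2 * 2^J) powr (-real DIM('a))"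
    proof -
      have "(2 * 2^J :: real) powr (-real DIM('a)) = 2 powr (-real DIM('a)) * (2^J) powr (-real DIM('a))"
        by (rule powr_mult)
      moreover have "((2::real)^J) powr DIM('a) * (2^J) powr (-real DIM('a)) = 1"
        by (simp add: powr_add[symmetric])
      ultimately show ?thesis by (simp add: c_def)
    qed
    then show "ennreal c \<le> (\<integral>\<^sup>+y. h y * indicator (S (2^J) (2 * 2^J)) y \<partial>lebesgue)"
      using shell_integral_ge[of "2^J" "real DIM('a)", where 'a='a] by (simp add: S_def h_def)
  qed
  also have "\<dots> = (\<integral>\<^sup>+y. h y * indicator (S 1 (2^J)) y + h y * indicator (S (2^J) (2 * 2^J)) y \<partial>lebesgue)"
    by (rule nn_integral_add[symmetric, OF hm hm])
  also have "\<dots> \<le> (\<integral>\<^sup>+y. h y * indicator (S 1 (2^Suc J)) y \<partial>lebesgue)"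
  proof (rule nn_integral_mono)
    fix y :: 'a
    have "(1::real) \<le> 2^J" by simp
    then have "1 \<le> norm y" if "2^J \<le> norm y" using that by linarith
    then show "h y * indicator (S 1 (2^J)) y + h y * indicator (S (2^J) (2 * 2^J)) y \<le> h y * indicator (S 1 (2^Suc J)) y"
      by (auto simp: S_def indicator_def)
  qed
  finally show ?case by (simp add: c_def S_def h_def)
qed simp

lemma in_Lp_of_decay:
  fixes f :: "real ^ 'n \<Rightarrow> real"
  assumes f: "f \<in> borel_measurable lebesgue" "\<And>x. 0 \<le> f x" "\<And>x. f x \<le> M"
    and R: "R > 0" "\<And>x. R \<le> norm x \<Longrightarrow> f x \<le> D * norm x powr (-k)"
    and k: "0 < k0" "k0 < k"
  shows "in_Lp (CARD('n) / k0) f"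
proof -
  define n where "n = real CARD('n)"
  define r where "r = n / k0"
  have n: "n > 0" by (simp add: n_def)
  have r: "r > 0" "k * r / n > 1" using n k by (simp_all add: r_def field_simps)
  define M' where "M' = max M 1"
  have M': "f x \<le> M'" "M' > 0" for x using f(3)[of x] by (auto simp: M'_def)
  have "k \<ge> 0" using k by simp
  then obtain D' where D': "D' > 0" "\<And>y. y \<noteq> 0 \<Longrightarrow> f y \<le> D' * norm y powr (-k)"
    using norm_powr_bound_everywhere[OF M'(1) R(2,1) _ M'(2)] by blast
  have meas: "(\<lambda>x. \<bar>f x\<bar> powr r) \<in> borel_measurable lebesgue" using f(1) by measurable
  have rd: "rearr_le (\<lambda>x. indicator (-{0}) x * \<bar>f x\<bar> powr r) (\<lambda>s. D' powr r * (unit_ball_vol n powr (k * r / n) * s powr (-(k * r / n))))"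
  proof (rule rearr_le_mono[OF rearr_le_cmult[OF rearr_le_norm_powr0[of "k * r", where 'a="real^'n"], of "D' powr r"]])
    show "(\<lambda>x. indicator (-{0}) x * \<bar>f x\<bar> powr r) \<in> borel_measurable lebesgue"
      using meas by (intro borel_measurable_times borel_measurable_indicator) auto
    fix x :: "real^'n"
    show "indicator (-{0}) x * \<bar>f x\<bar> powr r \<le> D' powr r * norm x powr (-(k * r))"
    proof (cases "x = 0")
      case False
      have "\<bar>f x\<bar> powr r \<le> (D' * norm x powr (-k)) powr r" using f(2)[of x] D'(2)[OF False] r by (intro powr_mono2) auto
      then show ?thesis using False by (simp add: powr_mult powr_powr)
    qed simp
  qed (use k r D' in \<open>auto simp: n_def\<close>)
  have rM: "rearr_le (\<lambda>x. indicator (-{0}) x * \<bar>f x\<bar> powr r) (\<lambda>s. M' powr r * s powr (-0))"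
  proof (rule rearr_le_mono_bound[OF rearr_le_const[OF rearr_le_measurable[OF rd]]])
    show "indicator (-{0}) x * \<bar>f x\<bar> powr r \<le> M' powr r" for x
      using f(2)[of x] M'(1)[of x] r by (auto simp: indicator_def intro!: powr_mono2)
  qed auto
  have "unit_ball_vol n > 0" using n by (intro unit_ball_vol_pos) simp
  then have "(\<integral>\<^sup>+x. ennreal (indicator (-{0}) x * \<bar>f x\<bar> powr r) \<partial>lebesgue) \<le>
      ennreal (M' powr r * (1 powr (1 - 0) / (1 - 0)) +
        D' powr r * unit_ball_vol n powr (k * r / n) * (1 powr (1 - k * r / n) / (k * r / n - 1)))"
    by (intro nn_integral_le_two_powers[OF rM rd[folded mult.assoc]]) (use r in auto)
  also have "\<dots> < \<infinity>" by (rule ennreal_less_top[folded infinity_ennreal_def])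
  finally have "(\<integral>\<^sup>+x. ennreal (indicator (-{0}) x * \<bar>f x\<bar> powr r) \<partial>lebesgue) < \<infinity>" .
  also have "(\<integral>\<^sup>+x. ennreal (indicator (-{0}) x * \<bar>f x\<bar> powr r) \<partial>lebesgue) = (\<integral>\<^sup>+x. ennreal (\<bar>f x\<bar> powr r) \<partial>lebesgue)"
  proof (rule nn_integral_cong_AE)
    show "AE x in lebesgue. ennreal (indicator (-{0}) x * \<bar>f x\<bar> powr r) = ennreal (\<bar>f x\<bar> powr r)"
      using AE_lebesgue_neq[of 0] by eventually_elim (simp add: indicator_def)
  qed
  finally have "integrable lebesgue (\<lambda>x. \<bar>f x\<bar> powr r)"
    using meas by (intro integrableI_nonneg) auto
  then show ?thesis using f(1) by (simp add: in_Lp_def r_def n_def)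
qed

text \<open>Raising to \<gamma> - 1 undoes the outer exponent of the Wolff bound and leaves a linear
  potential. If the potential is infinite the claim is trivial, as its coefficient is
  positive.\<close>

lemma root_le_riesz:
  fixes f :: "real ^ 'n \<Rightarrow> real" and \<beta> \<gamma> C\<^sub>0 :: real
  assumes \<alpha>: "\<beta> * \<gamma> < CARD('n)" and \<gamma>: "1 < \<gamma>" "\<gamma> \<le> 2"
    and f: "f \<in> borel_measurable lebesgue" "\<And>y. 0 \<le> f y"
    and eq: "ennreal w = ennreal c * wolff_potential \<beta> \<gamma> f x" and c: "0 < c" "c \<le> C\<^sub>0" and w: "0 \<le> w"
  shows "ennreal (w powr (\<gamma> - 1)) \<le> ennreal ((C\<^sub>0 / (CARD('n) - \<beta> * \<gamma>)) powr (\<gamma> - 1)) * riesz (\<beta> * \<gamma>) f x"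
proof (cases "riesz (\<beta> * \<gamma>) f x")
  case top
  have "(C\<^sub>0 / (CARD('n) - \<beta> * \<gamma>)) powr (\<gamma> - 1) > 0" using c \<alpha> by simp
  then show ?thesis unfolding top by (simp add: ennreal_mult_top)
next
  case (real I)
  define d where "d = CARD('n) - \<beta> * \<gamma>"
  have d: "d > 0" using \<alpha> by (simp add: d_def)
  have "ennreal w \<le> ennreal C\<^sub>0 * ennreal (I powr (1 / (\<gamma> - 1)) / d)"
    unfolding eq d_def using c by (intro mult_mono ennreal_leI wolff_le_riesz[OF \<alpha> \<gamma> f real(2,1)]) auto
  also have "\<dots> = ennreal (C\<^sub>0 * (I powr (1 / (\<gamma> - 1)) / d))" using c d by (intro ennreal_mult[symmetric]) auto
  finally have "w \<le> C\<^sub>0 / d * I powr (1 / (\<gamma> - 1))"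
    using c d by (subst (asm) ennreal_le_iff) (auto simp: mult_ac)
  then have "w powr (\<gamma> - 1) \<le> (C\<^sub>0 / d * I powr (1 / (\<gamma> - 1))) powr (\<gamma> - 1)"
    using w \<gamma> by (intro powr_mono2) auto
  also have "\<dots> = (C\<^sub>0 / d) powr (\<gamma> - 1) * I"
  proof -
    have "(I powr (1 / (\<gamma> - 1))) powr (\<gamma> - 1) = I"
      using \<gamma> real(1) by (cases "I = 0") (simp_all add: powr_powr)
    then show ?thesis by (simp only: powr_mult)
  qed
  finally have "ennreal (w powr (\<gamma> - 1)) \<le> ennreal ((C\<^sub>0 / d) powr (\<gamma> - 1) * I)" by (rule ennreal_leI)
  then show ?thesis unfolding real(2) d_def using real(1) by (simp add: ennreal_mult)
qed

lemma le_solution: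
  assumes eq: "ennreal w = ennreal c * W" and c: "0 < C\<^sub>0" "1 / C\<^sub>0 \<le> c" and W: "ennreal K \<le> W" and "0 \<le> w" "0 \<le> K"
  shows "K / C\<^sub>0 \<le> w"
proof -
  have "ennreal (1 / C\<^sub>0 * K) = ennreal (1 / C\<^sub>0) * ennreal K" using assms by (intro ennreal_mult) auto
  also have "\<dots> \<le> ennreal w" unfolding eq using c by (intro mult_mono ennreal_leI W) auto
  finally show ?thesis using assms by (subst (asm) ennreal_le_iff) auto
qed

text \<open>For |x| >= 1 every ball around \<open>x\<close> of radius above 2 |x| contains the unit
  ball, hence a fixed positive mass.\<close>

lemma wolff_ge_fast:
  fixes f :: "real ^ 'n \<Rightarrow> real" and \<beta> \<gamma> :: real
  assumes \<alpha>: "\<beta> * \<gamma> < CARD('n)" and \<gamma>: "1 < \<gamma>"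
    and f: "f \<in> borel_measurable lebesgue" "\<And>y. y \<noteq> 0 \<Longrightarrow> 0 < f y"
  obtains K where "K > 0" "\<And>x. 1 \<le> norm x \<Longrightarrow> ennreal (K * norm x powr (-((CARD('n) - \<beta> * \<gamma>) / (\<gamma> - 1)))) \<le> wolff_potential \<beta> \<gamma> f x"
proof -
  define k where "k = (CARD('n) - \<beta> * \<gamma>) / (\<gamma> - 1)"
  have k: "k > 0" using \<alpha> \<gamma> by (simp add: k_def)
  define I where "I = (\<integral>\<^sup>+y\<in>ball 0 1. ennreal (f y) \<partial>lebesgue)"
  have fm: "(\<lambda>y. ennreal (f y) * indicator (ball 0 1) y) \<in> borel_measurable lebesgue"
    by (intro borel_measurable_times_ennreal measurable_compose[OF f(1) measurable_ennreal] borel_measurable_indicator) auto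
  have "I \<noteq> 0"
  proof
    assume "I = 0"
    then have "AE y in lebesgue. ennreal (f y) * indicator (ball 0 1) y = 0"
      unfolding I_def using fm by (simp add: nn_integral_0_iff_AE)
    then have "AE y in lebesgue. y \<notin> ball (0::real^'n) 1"
      using AE_lebesgue_neq[of 0]
    proof eventually_elim
      fix y :: "real^'n" assume "ennreal (f y) * indicator (ball 0 1) y = 0" "y \<noteq> 0"
      then show "y \<notin> ball 0 1" using f(2)[of y] by (auto simp: indicator_def split: if_splits)
    qed
    then have "ball (0::real^'n) 1 \<in> null_sets lebesgue"
      by (subst AE_iff_null_sets) auto
    then have "emeasure lebesgue (ball (0::real^'n) 1) = 0" by auto
    moreover have "unit_ball_vol (real CARD('n)) \<noteq> 0"
      using unit_ball_vol_pos[of "real CARD('n)"] by (metis less_irrefl of_nat_0_le_iff)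
    ultimately show False using emeasure_lebesgue_ball[of 1 "0::real^'n"] by simp
  qed
  \<comment> \<open>The mass may be infinite, so a finite positive minorant is taken.\<close>
  have "\<exists>m>0. ennreal m \<le> I"
  proof (cases I)
    case (real i)
    then show ?thesis using \<open>I \<noteq> 0\<close> by (intro exI[of _ i]) auto
  next
    case top
    then show ?thesis by (intro exI[of _ 1]) auto
  qed
  then obtain m where m: "m > 0" "ennreal m \<le> I" by blast
  define K where "K = m powr (1 / (\<gamma> - 1)) * 2 powr (-k) / k"
  show ?thesis
  proof (rule that[of K])
    show "K > 0" using m k by (simp add: K_def)
    fix x :: "real^'n" assume x: "1 \<le> norm x"
    have "ennreal (m powr (1 / (\<gamma> - 1)) * (2 * norm x) powr (-k) / k) \<le> wolff_potential \<beta> \<gamma> f x"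
    proof (rule wolff_ge[OF \<gamma>, where j = 0])
      fix t assume t: "2 * norm x < t"
      have "ball (0::real^'n) 1 \<subseteq> ball x t"
      proof
        fix y :: "real^'n" assume "y \<in> ball 0 1"
        then show "y \<in> ball x t" using norm_triangle_ineq4[of x y] x t by (auto simp: dist_norm)
      qed
      then have "I \<le> (\<integral>\<^sup>+y\<in>ball x t. ennreal (f y) \<partial>lebesgue)"
        unfolding I_def by (intro nn_integral_mono) (auto simp: indicator_def)
      then show "ennreal (m * t powr (-0)) \<le> (\<integral>\<^sup>+y\<in>ball x t. ennreal (f y) \<partial>lebesgue)"
        using m t x by simp
    qed (use x m k in \<open>auto simp: k_def\<close>)
    also have "m powr (1 / (\<gamma> - 1)) * (2 * norm x) powr (-k) / k = K * norm x powr (-k)"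
      by (simp add: K_def powr_mult)
    finally show "ennreal (K * norm x powr (-((CARD('n) - \<beta> * \<gamma>) / (\<gamma> - 1)))) \<le> wolff_potential \<beta> \<gamma> f x"
      by (simp add: k_def)
  qed
qed

lemma ball_integral_ge:
  fixes f :: "'a::euclidean_space \<Rightarrow> real"
  assumes S: "S \<in> sets lebesgue" "S \<subseteq> ball x t" and f: "\<And>y. y \<in> S \<Longrightarrow> c * norm y powr e \<le> f y"
    and c: "0 \<le> c" "0 \<le> I" and I: "ennreal I \<le> (\<integral>\<^sup>+y\<in>S. ennreal (norm y powr e) \<partial>lebesgue)"
  shows "ennreal (c * I) \<le> (\<integral>\<^sup>+y\<in>ball x t. ennreal (f y) \<partial>lebesgue)"
proof -
  have "ennreal (c * I) \<le> ennreal c * (\<integral>\<^sup>+y\<in>S. ennreal (norm y powr e) \<partial>lebesgue)"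
    unfolding ennreal_mult[OF c] by (intro mult_left_mono I) simp
  also have "\<dots> = (\<integral>\<^sup>+y. ennreal c * (ennreal (norm y powr e) * indicator S y) \<partial>lebesgue)"
    by (intro nn_integral_cmult[symmetric] borel_measurable_times_ennreal borel_measurable_indicator S(1)
        measurable_compose[OF norm_powr_measurable measurable_ennreal])
  also have "\<dots> \<le> (\<integral>\<^sup>+y\<in>ball x t. ennreal (f y) \<partial>lebesgue)"
  proof (rule nn_integral_mono)
    fix y
    show "ennreal c * (ennreal (norm y powr e) * indicator S y) \<le> ennreal (f y) * indicator (ball x t) y"
    proof (cases "y \<in> S")
      case True
      then have "ennreal c * ennreal (norm y powr e) \<le> ennreal (f y)"
        using f c by (subst ennreal_mult[symmetric]) (auto intro!: ennreal_leI)
      then show ?thesis using True S(2) by auto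
    qed simp
  qed
  finally show ?thesis .
qed

text \<open>For t > 2 |x| the ball contains a shell of radius comparable to t, hence mass of order
  at least t^(n - e).\<close>

lemma wolff_ge_intermediate:
  fixes f :: "real ^ 'n \<Rightarrow> real" and \<beta> \<gamma> c e :: real
  assumes \<gamma>: "1 < \<gamma>" and f: "\<And>y. 1 \<le> norm y \<Longrightarrow> c * norm y powr (-e) \<le> f y" "c > 0"
    and e: "\<beta> * \<gamma> < e" "0 \<le> e"
  obtains K where "K > 0" "\<And>x. 2 \<le> norm x \<Longrightarrow> ennreal (K * norm x powr (-((e - \<beta> * \<gamma>) / (\<gamma> - 1)))) \<le> wolff_potential \<beta> \<gamma> f x"
proof -
  define n where "n = real CARD('n)"
  define \<omega> where "\<omega> = unit_ball_vol n"
  have \<omega>: "\<omega> > 0" unfolding \<omega>_def by (intro unit_ball_vol_pos) (simp add: n_def)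
  define k where "k = (e - \<beta> * \<gamma>) / (\<gamma> - 1)"
  have k: "k > 0" using e \<gamma> by (simp add: k_def)
  define m where "m = c * \<omega> * 4 powr (-n) * 2 powr e"
  have m: "m > 0" using f \<omega> by (simp add: m_def)
  define K where "K = m powr (1 / (\<gamma> - 1)) * 2 powr (-k) / k"
  show ?thesis
  proof (rule that[of K])
    show "K > 0" using m k by (simp add: K_def)
    fix x :: "real^'n" assume x: "2 \<le> norm x"
    have "ennreal (m powr (1 / (\<gamma> - 1)) * (2 * norm x) powr (-k) / k) \<le> wolff_potential \<beta> \<gamma> f x"
    proof (rule wolff_ge[OF \<gamma>, where j = "e - n"])
      fix t assume t: "2 * norm x < t"
      \<comment> \<open>The shell from t/4 to t/2 fits in the ball because |x| < t/2, and t > 4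
        places it in |y| >= 1, where the lower bound on \<open>f\<close> holds.\<close>
      define r where "r = t / 4"
      have r: "r \<ge> 1" "t = 4 * r" using t x by (auto simp: r_def)
      let ?S = "{y::real^'n. r \<le> norm y \<and> norm y < 2 * r}"
      have sub: "?S \<subseteq> ball x t"
      proof
        fix y :: "real^'n" assume "y \<in> ?S"
        then show "y \<in> ball x t" using norm_triangle_ineq4[of x y] r t by (auto simp: dist_norm)
      qed
      have eq: "m * t powr (-(e - n)) = c * (\<omega> * r powr n * (2 * r) powr (-e))"
        using r by (simp add: m_def powr_mult powr_diff powr_minus field_simps)
          (simp add: powr_mult[symmetric] mult.assoc[symmetric])
      show "ennreal (m * t powr (-(e - n))) \<le> (\<integral>\<^sup>+y\<in>ball x t. ennreal (f y) \<partial>lebesgue)"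
        unfolding eq
      proof (rule ball_integral_ge[OF shell_sets sub])
        show "ennreal (\<omega> * r powr n * (2 * r) powr (-e)) \<le> (\<integral>\<^sup>+y\<in>?S. ennreal (norm y powr (-e)) \<partial>lebesgue)"
          using shell_integral_ge[of r e, where 'a="real^'n"] r e by (simp add: \<omega>_def n_def)
      qed (use f r \<omega> in auto)
    qed (use x m k in \<open>auto simp: k_def n_def\<close>)
    also have "m powr (1 / (\<gamma> - 1)) * (2 * norm x) powr (-k) / k = K * norm x powr (-k)"
      by (simp add: K_def powr_mult)
    finally show "ennreal (K * norm x powr (-((e - \<beta> * \<gamma>) / (\<gamma> - 1)))) \<le> wolff_potential \<beta> \<gamma> f x"
      by (simp add: k_def)
  qed
qed

text \<open>The ball contains all dyadic shells from 1 up to about |x|, and their number is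
  comparable to ln |x|. This logarithm enters the mass \<open>m\<close> and comes out with the power
  1/(\<gamma> - 1).\<close>

lemma wolff_ge_log:
  fixes f :: "real ^ 'n \<Rightarrow> real" and \<beta> \<gamma> c :: real
  assumes \<alpha>: "\<beta> * \<gamma> < CARD('n)" and \<gamma>: "1 < \<gamma>"
    and f: "\<And>y. 1 \<le> norm y \<Longrightarrow> c * norm y powr (-real CARD('n)) \<le> f y" "c > 0"
  obtains K where "K > 0" "\<And>x. 4 \<le> norm x \<Longrightarrow>
    ennreal (K * (norm x powr (-((CARD('n) - \<beta> * \<gamma>) / (\<gamma> - 1))) * ln (norm x) powr (1 / (\<gamma> - 1)))) \<le> wolff_potential \<beta> \<gamma> f x"
proof -
  define n where "n = real CARD('n)"
  define c' where "c' = unit_ball_vol n * 2 powr (-n)"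
  have "unit_ball_vol n > 0" by (intro unit_ball_vol_pos) (simp add: n_def)
  then have c': "c' > 0" by (simp add: c'_def)
  define k where "k = (n - \<beta> * \<gamma>) / (\<gamma> - 1)"
  have k: "k > 0" using \<alpha> \<gamma> by (simp add: k_def n_def)
  define K where "K = (c * c' / 2) powr (1 / (\<gamma> - 1)) * 2 powr (-k) / k"
  show ?thesis
  proof (rule that[of K])
    show "K > 0" using f c' k by (simp add: K_def)
    fix x :: "real^'n" assume x: "4 \<le> norm x"
    define m where "m = c * c' / 2 * ln (norm x)"
    \<comment> \<open>The largest J with 2^J <= |x|. For |x| >= 4 rounding loses at most half, so J
      >= ln |x| / 2.\<close>
    define J where "J = nat \<lfloor>log 2 (norm x)\<rfloor>"
    have l2: "log 2 (norm x) \<ge> 2" using x by (subst le_log_iff) auto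
    then have J: "real J = of_int \<lfloor>log 2 (norm x)\<rfloor>" by (simp add: J_def)
    have "2 ^ J = 2 powr real J" by (simp add: powr_realpow)
    also have "\<dots> \<le> 2 powr (log 2 (norm x))" unfolding J by (intro powr_mono) auto
    also have "\<dots> = norm x" using x by (intro powr_log_cancel) auto
    finally have J1: "2 ^ J \<le> norm x" .
    have "log 2 (norm x) - 1 \<le> real J" unfolding J by linarith
    then have "log 2 (norm x) / 2 \<le> real J" using l2 by simp
    moreover have "ln (norm x) \<le> log 2 (norm x)"
    proof -
      have "ln (2::real) \<le> 1" using ln_2_less_1 by simp
      moreover have "ln (norm x) \<ge> 0" using x by simp
      ultimately have "ln (norm x) * ln 2 \<le> ln (norm x)" by (intro mult_left_le) auto
      then show ?thesis unfolding log_def by (simp add: pos_le_divide_eq)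
    qed
    ultimately have J2: "ln (norm x) / 2 \<le> real J" by simp
    have lx: "ln (norm x) > 0" using x by (intro ln_gt_zero) linarith
    have m: "m > 0" using f c' lx by (simp add: m_def)
    let ?S = "{y::real^'n. 1 \<le> norm y \<and> norm y < 2 ^ J}"
    have "ennreal (m powr (1 / (\<gamma> - 1)) * (2 * norm x) powr (-k) / k) \<le> wolff_potential \<beta> \<gamma> f x"
    proof (rule wolff_ge[OF \<gamma>, where j = 0])
      fix t assume t: "2 * norm x < t"
      have sub: "?S \<subseteq> ball x t"
      proof
        fix y :: "real^'n" assume "y \<in> ?S"
        then show "y \<in> ball x t" using norm_triangle_ineq4[of x y] J1 t by (auto simp: dist_norm)
      qed
      have "m * t powr (-0) = c * (ln (norm x) / 2 * c')" using t x by (simp add: m_def)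
      also have "\<dots> \<le> c * (real J * c')" using f c' J2 by (intro mult_left_mono mult_right_mono) auto
      finally have "ennreal (m * t powr (-0)) \<le> ennreal (c * (real J * c'))" by (rule ennreal_leI)
      also have "\<dots> \<le> (\<integral>\<^sup>+y\<in>ball x t. ennreal (f y) \<partial>lebesgue)"
      proof (rule ball_integral_ge[OF shell_sets sub])
        show "ennreal (real J * c') \<le> (\<integral>\<^sup>+y\<in>?S. ennreal (norm y powr (-n)) \<partial>lebesgue)"
          using log_integral_ge[of J, where 'a="real^'n"] by (simp add: c'_def n_def)
      qed (use f c' in \<open>auto simp: n_def\<close>)
      finally show "ennreal (m * t powr (-0)) \<le> (\<integral>\<^sup>+y\<in>ball x t. ennreal (f y) \<partial>lebesgue)" .
    qed (use x m k in \<open>auto simp: k_def n_def\<close>)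
    also have "m powr (1 / (\<gamma> - 1)) * (2 * norm x) powr (-k) / k = K * (norm x powr (-k) * ln (norm x) powr (1 / (\<gamma> - 1)))"
      unfolding K_def m_def powr_mult by simp
    finally show "ennreal (K * (norm x powr (-((CARD('n) - \<beta> * \<gamma>) / (\<gamma> - 1))) * ln (norm x) powr (1 / (\<gamma> - 1)))) \<le> wolff_potential \<beta> \<gamma> f x"
      by (simp add: k_def n_def)
  qed
qed

section \<open>The Wolff system\<close>

text \<open>\<open>A\<close> and \<open>B\<close> solve the linear system that balances the
  homogeneities of the two equations; its determinant p q - g^2 is positive because g <= 1 < p <= q.
  The last claim is the non-subcritical condition with denominators cleared.\<close>

lemma scaling_exponents:
  fixes g p q \<alpha> a b n :: real
  assumes g: "0 < g" "g \<le> 1" and pq: "1 < p" "p \<le> q" and \<alpha>: "0 < \<alpha>"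
    and ab: "-\<alpha> < a" "-\<alpha> < b"
  defines "A \<equiv> (\<alpha> * (g + q) + g * a + b * q) / (p * q - g\<^sup>2)"
    and "B \<equiv> (\<alpha> * (g + p) + g * b + a * p) / (p * q - g\<^sup>2)"
  shows "0 < A" "0 < B" "q * B = g * A + \<alpha> + a" "p * A = g * B + \<alpha> + b"
    and "(n + a) / (g + q) + (n + b) / (g + p) \<le> (n - \<alpha>) / g \<Longrightarrow> g * (A + B) \<le> n - \<alpha>"
proof -
  define D where "D = p * q - g\<^sup>2"
  have "g * g \<le> 1 * 1" using g by (intro mult_mono) auto
  moreover have "1 * 1 < p * q" using pq by (intro mult_strict_mono) auto
  ultimately have D: "D > 0" by (simp add: D_def power2_eq_square)
  have "A * D = \<alpha> * (g + q) + g * a + b * q" "B * D = \<alpha> * (g + p) + g * b + a * p"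
    unfolding A_def B_def D_def[symmetric] using D by simp_all
  then have AD: "A * D = g * (\<alpha> + a) + q * (\<alpha> + b)" and BD: "B * D = g * (\<alpha> + b) + p * (\<alpha> + a)"
    by (simp_all add: algebra_simps)
  have "g * (\<alpha> + a) + q * (\<alpha> + b) > 0" "g * (\<alpha> + b) + p * (\<alpha> + a) > 0"
  proof -
    have "\<alpha> + a > 0" "\<alpha> + b > 0" "q > 0" "p > 0" using ab pq by auto
    then show "g * (\<alpha> + a) + q * (\<alpha> + b) > 0" "g * (\<alpha> + b) + p * (\<alpha> + a) > 0"
      using g by (metis add_pos_pos mult_pos_pos)+
  qed
  then show "0 < A" "0 < B" using AD BD D by (metis zero_less_mult_pos2)+
  have "(q * B) * D = (g * A + \<alpha> + a) * D"
  proof -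
    have l: "(q * B) * D = q * (B * D)" and r: "(g * A + \<alpha> + a) * D = g * (A * D) + (\<alpha> + a) * D"
      by (simp_all add: algebra_simps)
    show ?thesis unfolding l r unfolding AD BD unfolding D_def by (simp add: algebra_simps power2_eq_square)
  qed
  then show "q * B = g * A + \<alpha> + a" using D by simp
  have "(p * A) * D = (g * B + \<alpha> + b) * D"
  proof -
    have l: "(p * A) * D = p * (A * D)" and r: "(g * B + \<alpha> + b) * D = g * (B * D) + (\<alpha> + b) * D"
      by (simp_all add: algebra_simps)
    show ?thesis unfolding l r unfolding AD BD unfolding D_def by (simp add: algebra_simps power2_eq_square)
  qed
  then show "p * A = g * B + \<alpha> + b" using D by simp
  assume cond: "(n + a) / (g + q) + (n + b) / (g + p) \<le> (n - \<alpha>) / g"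
  have gp: "g + p > 0" "g + q > 0" using g pq by auto
  have "((n + a) / (g + q) + (n + b) / (g + p)) * (g * (g + p) * (g + q)) \<le> (n - \<alpha>) / g * (g * (g + p) * (g + q))"
    using g gp by (intro mult_right_mono cond) auto
  also have "(n - \<alpha>) / g * (g * (g + p) * (g + q)) = (n - \<alpha>) * ((g + p) * (g + q))" using g by simp
  also have "((n + a) / (g + q) + (n + b) / (g + p)) * (g * (g + p) * (g + q)) = g * ((n + a) * (g + p) + (n + b) * (g + q))"
  proof -
    have "(n + a) / (g + q) * (g * (g + p) * (g + q)) = g * ((n + a) * (g + p))"
      "(n + b) / (g + p) * (g * (g + p) * (g + q)) = g * ((n + b) * (g + q))"
      using gp by simp_all
    then show ?thesis by (simp only: distrib_right distrib_left)
  qed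
  \<comment> \<open>Since (g + p) (g + q) - g (2 g + p + q) = p q - g^2, subtracting (n - \<alpha>)
    g (2 g + p + q) from both sides leaves the determinant on the right.\<close>
  finally have "g * (A * D + B * D) \<le> (n - \<alpha>) * D"
    unfolding AD BD unfolding D_def by (simp add: algebra_simps power2_eq_square)
  then have "(g * (A + B)) * D \<le> (n - \<alpha>) * D" by (simp add: algebra_simps)
  then show "g * (A + B) \<le> n - \<alpha>" using D by (simp add: mult_le_cancel_right)
qed

lemma same_rateI:
  fixes f g :: "'a::real_normed_vector \<Rightarrow> real"
  assumes "k > 0" "K > 0" "\<And>x. R \<le> norm x \<Longrightarrow> k * g x \<le> f x" "\<And>x. R \<le> norm x \<Longrightarrow> f x \<le> K * g x"
  shows "f \<simeq> g"
  unfolding same_rate_def eventually_at_infinity using assms by blast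

lemma same_rateD:
  fixes f g :: "'a::real_normed_vector \<Rightarrow> real"
  assumes "f \<simeq> g"
  obtains K R where "K > 0" "R > 0" "\<And>x. R \<le> norm x \<Longrightarrow> f x \<le> K * g x"
proof -
  obtain k K b where "K > 0" "\<And>x. b \<le> norm x \<Longrightarrow> k * g x \<le> f x \<and> f x \<le> K * g x"
    using assms unfolding same_rate_def eventually_at_infinity by blast
  then show ?thesis using that[of K "max b 1"] by auto
qed

section \<open>Passing between the Wolff system and the Riesz system\<close>

locale wolff_system =
  fixes \<beta> \<gamma> p q \<sigma>\<^sub>1 \<sigma>\<^sub>2 :: real and c\<^sub>1 c\<^sub>2 u v :: "real ^ 'n \<Rightarrow> real"
  assumes \<gamma>: "1 < \<gamma>" "\<gamma> \<le> 2" and \<beta>: "\<beta> > 0" "\<beta> * \<gamma> < real CARD('n)"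
    and pq: "q \<ge> p" "p > 1" and \<sigma>: "- \<beta> * \<gamma> < \<sigma>\<^sub>1" "\<sigma>\<^sub>1 \<le> \<sigma>\<^sub>2" "\<sigma>\<^sub>2 \<le> 0"
    and c: "\<And>x. c\<^sub>1 x > 0" "\<And>x. c\<^sub>2 x > 0" "double_bounded c\<^sub>1" "double_bounded c\<^sub>2"
    and noncritical: "(real CARD('n) + \<sigma>\<^sub>1) / (\<gamma> - 1 + q) + (real CARD('n) + \<sigma>\<^sub>2) / (\<gamma> - 1 + p)
           \<le> (real CARD('n) - \<beta> * \<gamma>) / (\<gamma> - 1)"
    and solution: "positive_solution \<beta> \<gamma> p q \<sigma>\<^sub>1 \<sigma>\<^sub>2 c\<^sub>1 c\<^sub>2 u v"
begin

definition n :: real where "n = real CARD('n)"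
definition \<alpha> where "\<alpha> = \<beta> * \<gamma>"
definition g where "g = \<gamma> - 1"
text \<open>Despite the letters, \<open>q0\<close> is the scale-invariant decay rate of
  \<open>u\<close> and \<open>p0\<close> that of \<open>v\<close>.\<close>

definition q0 where "q0 = q0_exponent \<beta> \<gamma> p q \<sigma>\<^sub>1 \<sigma>\<^sub>2"
definition p0 where "p0 = p0_exponent \<beta> \<gamma> p q \<sigma>\<^sub>1 \<sigma>\<^sub>2"

lemma n: "0 < n" by (simp add: n_def)
lemma g: "0 < g" "g \<le> 1" using \<gamma> by (auto simp: g_def)
lemma \<alpha>: "0 < \<alpha>" "\<alpha> < n" using \<beta> \<gamma> by (auto simp: \<alpha>_def n_def)
lemma \<sigma>': "-\<alpha> < \<sigma>\<^sub>1" "-\<alpha> < \<sigma>\<^sub>2" "\<sigma>\<^sub>1 \<le> 0" using \<sigma> by (auto simp: \<alpha>_def)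

lemma exponents: "0 < q0" "0 < p0" "q * p0 = g * q0 + \<alpha> + \<sigma>\<^sub>1" "p * q0 = g * p0 + \<alpha> + \<sigma>\<^sub>2" "g * (q0 + p0) \<le> n - \<alpha>"
proof -
  have defs: "q0 = (\<alpha> * (g + q) + g * \<sigma>\<^sub>1 + \<sigma>\<^sub>2 * q) / (p * q - g\<^sup>2)"
     "p0 = (\<alpha> * (g + p) + g * \<sigma>\<^sub>2 + \<sigma>\<^sub>1 * p) / (p * q - g\<^sup>2)"
    by (simp_all add: q0_def p0_def q0_exponent_def p0_exponent_def \<alpha>_def g_def)
  note * = scaling_exponents[OF g pq(2,1) \<alpha>(1) \<sigma>'(1,2), folded defs]
  show "0 < q0" "0 < p0" "q * p0 = g * q0 + \<alpha> + \<sigma>\<^sub>1" "p * q0 = g * p0 + \<alpha> + \<sigma>\<^sub>2" by (rule *)+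
  show "g * (q0 + p0) \<le> n - \<alpha>"
    by (rule *(5)) (use noncritical in \<open>simp add: n_def \<alpha>_def g_def\<close>)
qed

lemma uv_measurable: "u \<in> borel_measurable lebesgue" "v \<in> borel_measurable lebesgue"
  and uv_pos: "0 < u x" "0 < v x"
  and u_eq: "ennreal (u x) = ennreal (c\<^sub>1 x) * wolff_potential \<beta> \<gamma> (\<lambda>y. norm y powr \<sigma>\<^sub>1 * v y powr q) x"
  and v_eq: "ennreal (v x) = ennreal (c\<^sub>2 x) * wolff_potential \<beta> \<gamma> (\<lambda>y. norm y powr \<sigma>\<^sub>2 * u y powr p) x"
  using solution unfolding positive_solution_def by blast+

lemma c_bounds:
  obtains C\<^sub>0 where "C\<^sub>0 > 0" "\<And>x. 1 / C\<^sub>0 \<le> c\<^sub>1 x" "\<And>x. c\<^sub>1 x \<le> C\<^sub>0" "\<And>x. 1 / C\<^sub>0 \<le> c\<^sub>2 x" "\<And>x. c\<^sub>2 x \<le> C\<^sub>0"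
proof -
  obtain C1 where C1: "C1 > 0" "\<And>x. 1 / C1 \<le> c\<^sub>1 x \<and> c\<^sub>1 x \<le> C1" using c(3) unfolding double_bounded_def by blast
  obtain C2 where C2: "C2 > 0" "\<And>x. 1 / C2 \<le> c\<^sub>2 x \<and> c\<^sub>2 x \<le> C2" using c(4) unfolding double_bounded_def by blast
  have "1 / max C1 C2 \<le> 1 / C1" "1 / max C1 C2 \<le> 1 / C2" using C1 C2 by (auto intro!: divide_left_mono simp: less_max_iff_disj)
  then show ?thesis using C1 C2
    by (intro that[of "max C1 C2"]) (auto simp: less_max_iff_disj le_max_iff_disj intro: order_trans)
qed

lemma source_measurable:
  "w \<in> borel_measurable lebesgue \<Longrightarrow> (\<lambda>y::real^'n. norm y powr a * w y powr e) \<in> borel_measurable lebesgue"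
  using norm_powr_measurable[of a] by measurable

definition U where "U = (\<lambda>x. u x powr g)"
definition V where "V = (\<lambda>x. v x powr g)"

lemma UV_powr: "U x powr (e / g) = u x powr e" "V x powr (e / g) = v x powr e"
  using g by (simp_all add: U_def V_def powr_powr)

lemma u_eq_U: "u x = U x powr (1 / g)" and v_eq_V: "v x = V x powr (1 / g)"
  using UV_powr[of _ 1] uv_pos[of x] by simp_all

lemma riesz_bounds:
  obtains C where "C > 0"
    "\<And>x. ennreal (U x) \<le> ennreal C * riesz \<alpha> (\<lambda>y. norm y powr \<sigma>\<^sub>1 * V y powr (q / g)) x"
    "\<And>x. ennreal (V x) \<le> ennreal C * riesz \<alpha> (\<lambda>y. norm y powr \<sigma>\<^sub>2 * U y powr (p / g)) x"
proof -
  obtain C0 where C0: "C0 > 0" "\<And>x. 1 / C0 \<le> c\<^sub>1 x" "\<And>x. c\<^sub>1 x \<le> C0" "\<And>x. 1 / C0 \<le> c\<^sub>2 x" "\<And>x. c\<^sub>2 x \<le> C0"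
    using c_bounds by blast
  define C where "C = (C0 / (n - \<alpha>)) powr g"
  show ?thesis
  proof (rule that[of C])
    show "C > 0" using C0 \<alpha> by (simp add: C_def)
    fix x
    show "ennreal (U x) \<le> ennreal C * riesz \<alpha> (\<lambda>y. norm y powr \<sigma>\<^sub>1 * V y powr (q / g)) x"
      unfolding UV_powr unfolding U_def C_def n_def \<alpha>_def g_def
      by (rule root_le_riesz[OF \<beta>(2) \<gamma> _ _ u_eq c(1) C0(3)])
        (use source_measurable uv_measurable uv_pos in \<open>auto intro: less_imp_le\<close>)
    show "ennreal (V x) \<le> ennreal C * riesz \<alpha> (\<lambda>y. norm y powr \<sigma>\<^sub>2 * U y powr (p / g)) x"
      unfolding UV_powr unfolding V_def C_def n_def \<alpha>_def g_def
      by (rule root_le_riesz[OF \<beta>(2) \<gamma> _ _ v_eq c(2) C0(5)])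
        (use source_measurable uv_measurable uv_pos in \<open>auto intro: less_imp_le\<close>)
  qed
qed

text \<open>Passing to \<open>U\<close> and \<open>V\<close> multiplies rates by \<open>g\<close>
  and divides the powers q and p by \<open>g\<close>; the integrals in question are unchanged, as
  U^(n/(g q0)) = u^(n/q0) and likewise for \<open>V\<close>.\<close>

lemma riesz_system_of_integrable:
  assumes u: "in_Lp (n / q0) u" and v: "in_Lp (n / p0) v"
  obtains C where "riesz_system \<alpha> \<sigma>\<^sub>1 \<sigma>\<^sub>2 (q / g) (p / g) (g * q0) (g * p0) C U V"
proof -
  obtain C where C: "C > 0"
    "\<And>x. ennreal (U x) \<le> ennreal C * riesz \<alpha> (\<lambda>y. norm y powr \<sigma>\<^sub>1 * V y powr (q / g)) x"
    "\<And>x. ennreal (V x) \<le> ennreal C * riesz \<alpha> (\<lambda>y. norm y powr \<sigma>\<^sub>2 * U y powr (p / g)) x"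
    using riesz_bounds by blast
  have int: "(\<integral>\<^sup>+x. ennreal (h x powr r) \<partial>lebesgue) < \<infinity>" if "in_Lp r h" "\<And>x. 0 < h x" for r and h :: "real^'n \<Rightarrow> real"
  proof -
    have "integrable lebesgue (\<lambda>x. h x powr r)" using that by (simp add: in_Lp_def less_imp_le)
    then show ?thesis by (simp add: integrable_iff_bounded)
  qed
  have Q: "1 < q / g" "1 < p / g" using g pq by (simp_all add: less_divide_eq)
  have AB: "0 < g * q0" "0 < g * p0" using g exponents by simp_all
  have AB2: "g * q0 + g * p0 \<le> n - \<alpha>" using exponents(5) by (simp add: distrib_left)
  have QB: "q / g * (g * p0) = g * q0 + \<alpha> + \<sigma>\<^sub>1" "p / g * (g * q0) = g * p0 + \<alpha> + \<sigma>\<^sub>2"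
    using exponents g by simp_all
  have UVm: "U \<in> borel_measurable lebesgue" "V \<in> borel_measurable lebesgue"
    unfolding U_def V_def using uv_measurable by measurable
  have dim: "real DIM(real^'n) = n" by (simp add: n_def)
  have e: "n / (g * q0) = n / q0 / g" "n / (g * p0) = n / p0 / g" by simp_all
  \<comment> \<open>this is where \<open>p \<le> q\<close> enters\<close>
  have gap: "n - \<alpha> - g * q0 < q / g * (n - \<alpha> - max (g * q0) (g * p0))"
  proof (cases "g * p0 \<le> g * q0")
    case True
    then have "1 * (n - \<alpha> - g * q0) < q / g * (n - \<alpha> - g * q0)"
      using Q AB AB2 by (intro mult_strict_right_mono) auto
    then show ?thesis using True by (simp add: max_absorb1)
  next
    case False
    have "p / g * (g * q0) \<le> q / g * (g * q0)" using pq g AB by (intro mult_right_mono divide_right_mono) auto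
    then have 1: "g * p0 < q / g * (g * q0)" using QB \<sigma>' by linarith
    \<comment> \<open>With A = g q0, B = g p0 and Q = q/g: n - \<alpha> - B >= A makes Q (n -
      \<alpha> - B) at least n - \<alpha> - A plus Q A - B, which is positive by the previous
      line.\<close>
    have "(q / g - 1) * (g * q0) \<le> (q / g - 1) * (n - \<alpha> - g * p0)"
      using Q AB2 by (intro mult_left_mono) auto
    then have "n - \<alpha> - g * p0 + q / g * (g * q0) - g * q0 \<le> q / g * (n - \<alpha> - g * p0)"
      by (simp add: left_diff_distrib)
    then show ?thesis using 1 False by (simp add: max_absorb2)
  qed
  have F: "-\<alpha> < \<sigma>\<^sub>1" "\<sigma>\<^sub>1 \<le> 0" "-\<alpha> < \<sigma>\<^sub>2" "\<sigma>\<^sub>2 \<le> 0" "g * q0 < n - \<alpha>" "g * p0 < n - \<alpha>"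
      "\<And>x. 0 \<le> U x" "\<And>x. 0 \<le> V x"
    using \<sigma> \<sigma>' AB AB2 by (auto simp: U_def V_def)
  have I: "(\<integral>\<^sup>+x. ennreal (V x powr (n / (g * p0))) \<partial>lebesgue) < \<infinity>"
    "(\<integral>\<^sup>+x. ennreal (U x powr (n / (g * q0))) \<partial>lebesgue) < \<infinity>"
    unfolding e UV_powr by (rule int[OF v uv_pos(2)] int[OF u uv_pos(1)])+
  have "riesz_half \<alpha> \<sigma>\<^sub>1 (q / g) (g * q0) (g * p0) C U V"
    by (rule riesz_half.intro, unfold dim) (rule \<alpha> F Q AB QB UVm C I)+
  moreover have "riesz_half \<alpha> \<sigma>\<^sub>2 (p / g) (g * p0) (g * q0) C V U"
    by (rule riesz_half.intro, unfold dim) (rule \<alpha> F Q AB QB UVm C I)+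
  moreover have "riesz_system_axioms TYPE(real^'n) \<alpha> (q / g) (g * q0) (g * p0)"
    by (rule riesz_system_axioms.intro, unfold dim) (rule gap)
  ultimately have "riesz_system \<alpha> \<sigma>\<^sub>1 \<sigma>\<^sub>2 (q / g) (p / g) (g * q0) (g * p0) C U V"
    by (rule riesz_system.intro)
  then show ?thesis by (rule that)
qed

text \<open>A rate strictly above the scale-invariant one gives the integrability. The kernel rate
  beats both \<open>q0\<close> and \<open>p0\<close> because g (q0 + p0) <= n - \<alpha> with
  positive summands; the other two rates of \<open>v\<close> are compared with \<open>p0\<close>
  separately.\<close>

lemma decay_imp_integrable:
  assumes b: "bounded (range u)" "bounded (range v)"
    and u: "u \<simeq> (\<lambda>x. norm x powr (- ((n - \<alpha>) / g)))"
    and v1: "n < p * ((n - \<alpha>) / g) - \<sigma>\<^sub>2 \<Longrightarrow> v \<simeq> (\<lambda>x. norm x powr (- ((n - \<alpha>) / g)))"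
    and v2: "p * ((n - \<alpha>) / g) - \<sigma>\<^sub>2 = n \<Longrightarrow> v \<simeq> (\<lambda>x. norm x powr (- ((n - \<alpha>) / g)) * ln (norm x) powr (1 / g))"
    and v3: "p * ((n - \<alpha>) / g) - \<sigma>\<^sub>2 < n \<Longrightarrow> v \<simeq> (\<lambda>x. norm x powr (- ((p * ((n - \<alpha>) / g) - (\<alpha> + \<sigma>\<^sub>2)) / g)))"
  shows "in_Lp (n / q0) u" "in_Lp (n / p0) v"
proof -
  define N where "N = (n - \<alpha>) / g"
  have "g * q0 + g * p0 \<le> n - \<alpha>" using exponents(5) by (simp add: distrib_left)
  moreover have "0 < g * q0" "0 < g * p0" using g exponents by simp_all
  ultimately have "g * q0 < n - \<alpha>" "g * p0 < n - \<alpha>" by simp_all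
  then have N: "q0 < N" "p0 < N" using g by (simp_all add: N_def pos_less_divide_eq mult.commute)
  obtain M1 where M1: "\<And>x. u x \<le> M1" using b(1) unfolding bounded_iff by (metis abs_le_D1 rangeI real_norm_def)
  obtain M2 where M2: "\<And>x. v x \<le> M2" using b(2) unfolding bounded_iff by (metis abs_le_D1 rangeI real_norm_def)
  obtain K R where K: "R > 0" "\<And>x. R \<le> norm x \<Longrightarrow> u x \<le> K * norm x powr (-N)"
    by (rule same_rateD[OF u[folded N_def]]) (rule that; blast)
  show "in_Lp (n / q0) u"
    unfolding n_def by (rule in_Lp_of_decay[OF uv_measurable(1) _ M1 K exponents(1) N(1)]) (use uv_pos less_imp_le in blast)
  have "\<exists>k K R. p0 < k \<and> R > 0 \<and> (\<forall>x. R \<le> norm x \<longrightarrow> v x \<le> K * norm x powr (-k))"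
  proof -
    consider (1) "n < p * N - \<sigma>\<^sub>2" | (2) "p * N - \<sigma>\<^sub>2 = n" | (3) "p * N - \<sigma>\<^sub>2 < n" by linarith
    then show ?thesis
    proof cases
      case 1
      obtain K R where "R > 0" "\<And>x. R \<le> norm x \<Longrightarrow> v x \<le> K * norm x powr (-N)"
        by (rule same_rateD[OF v1[folded N_def, OF 1]]) (rule that; blast)
      then show ?thesis using N by blast
    next
      case 2
      obtain K R where K: "K > 0" "R > 0" "\<And>x. R \<le> norm x \<Longrightarrow> v x \<le> K * (norm x powr (-N) * ln (norm x) powr (1 / g))"
        using same_rateD[OF v2[folded N_def, OF 2]] by blast
      \<comment> \<open>The logarithm is traded for the power \<epsilon>/g, half of the margin
        between \<open>N\<close> and \<open>p0\<close>.\<close>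
      define \<epsilon> where "\<epsilon> = g * (N - p0) / 2"
      have \<epsilon>: "\<epsilon> > 0" using g N by (simp add: \<epsilon>_def)
      have "v x \<le> (K / \<epsilon> powr (1 / g)) * norm x powr (-(N - \<epsilon> / g))" if x: "max R 1 \<le> norm x" for x
      proof -
        have "ln (norm x) powr (1 / g) \<le> (norm x powr \<epsilon> / \<epsilon>) powr (1 / g)"
          using x \<epsilon> g ln_powr_bound[of "norm x" \<epsilon>] by (intro powr_mono2) auto
        also have "\<dots> = norm x powr (\<epsilon> / g) / \<epsilon> powr (1 / g)" using \<epsilon> by (simp add: powr_divide powr_powr)
        finally have "K * (norm x powr (-N) * ln (norm x) powr (1 / g)) \<le> K * (norm x powr (-N) * (norm x powr (\<epsilon> / g) / \<epsilon> powr (1 / g)))"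
          using K by (intro mult_left_mono) auto
        also have "\<dots> = (K / \<epsilon> powr (1 / g)) * (norm x powr (-N) * norm x powr (\<epsilon> / g))" by simp
        also have "norm x powr (-N) * norm x powr (\<epsilon> / g) = norm x powr (-(N - \<epsilon> / g))" by (simp add: powr_add[symmetric])
        finally show ?thesis using K(3)[of x] x by simp
      qed
      moreover have "p0 < N - \<epsilon> / g"
      proof -
        have eq: "\<epsilon> / g = (N - p0) / 2" using g by (simp add: \<epsilon>_def)
        show ?thesis unfolding eq using N by (simp add: field_simps)
      qed
      moreover have "max R 1 > 0" by simp
      ultimately show ?thesis by blast
    next
      case 3
      obtain K R where K: "R > 0" "\<And>x. R \<le> norm x \<Longrightarrow> v x \<le> K * norm x powr (-((p * N - (\<alpha> + \<sigma>\<^sub>2)) / g))"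
        by (rule same_rateD[OF v3[folded N_def, OF 3]]) (rule that; blast)
      \<comment> \<open>The identity p q0 = g p0 + \<alpha> + \<open>\<sigma>\<^sub>2\<close>
        converts this margin for \<open>u\<close> into one for \<open>v\<close>.\<close>
      have "p * q0 < p * N" using N pq by simp
      then have "p0 < (p * N - (\<alpha> + \<sigma>\<^sub>2)) / g" using exponents(4) g by (simp add: pos_less_divide_eq mult.commute)
      then show ?thesis using K by blast
    qed
  qed
  then obtain k K' R' where k: "p0 < k" "R' > 0" "\<And>x. R' \<le> norm x \<Longrightarrow> v x \<le> K' * norm x powr (-k)" by blast
  show "in_Lp (n / p0) v"
    unfolding n_def by (rule in_Lp_of_decay[OF uv_measurable(2) _ M2 k(2,3) exponents(2) k(1)]) (use uv_pos less_imp_le in blast)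
qed

section \<open>Lower bounds valid for every positive solution\<close>

lemma uv_lower:
  obtains k where "k > 0" "\<And>x. 1 \<le> norm x \<Longrightarrow> k * norm x powr (- ((n - \<alpha>) / g)) \<le> u x"
    "\<And>x. 1 \<le> norm x \<Longrightarrow> k * norm x powr (- ((n - \<alpha>) / g)) \<le> v x"
proof -
  obtain C0 where C0: "C0 > 0" "\<And>x. 1 / C0 \<le> c\<^sub>1 x" "\<And>x. c\<^sub>1 x \<le> C0" "\<And>x. 1 / C0 \<le> c\<^sub>2 x" "\<And>x. c\<^sub>2 x \<le> C0"
    using c_bounds by blast
  have pos1: "0 < norm y powr \<sigma>\<^sub>1 * v y powr q" and pos2: "0 < norm y powr \<sigma>\<^sub>2 * u y powr p"
    if "y \<noteq> 0" for y :: "real^'n"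
    using that uv_pos[of y] by simp_all
  obtain K1 where K1: "K1 > 0" "\<And>x. 1 \<le> norm x \<Longrightarrow> ennreal (K1 * norm x powr (-((n - \<alpha>) / g))) \<le>
      wolff_potential \<beta> \<gamma> (\<lambda>y. norm y powr \<sigma>\<^sub>1 * v y powr q) x"
    using wolff_ge_fast[OF \<beta>(2) \<gamma>(1) source_measurable[OF uv_measurable(2), of \<sigma>\<^sub>1 q] pos1]
    unfolding n_def \<alpha>_def g_def by blast
  obtain K2 where K2: "K2 > 0" "\<And>x. 1 \<le> norm x \<Longrightarrow> ennreal (K2 * norm x powr (-((n - \<alpha>) / g))) \<le>
      wolff_potential \<beta> \<gamma> (\<lambda>y. norm y powr \<sigma>\<^sub>2 * u y powr p) x"
    using wolff_ge_fast[OF \<beta>(2) \<gamma>(1) source_measurable[OF uv_measurable(1), of \<sigma>\<^sub>2 p] pos2]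
    unfolding n_def \<alpha>_def g_def by blast
  show ?thesis
  proof (rule that[of "min K1 K2 / C0"])
    show "min K1 K2 / C0 > 0" using K1 K2 C0 by simp
    fix x :: "real^'n" assume x: "1 \<le> norm x"
    have "K1 * norm x powr (-((n - \<alpha>) / g)) / C0 \<le> u x"
      by (rule le_solution[OF u_eq C0(1,2) K1(2)[OF x]]) (use uv_pos K1 in \<open>auto intro: less_imp_le\<close>)
    moreover have "min K1 K2 / C0 * norm x powr (-((n - \<alpha>) / g)) \<le> K1 / C0 * norm x powr (-((n - \<alpha>) / g))"
      using C0 by (intro mult_right_mono divide_right_mono) auto
    ultimately show "min K1 K2 / C0 * norm x powr (-((n - \<alpha>) / g)) \<le> u x" by simp
    have "K2 * norm x powr (-((n - \<alpha>) / g)) / C0 \<le> v x"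
      by (rule le_solution[OF v_eq C0(1,4) K2(2)[OF x]]) (use uv_pos K2 in \<open>auto intro: less_imp_le\<close>)
    moreover have "min K1 K2 / C0 * norm x powr (-((n - \<alpha>) / g)) \<le> K2 / C0 * norm x powr (-((n - \<alpha>) / g))"
      using C0 by (intro mult_right_mono divide_right_mono) auto
    ultimately show "min K1 K2 / C0 * norm x powr (-((n - \<alpha>) / g)) \<le> v x" by simp
  qed
qed

lemma v_source_lower:
  obtains k where "k > 0" "\<And>y. 1 \<le> norm y \<Longrightarrow> k * norm y powr (- (p * ((n - \<alpha>) / g) - \<sigma>\<^sub>2)) \<le> norm y powr \<sigma>\<^sub>2 * u y powr p"
proof -
  define N where "N = (n - \<alpha>) / g"
  obtain k where k: "k > 0" "\<And>x. 1 \<le> norm x \<Longrightarrow> k * norm x powr (-N) \<le> u x"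
    by (rule uv_lower[folded N_def]) (rule that; blast)
  have "k powr p * norm y powr (-(p * N - \<sigma>\<^sub>2)) \<le> norm y powr \<sigma>\<^sub>2 * u y powr p" if y: "1 \<le> norm y" for y
  proof -
    have "k powr p * norm y powr (-(p * N - \<sigma>\<^sub>2)) = norm y powr \<sigma>\<^sub>2 * (k * norm y powr (-N)) powr p"
    proof -
      have "norm y powr (-(p * N - \<sigma>\<^sub>2)) = norm y powr \<sigma>\<^sub>2 * norm y powr (-N * p)" by (simp add: powr_add[symmetric] mult.commute)
      then show ?thesis by (simp add: powr_mult powr_powr)
    qed
    also have "\<dots> \<le> norm y powr \<sigma>\<^sub>2 * u y powr p" using k y pq by (intro mult_left_mono powr_mono2) auto
    finally show ?thesis .
  qed
  then show ?thesis using that[of "k powr p"] k unfolding N_def by simp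
qed

lemma v_lower_log:
  assumes "p * ((n - \<alpha>) / g) - \<sigma>\<^sub>2 = n"
  obtains k where "k > 0" "\<And>x. 4 \<le> norm x \<Longrightarrow> k * (norm x powr (- ((n - \<alpha>) / g)) * ln (norm x) powr (1 / g)) \<le> v x"
proof -
  obtain C0 where C0: "C0 > 0" "\<And>x. 1 / C0 \<le> c\<^sub>2 x"
    by (rule c_bounds) (rule that; blast)
  obtain m where m: "m > 0" "\<And>y. 1 \<le> norm y \<Longrightarrow> m * norm y powr (-real CARD('n)) \<le> norm y powr \<sigma>\<^sub>2 * u y powr p"
    by (rule v_source_lower[unfolded assms, unfolded n_def]) (rule that; blast)
  obtain K where K: "K > 0" "\<And>x. 4 \<le> norm x \<Longrightarrow> ennreal (K * (norm x powr (-((n - \<alpha>) / g)) * ln (norm x) powr (1 / g))) \<le>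
      wolff_potential \<beta> \<gamma> (\<lambda>y. norm y powr \<sigma>\<^sub>2 * u y powr p) x"
    using wolff_ge_log[OF \<beta>(2) \<gamma>(1) m(2,1)] unfolding n_def \<alpha>_def g_def by blast
  show ?thesis
  proof (rule that[of "K / C0"])
    fix x :: "real^'n" assume x: "4 \<le> norm x"
    show "K / C0 * (norm x powr (-((n - \<alpha>) / g)) * ln (norm x) powr (1 / g)) \<le> v x"
      using le_solution[OF v_eq C0 K(2)[OF x]] uv_pos(2)[of x] K by simp
  qed (use K C0 in simp)
qed

lemma v_lower_intermediate:
  obtains k where "k > 0" "\<And>x. 2 \<le> norm x \<Longrightarrow> k * norm x powr (- ((p * ((n - \<alpha>) / g) - (\<alpha> + \<sigma>\<^sub>2)) / g)) \<le> v x"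
proof -
  define e where "e = p * ((n - \<alpha>) / g) - \<sigma>\<^sub>2"
  obtain C0 where C0: "C0 > 0" "\<And>x. 1 / C0 \<le> c\<^sub>2 x"
    by (rule c_bounds) (rule that; blast)
  obtain m where m: "m > 0" "\<And>y. 1 \<le> norm y \<Longrightarrow> m * norm y powr (-e) \<le> norm y powr \<sigma>\<^sub>2 * u y powr p"
    by (rule v_source_lower[folded e_def]) (rule that; blast)
  \<comment> \<open>This leads to e >= p q0 - \<open>\<sigma>\<^sub>2\<close> = g p0 + \<alpha> >
    \<alpha>, so the rate (e - \<alpha>)/g in the Wolff lower bound is positive.\<close>
  have "g * q0 \<le> n - \<alpha>"
    using exponents(5) mult_pos_pos[OF g(1) exponents(2)] by (simp add: distrib_left)
  then have "q0 \<le> (n - \<alpha>) / g" using g by (simp add: pos_le_divide_eq mult.commute)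
  then have "p * q0 \<le> p * ((n - \<alpha>) / g)" using pq by (intro mult_left_mono) auto
  then have e: "\<alpha> < e" using exponents(4) mult_pos_pos[OF g(1) exponents(2)] unfolding e_def by linarith
  have e0: "0 \<le> e" using e \<alpha> by simp
  obtain K where K: "K > 0" "\<And>x. 2 \<le> norm x \<Longrightarrow> ennreal (K * norm x powr (-((e - \<alpha>) / g))) \<le>
      wolff_potential \<beta> \<gamma> (\<lambda>y. norm y powr \<sigma>\<^sub>2 * u y powr p) x"
    using wolff_ge_intermediate[OF \<gamma>(1) m(2,1) e[unfolded \<alpha>_def] e0] unfolding \<alpha>_def g_def by blast
  have ee: "p * ((n - \<alpha>) / g) - (\<alpha> + \<sigma>\<^sub>2) = e - \<alpha>" by (simp add: e_def)
  show ?thesis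
  proof (rule that[of "K / C0"])
    fix x :: "real^'n" assume x: "2 \<le> norm x"
    show "K / C0 * norm x powr (- ((p * ((n - \<alpha>) / g) - (\<alpha> + \<sigma>\<^sub>2)) / g)) \<le> v x"
      unfolding ee using le_solution[OF v_eq C0 K(2)[OF x]] uv_pos(2)[of x] K by simp
  qed (use K C0 in simp)
qed

text \<open>The upper bounds are those of \<open>U\<close> and \<open>V\<close> raised to 1/g, which
  also produces the power of the logarithm. The lower bounds come from the equations alone.\<close>

lemma integrable_imp_decay:
  assumes uL: "in_Lp (n / q0) u" and vL: "in_Lp (n / p0) v"
  shows "bounded (range u)" "bounded (range v)"
    and "u \<simeq> (\<lambda>x. norm x powr (- ((n - \<alpha>) / g)))"
    and "n < p * ((n - \<alpha>) / g) - \<sigma>\<^sub>2 \<Longrightarrow> v \<simeq> (\<lambda>x. norm x powr (- ((n - \<alpha>) / g)))"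
    and "p * ((n - \<alpha>) / g) - \<sigma>\<^sub>2 = n \<Longrightarrow> v \<simeq> (\<lambda>x. norm x powr (- ((n - \<alpha>) / g)) * ln (norm x) powr (1 / g))"
    and "p * ((n - \<alpha>) / g) - \<sigma>\<^sub>2 < n \<Longrightarrow> v \<simeq> (\<lambda>x. norm x powr (- ((p * ((n - \<alpha>) / g) - (\<alpha> + \<sigma>\<^sub>2)) / g)))"
proof -
  obtain C where "riesz_system \<alpha> \<sigma>\<^sub>1 \<sigma>\<^sub>2 (q / g) (p / g) (g * q0) (g * p0) C U V"
    using riesz_system_of_integrable[OF uL vL] by blast
  then interpret riesz_system \<alpha> \<sigma>\<^sub>1 \<sigma>\<^sub>2 "q / g" "p / g" "g * q0" "g * p0" C U V .
  have nn: "UV.n = n" by (simp add: UV.n_def n_def)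
  have U0: "0 \<le> U x" "0 \<le> V x" for x by (simp_all add: U_def V_def)
  have root: "w powr (1/g) \<le> K powr (1/g) * t powr (1/g)" if "0 \<le> w" "w \<le> K * t" for w K t
    using powr_mono2[of "1/g" w "K * t"] that g by (simp add: powr_mult)
  obtain M where M: "M > 0" "\<And>x. U x \<le> M" "\<And>x. V x \<le> M" using bounded_solution by blast
  have "U x powr (1/g) \<le> M powr (1/g)" "V x powr (1/g) \<le> M powr (1/g)" for x
    using M U0 g by (auto intro!: powr_mono2)
  then have "u x \<le> M powr (1/g)" "v x \<le> M powr (1/g)" for x
    using u_eq_U[of x] v_eq_V[of x] by metis+
  then show "bounded (range u)" "bounded (range v)"
    using uv_pos by (auto simp: bounded_iff intro!: exI[of _ "M powr (1/g)"] simp: less_imp_le)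
  obtain k where k: "k > 0" "\<And>x. 1 \<le> norm x \<Longrightarrow> k * norm x powr (- ((n - \<alpha>) / g)) \<le> u x"
    "\<And>x. 1 \<le> norm x \<Longrightarrow> k * norm x powr (- ((n - \<alpha>) / g)) \<le> v x" using uv_lower by blast
  obtain K where K: "K > 0" "\<And>x. x \<noteq> 0 \<Longrightarrow> U x \<le> K * norm x powr (-(n - \<alpha>))"
    using U_decay unfolding nn by blast
  have eN: "(norm x powr e) powr (1/g) = norm x powr (e / g)" for x :: "real^'n" and e by (simp add: powr_powr)
  show "u \<simeq> (\<lambda>x. norm x powr (- ((n - \<alpha>) / g)))"
  proof (rule same_rateI[OF k(1)])
    show "K powr (1/g) > 0" using K by simp
    fix x :: "real^'n" assume x: "1 \<le> norm x"
    show "k * norm x powr (- ((n - \<alpha>) / g)) \<le> u x" by (rule k(2)[OF x])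
    have "U x \<le> K * norm x powr (-(n - \<alpha>))" by (rule K(2)) (use x in auto)
    from root[OF U0(1) this] show "u x \<le> K powr (1/g) * norm x powr (- ((n - \<alpha>) / g))"
      unfolding eN minus_divide_left[symmetric] using u_eq_U[of x] by linarith
  qed
  have pe: "p / g * (n - \<alpha>) - \<sigma>\<^sub>2 = p * ((n - \<alpha>) / g) - \<sigma>\<^sub>2" by simp
  obtain L where L: "L > 0"
    "n < p * ((n - \<alpha>) / g) - \<sigma>\<^sub>2 \<Longrightarrow> \<forall>x. 3 \<le> norm x \<longrightarrow> V x \<le> L * norm x powr (\<alpha> - n)"
    "p * ((n - \<alpha>) / g) - \<sigma>\<^sub>2 = n \<Longrightarrow> \<forall>x. 3 \<le> norm x \<longrightarrow> V x \<le> L * (norm x powr (\<alpha> - n) * ln (norm x))"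
    "p * ((n - \<alpha>) / g) - \<sigma>\<^sub>2 < n \<Longrightarrow> \<forall>x. 3 \<le> norm x \<longrightarrow> V x \<le> L * norm x powr (\<alpha> - (p * ((n - \<alpha>) / g) - \<sigma>\<^sub>2))"
    using V_decay unfolding nn pe by blast
  have L': "L powr (1/g) > 0" using L by simp
  have neg: "(\<alpha> - n) / g = - ((n - \<alpha>) / g)" by (simp add: minus_divide_left)
  show "v \<simeq> (\<lambda>x. norm x powr (- ((n - \<alpha>) / g)))" if "n < p * ((n - \<alpha>) / g) - \<sigma>\<^sub>2"
  proof (rule same_rateI[OF k(1) L'])
    fix x :: "real^'n" assume x: "3 \<le> norm x"
    show "k * norm x powr (- ((n - \<alpha>) / g)) \<le> v x" by (rule k(3)) (use x in simp)
    have "V x \<le> L * norm x powr (\<alpha> - n)" using L(2)[OF that] x by blast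
    from root[OF U0(2) this] show "v x \<le> L powr (1/g) * norm x powr (- ((n - \<alpha>) / g))"
      unfolding eN neg using v_eq_V[of x] by linarith
  qed
  show "v \<simeq> (\<lambda>x. norm x powr (- ((n - \<alpha>) / g)) * ln (norm x) powr (1 / g))" if c: "p * ((n - \<alpha>) / g) - \<sigma>\<^sub>2 = n"
  proof -
    obtain k' where k': "k' > 0" "\<And>x. 4 \<le> norm x \<Longrightarrow> k' * (norm x powr (- ((n - \<alpha>) / g)) * ln (norm x) powr (1 / g)) \<le> v x"
      using v_lower_log[OF c] by blast
    show ?thesis
    proof (rule same_rateI[OF k'(1) L' k'(2)])
      fix x :: "real^'n" assume x: "4 \<le> norm x"
      have "V x \<le> L * (norm x powr (\<alpha> - n) * ln (norm x))" using L(3)[OF c] x by simp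
      from root[OF U0(2) this] show "v x \<le> L powr (1/g) * (norm x powr (- ((n - \<alpha>) / g)) * ln (norm x) powr (1 / g))"
        unfolding powr_mult eN neg using v_eq_V[of x] by linarith
    qed
  qed
  show "v \<simeq> (\<lambda>x. norm x powr (- ((p * ((n - \<alpha>) / g) - (\<alpha> + \<sigma>\<^sub>2)) / g)))" if c: "p * ((n - \<alpha>) / g) - \<sigma>\<^sub>2 < n"
  proof -
    obtain k' where k': "k' > 0" "\<And>x. 2 \<le> norm x \<Longrightarrow> k' * norm x powr (- ((p * ((n - \<alpha>) / g) - (\<alpha> + \<sigma>\<^sub>2)) / g)) \<le> v x"
      using v_lower_intermediate by blast
    have neg': "(\<alpha> - (p * ((n - \<alpha>) / g) - \<sigma>\<^sub>2)) / g = - ((p * ((n - \<alpha>) / g) - (\<alpha> + \<sigma>\<^sub>2)) / g)"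
    proof -
      have "\<alpha> - (p * ((n - \<alpha>) / g) - \<sigma>\<^sub>2) = - (p * ((n - \<alpha>) / g) - (\<alpha> + \<sigma>\<^sub>2))" by simp
      then show ?thesis by (simp only: minus_divide_left)
    qed
    show ?thesis
    proof (rule same_rateI[OF k'(1) L'])
      fix x :: "real^'n" assume x: "3 \<le> norm x"
      show "k' * norm x powr (- ((p * ((n - \<alpha>) / g) - (\<alpha> + \<sigma>\<^sub>2)) / g)) \<le> v x" by (rule k'(2)) (use x in simp)
      have "V x \<le> L * norm x powr (\<alpha> - (p * ((n - \<alpha>) / g) - \<sigma>\<^sub>2))" using L(4)[OF c] x by blast
      from root[OF U0(2) this] show "v x \<le> L powr (1/g) * norm x powr (- ((p * ((n - \<alpha>) / g) - (\<alpha> + \<sigma>\<^sub>2)) / g))"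
        unfolding eN neg' using v_eq_V[of x] by linarith
    qed
  qed
qed

end

theorem theorem1:
  fixes n :: nat
    and \<beta> \<gamma> p q \<sigma>\<^sub>1 \<sigma>\<^sub>2 :: real
    and c\<^sub>1 c\<^sub>2 u v :: "real ^ 'n \<Rightarrow> real"
  assumes "n = CARD('n)" and "n \<ge> 3"
    and "1 < \<gamma>" and "\<gamma> \<le> 2"
    and "\<beta> > 0" and "\<beta> * \<gamma> < real n"
    and "q \<ge> p" and "p > 1"
    and "- \<beta> * \<gamma> < \<sigma>\<^sub>1" and "\<sigma>\<^sub>1 \<le> \<sigma>\<^sub>2" and "\<sigma>\<^sub>2 \<le> 0"
    and "\<And>x. c\<^sub>1 x > 0" and "\<And>x. c\<^sub>2 x > 0"
    and "double_bounded c\<^sub>1" and "double_bounded c\<^sub>2"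
    and "(real n + \<sigma>\<^sub>1) / (\<gamma> - 1 + q) + (real n + \<sigma>\<^sub>2) / (\<gamma> - 1 + p)
           \<le> (real n - \<beta> * \<gamma>) / (\<gamma> - 1)"
    and "positive_solution \<beta> \<gamma> p q \<sigma>\<^sub>1 \<sigma>\<^sub>2 c\<^sub>1 c\<^sub>2 u v"
  shows "integrable_solution \<beta> \<gamma> p q \<sigma>\<^sub>1 \<sigma>\<^sub>2 c\<^sub>1 c\<^sub>2 u v \<longleftrightarrow>
     bounded (range u) \<and> bounded (range v) \<and>
     u \<simeq> (\<lambda>x. norm x powr (- ((real n - \<beta> * \<gamma>) / (\<gamma> - 1)))) \<and>
     (p * ((real n - \<beta> * \<gamma>) / (\<gamma> - 1)) - \<sigma>\<^sub>2 > real n \<longrightarrow>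
        v \<simeq> (\<lambda>x. norm x powr (- ((real n - \<beta> * \<gamma>) / (\<gamma> - 1))))) \<and>
     (p * ((real n - \<beta> * \<gamma>) / (\<gamma> - 1)) - \<sigma>\<^sub>2 = real n \<longrightarrow>
        v \<simeq> (\<lambda>x. norm x powr (- ((real n - \<beta> * \<gamma>) / (\<gamma> - 1)))
                   * ln (norm x) powr (1 / (\<gamma> - 1)))) \<and>
     (p * ((real n - \<beta> * \<gamma>) / (\<gamma> - 1)) - \<sigma>\<^sub>2 < real n \<longrightarrow>
        v \<simeq> (\<lambda>x. norm x powr
                   (- ((p * ((real n - \<beta> * \<gamma>) / (\<gamma> - 1)) - (\<beta> * \<gamma> + \<sigma>\<^sub>2)) / (\<gamma> - 1)))))"
proof -
  interpret W: wolff_system \<beta> \<gamma> p q \<sigma>\<^sub>1 \<sigma>\<^sub>2 c\<^sub>1 c\<^sub>2 u v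
    by unfold_locales (use assms in \<open>simp_all add: assms(1)[symmetric]\<close>)
  have n: "W.n = real n" using assms(1) by (simp add: W.n_def)
  \<comment> \<open>Being a positive solution is among the hypotheses, so only the two integrability
    conditions remain on the left.\<close>
  have integrable: "integrable_solution \<beta> \<gamma> p q \<sigma>\<^sub>1 \<sigma>\<^sub>2 c\<^sub>1 c\<^sub>2 u v \<longleftrightarrow> in_Lp (real n / W.q0) u \<and> in_Lp (real n / W.p0) v"
    using assms(1,17) by (simp add: integrable_solution_def W.q0_def W.p0_def)
  note decay = W.integrable_imp_decay[unfolded n W.\<alpha>_def W.g_def]
    and int = W.decay_imp_integrable[unfolded n W.\<alpha>_def W.g_def]
  show ?thesis
    unfolding integrable
    by (rule iffI; elim conjE; intro conjI impI; (rule decay | rule int); blast?)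
qed

end
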